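(* Suppose $Q\succeq0$, $R\succ0$, $W\succeq0$, $V\succ0$, $(A,W^{1/2})$ and $(A,B)$ are controllable, and $(Q^{1/2},A)$ and $(C,A)$ are observable. Then the $\mathcal{H}_\infty$ policy optimization problem of minimizing $J_{\infty,n}(\mathsf K)=\|\mathbf{T}_{zd}(\mathsf K,s)\|_{\mathcal{H}_\infty}$ over $\mathsf K\in\mathcal{C}_{n}$ is equivalent to a convex problem in the sense that $$\inf_{\mathsf K\in\mathcal{C}_{n}}J_{\infty,n}(\mathsf K)=\inf_{(\gamma,\Lambda,X,Y)\in\mathcal{F}_{\infty,\mathrm d}}\gamma.$$ Furthermore, if a non-degenerate policy $\mathsf K\in\mathcal{C}_{n}$ is a Clarke stationary point, i.e. $0\in\partial J_{\infty,n}(\mathsf K)$, then it is globally optimal, i.e. it minimizes $J_{\infty,n}$ over $\mathcal{C}_n$.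
   Context: Data: $A\in\mathbb{R}^{n\times n}$, $B\in\mathbb{R}^{n\times m}$, $C\in\mathbb{R}^{p\times n}$, symmetric $Q,W\in\mathbb{S}^n$, $R\in\mathbb{S}^m$, $V\in\mathbb{S}^p$. $\mathrm{GL}_n$ is the set of invertible real $n\times n$ matrices; $\mathbb{S}^k_{++}$ the positive definite matrices. $B_1=[W^{1/2}\ \ 0_{n\times p}]$, $B_2=B$, $C_1=\begin{bmatrix}Q^{1/2}\\ 0_{m\times n}\end{bmatrix}$, $C_2=C$, $D_{12}=\begin{bmatrix}0_{n\times m}\\ R^{1/2}\end{bmatrix}$, $D_{21}=[0_{p\times n}\ \ V^{1/2}]$. Policies are $\mathsf{K}=\begin{bmatrix}D_{\mathsf K}&C_{\mathsf K}\\ B_{\mathsf K}&A_{\mathsf K}\end{bmatrix}\in\mathbb{R}^{(m+n)\times(p+n)}$ with $D_{\mathsf K}\in\mathbb{R}^{m\times p}$, and $A_{\mathrm{cl}}(\mathsf K)=\begin{bmatrix}A+BD_{\mathsf K}C&BC_{\mathsf K}\\ B_{\mathsf K}C&A_{\mathsf K}\end{bmatrix}$, $B_{\mathrm{cl}}(\mathsf K)=\begin{bmatrix}W^{1/2}&BD_{\mathsf K}V^{1/2}\\ 0&B_{\mathsf K}V^{1/2}\end{bmatrix}$, $C_{\mathrm{cl}}(\mathsf K)=\begin{bmatrix}Q^{1/2}&0\\ R^{1/2}D_{\mathsf K}C&R^{1/2}C_{\mathsf K}\end{bmatrix}$, $D_{\mathrm{cl}}(\mathsf K)=\begin{bmatrix}0&0\\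 0&R^{1/2}D_{\mathsf K}V^{1/2}\end{bmatrix}$. $\mathcal{C}_{n}=\{\mathsf K: A_{\mathrm{cl}}(\mathsf K)\text{ is Hurwitz stable}\}$, an open set. $\mathbf{T}_{zd}(\mathsf K,s)=C_{\mathrm{cl}}(\mathsf K)(sI-A_{\mathrm{cl}}(\mathsf K))^{-1}B_{\mathrm{cl}}(\mathsf K)+D_{\mathrm{cl}}(\mathsf K)$; $\|\mathbf{T}\|_{\mathcal{H}_\infty}=\sup_{\omega\in\mathbb{R}}\sigma_{\max}(\mathbf{T}(j\omega))$. $\partial J_{\infty,n}$ is the Clarke subdifferential of the locally Lipschitz function $J_{\infty,n}$ on $\mathcal{C}_n$: $\partial f(x)=\{g:\langle g,v\rangle\le\limsup_{x'\to x,t\downarrow0}\frac{f(x'+tv)-f(x')}{t}\ \forall v\}$. For a $2n\times2n$ matrix $P$, $P_{12}$ denotes its upper-right $n\times n$ block. $\mathcal{L}_{\infty,\mathrm d}$ is the set of $(\mathsf K,\gamma,P)$ with $\mathsf K\in\mathbb{R}^{(m+n)\times(p+n)}$, $\gamma\in\mathbb{R}$, $P\in\mathbb{S}^{2n}_{++}$, $P_{12}\in\mathrm{GL}_n$, $$\begin{bmatrix}A_{\mathrm{cl}}(\mathsf K)^{\mathsf T}P+PA_{\mathrm{cl}}(\mathsf K)&PB_{\mathrm{cl}}(\mathsf K)&C_{\mathrm{cl}}(\mathsf K)^{\mathsf T}\\ B_{\mathrm{cl}}(\mathsf K)^{\mathsf T}P&-\gamma I&D_{\mathrm{cl}}(\mathsf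 K)^{\mathsf T}\\ C_{\mathrm{cl}}(\mathsf K)&D_{\mathrm{cl}}(\mathsf K)&-\gamma I\end{bmatrix}\preceq0.$$ A policy $\mathsf K\in\mathcal{C}_n$ is non-degenerate (for $\mathcal{H}_\infty$ control) if there exists $P\in\mathbb{S}^{2n}_{++}$ with $P_{12}\in\mathrm{GL}_n$ such that $(\mathsf K,J_{\infty,n}(\mathsf K),P)\in\mathcal{L}_{\infty,\mathrm d}$. $\mathcal{F}_{\infty,\mathrm d}$ is the convex set of $(\gamma,\Lambda,X,Y)$ with $\gamma\in\mathbb{R}$, $\Lambda=\begin{bmatrix}G&F\\ H&M\end{bmatrix}\in\mathbb{R}^{(m+n)\times(p+n)}$ ($G\in\mathbb{R}^{m\times p}$), $\begin{bmatrix}X&I\\ I&Y\end{bmatrix}\in\mathbb{S}^{2n}_{++}$ ($X,Y\in\mathbb{S}^n$), and ($*$ denotes symmetric completion) $$\begin{bmatrix}AX+B_2F+(AX+B_2F)^{\mathsf T}&M^{\mathsf T}+A+B_2GC_2&B_1+B_2GD_{21}&(C_1X+D_{12}F)^{\mathsf T}\\ *&YA+HC_2+(YA+HC_2)^{\mathsf T}&YB_1+HD_{21}&(C_1+D_{12}GC_2)^{\mathsf T}\\ *&*&-\gamma I&(D_{12}GD_{21})^{\mathsf T}\\ *&*&*&-\gamma I\end{bmatrix}\preceq0.$$ *)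

theory Defs
  imports "HOL-Analysis.Analysis"
begin

section \<open>Block matrices\<close>

text \<open>
  A block matrix is indexed by sum types, the first block row (column) being the
  \<open>Inl\<close> part. Recall that \<open>real ^ 'c ^ 'r\<close> has rows indexed by \<open>'r\<close> and columns by \<open>'c\<close>.
\<close>

definition hcat :: "'a ^ 'c::finite ^ 'r::finite \<Rightarrow> 'a ^ 'd::finite ^ 'r \<Rightarrow> 'a ^ ('c + 'd) ^ 'r" where
  "hcat M N = (\<chi> i j. case j of Inl k \<Rightarrow> M $ i $ k | Inr k \<Rightarrow> N $ i $ k)"

definition vcat :: "'a ^ 'c::finite ^ 'r::finite \<Rightarrow> 'a ^ 'c ^ 's::finite \<Rightarrow> 'a ^ 'c ^ ('r + 's)" where
  "vcat M N = (\<chi> i. case i of Inl k \<Rightarrow> M $ k | Inr k \<Rightarrow> N $ k)"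

definition block2 :: "'a ^ 'c::finite ^ 'r::finite \<Rightarrow> 'a ^ 'd::finite ^ 'r \<Rightarrow>
    'a ^ 'c ^ 's::finite \<Rightarrow> 'a ^ 'd ^ 's \<Rightarrow> 'a ^ ('c + 'd) ^ ('r + 's)" where
  "block2 M11 M12 M21 M22 = vcat (hcat M11 M12) (hcat M21 M22)"

definition sub11 :: "'a ^ ('c::finite + 'd::finite) ^ ('r::finite + 's::finite) \<Rightarrow> 'a ^ 'c ^ 'r" where
  "sub11 M = (\<chi> i j. M $ Inl i $ Inl j)"

definition sub12 :: "'a ^ ('c::finite + 'd::finite) ^ ('r::finite + 's::finite) \<Rightarrow> 'a ^ 'd ^ 'r" where
  "sub12 M = (\<chi> i j. M $ Inl i $ Inr j)"

definition sub21 :: "'a ^ ('c::finite + 'd::finite) ^ ('r::finite + 's::finite) \<Rightarrow> 'a ^ 'c ^ 's" where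
  "sub21 M = (\<chi> i j. M $ Inr i $ Inl j)"

definition sub22 :: "'a ^ ('c::finite + 'd::finite) ^ ('r::finite + 's::finite) \<Rightarrow> 'a ^ 'd ^ 's" where
  "sub22 M = (\<chi> i j. M $ Inr i $ Inr j)"

text \<open>Symmetric completions: only the blocks on and above the diagonal are given.\<close>

definition sym_block3 where
  "sym_block3 M11 M12 M13 M22 M23 M33 =
     block2 M11 (hcat M12 M13)
            (transpose (hcat M12 M13)) (block2 M22 M23 (transpose M23) M33)"

definition sym_block4 where
  "sym_block4 M11 M12 M13 M14 M22 M23 M24 M33 M34 M44 =
     block2 M11 (hcat M12 (hcat M13 M14))
            (transpose (hcat M12 (hcat M13 M14))) (sym_block3 M22 M23 M24 M33 M34 M44)"

section \<open>Definite matrices, eigenvalues, singular values\<close>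

definition pos_semidef :: "real ^ 'n ^ 'n \<Rightarrow> bool" where
  "pos_semidef M \<longleftrightarrow> transpose M = M \<and> (\<forall>x. 0 \<le> x \<bullet> (M *v x))"

definition pos_def :: "real ^ 'n ^ 'n \<Rightarrow> bool" where
  "pos_def M \<longleftrightarrow> transpose M = M \<and> (\<forall>x. x \<noteq> 0 \<longrightarrow> 0 < x \<bullet> (M *v x))"

definition neg_semidef :: "real ^ 'n ^ 'n \<Rightarrow> bool" where
  "neg_semidef M \<longleftrightarrow> pos_semidef (- M)"

text \<open>The positive semidefinite square root; meaningful only for positive semidefinite \<open>M\<close>.\<close>

definition msqrt :: "real ^ 'n ^ 'n \<Rightarrow> real ^ 'n ^ 'n" where
  "msqrt M = (THE S. pos_semidef S \<and> S ** S = M)"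

definition cmat :: "real ^ 'c ^ 'r \<Rightarrow> complex ^ 'c ^ 'r" where
  "cmat = map_matrix complex_of_real"

definition conj_transpose :: "complex ^ 'c ^ 'r \<Rightarrow> complex ^ 'r ^ 'c" where
  "conj_transpose M = map_matrix cnj (transpose M)"

definition eigenval :: "complex ^ 'n ^ 'n \<Rightarrow> complex \<Rightarrow> bool" where
  "eigenval M l \<longleftrightarrow> (\<exists>v. v \<noteq> 0 \<and> M *v v = l *s v)"

definition hurwitz :: "real ^ 'n ^ 'n \<Rightarrow> bool" where
  "hurwitz M \<longleftrightarrow> (\<forall>l. eigenval (cmat M) l \<longrightarrow> Re l < 0)"

definition sigma_max :: "complex ^ 'c ^ 'r \<Rightarrow> real" where
  "sigma_max M =
     Max {s. 0 \<le> s \<and> eigenval (conj_transpose M ** M) (complex_of_real (s\<^sup>2))}"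

section \<open>Controllability and observability\<close>

text \<open>\<open>M ^ k\<close> on type \<open>real ^ 'n ^ 'n\<close> is the entrywise power, hence the following.\<close>

definition matpow :: "real ^ 'n ^ 'n \<Rightarrow> nat \<Rightarrow> real ^ 'n ^ 'n" where
  "matpow M k = (((**) M) ^^ k) (mat 1)"

text \<open>
  Kalman's rank conditions: the matrix \<open>[B, AB, \<dots>, A\<^sup>n\<^sup>-\<^sup>1 B]\<close> has (column) rank \<open>n\<close>,
  respectively the matrix with block rows \<open>C, CA, \<dots>, CA\<^sup>n\<^sup>-\<^sup>1\<close> has (row) rank \<open>n\<close>.
\<close>

definition controllable :: "real ^ 'n ^ 'n \<Rightarrow> real ^ 'm ^ 'n \<Rightarrow> bool" where
  "controllable A B \<longleftrightarrow> dim (\<Union>k<CARD('n). columns (matpow A k ** B)) = CARD('n)"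

definition observable :: "real ^ 'n ^ 'p \<Rightarrow> real ^ 'n ^ 'n \<Rightarrow> bool" where
  "observable C A \<longleftrightarrow> dim (\<Union>k<CARD('n). rows (C ** matpow A k)) = CARD('n)"

section \<open>Clarke subdifferential\<close>

text \<open>
  Only the values of \<open>f\<close> near \<open>x\<close> matter, so for a function of interest on an open
  set containing \<open>x\<close> the values outside that set are irrelevant.
\<close>

definition clarke_deriv :: "('a::real_normed_vector \<Rightarrow> real) \<Rightarrow> 'a \<Rightarrow> 'a \<Rightarrow> ereal" where
  "clarke_deriv f x v =
     Limsup (nhds x \<times>\<^sub>F at_right 0) (\<lambda>(y, t). ereal ((f (y + t *\<^sub>R v) - f y) / t))"

definition clarke_subdiff :: "('a::real_inner \<Rightarrow> real) \<Rightarrow> 'a \<Rightarrow> 'a set" where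
  "clarke_subdiff f x = {g. \<forall>v. ereal (g \<bullet> v) \<le> clarke_deriv f x v}"

section \<open>Closed-loop system and \<open>H\<^sub>\<infinity>\<close> cost\<close>

text \<open>
  The state, input and output dimensions are the cardinalities of \<open>'n\<close>, \<open>'m\<close>, \<open>'p\<close>.
  A policy \<open>K\<close> has blocks \<open>sub11 K = D\<^sub>K\<close>, \<open>sub12 K = C\<^sub>K\<close>, \<open>sub21 K = B\<^sub>K\<close>, \<open>sub22 K = A\<^sub>K\<close>.
\<close>

type_synonym ('n, 'm, 'p) policy = "real ^ ('p + 'n) ^ ('m + 'n)"

definition Acl :: "real ^ 'n::finite ^ 'n \<Rightarrow> real ^ 'm::finite ^ 'n \<Rightarrow> real ^ 'n ^ 'p::finite \<Rightarrow>
    ('n, 'm, 'p) policy \<Rightarrow> real ^ ('n + 'n) ^ ('n + 'n)" where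
  "Acl A B C K = block2 (A + B ** sub11 K ** C) (B ** sub12 K)
                        (sub21 K ** C)          (sub22 K)"

definition Bcl :: "real ^ 'm::finite ^ 'n::finite \<Rightarrow> real ^ 'n ^ 'n \<Rightarrow> real ^ 'p::finite ^ 'p \<Rightarrow>
    ('n, 'm, 'p) policy \<Rightarrow> real ^ ('n + 'p) ^ ('n + 'n)" where
  "Bcl B W V K = block2 (msqrt W) (B ** sub11 K ** msqrt V)
                        0         (sub21 K ** msqrt V)"

definition Ccl :: "real ^ 'n::finite ^ 'p::finite \<Rightarrow> real ^ 'n ^ 'n \<Rightarrow> real ^ 'm::finite ^ 'm \<Rightarrow>
    ('n, 'm, 'p) policy \<Rightarrow> real ^ ('n + 'n) ^ ('n + 'm)" where
  "Ccl C Q R K = block2 (msqrt Q)                   0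
                        (msqrt R ** sub11 K ** C)   (msqrt R ** sub12 K)"

definition Dcl :: "real ^ 'm::finite ^ 'm \<Rightarrow> real ^ 'p::finite ^ 'p \<Rightarrow>
    ('n::finite, 'm, 'p) policy \<Rightarrow> real ^ ('n + 'p) ^ ('n + 'm)" where
  "Dcl R V K = block2 0 0
                      0 (msqrt R ** sub11 K ** msqrt V)"

definition stabilizing :: "real ^ 'n::finite ^ 'n \<Rightarrow> real ^ 'm::finite ^ 'n \<Rightarrow>
    real ^ 'n ^ 'p::finite \<Rightarrow> ('n, 'm, 'p) policy set" where
  "stabilizing A B C = {K. hurwitz (Acl A B C K)}"

definition Tzd :: "real ^ 'n::finite ^ 'n \<Rightarrow> real ^ 'm::finite ^ 'n \<Rightarrow> real ^ 'n ^ 'p::finite \<Rightarrow>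
    real ^ 'n ^ 'n \<Rightarrow> real ^ 'm ^ 'm \<Rightarrow> real ^ 'n ^ 'n \<Rightarrow> real ^ 'p ^ 'p \<Rightarrow>
    ('n, 'm, 'p) policy \<Rightarrow> complex \<Rightarrow> complex ^ ('n + 'p) ^ ('n + 'm)" where
  "Tzd A B C Q R W V K s =
     cmat (Ccl C Q R K) ** matrix_inv (mat s - cmat (Acl A B C K)) ** cmat (Bcl B W V K)
     + cmat (Dcl R V K)"

text \<open>
  The supremum is that of a bounded set when \<open>T\<close> is a stable proper transfer matrix,
  in particular for the transfer matrices of stabilizing policies.
\<close>

definition hinf_norm :: "(complex \<Rightarrow> complex ^ 'c ^ 'r) \<Rightarrow> real" where
  "hinf_norm T = (SUP w. sigma_max (T (\<i> * complex_of_real w)))"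

definition Jinf :: "real ^ 'n::finite ^ 'n \<Rightarrow> real ^ 'm::finite ^ 'n \<Rightarrow> real ^ 'n ^ 'p::finite \<Rightarrow>
    real ^ 'n ^ 'n \<Rightarrow> real ^ 'm ^ 'm \<Rightarrow> real ^ 'n ^ 'n \<Rightarrow> real ^ 'p ^ 'p \<Rightarrow>
    ('n, 'm, 'p) policy \<Rightarrow> real" where
  "Jinf A B C Q R W V K = hinf_norm (Tzd A B C Q R W V K)"

section \<open>Lifted set, non-degenerate policies, convex reformulation\<close>

definition Linf_d :: "real ^ 'n::finite ^ 'n \<Rightarrow> real ^ 'm::finite ^ 'n \<Rightarrow> real ^ 'n ^ 'p::finite \<Rightarrow>
    real ^ 'n ^ 'n \<Rightarrow> real ^ 'm ^ 'm \<Rightarrow> real ^ 'n ^ 'n \<Rightarrow> real ^ 'p ^ 'p \<Rightarrow>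
    (('n, 'm, 'p) policy \<times> real \<times> (real ^ ('n + 'n) ^ ('n + 'n))) set" where
  "Linf_d A B C Q R W V = {(K, \<gamma>, P). pos_def P \<and> invertible (sub12 P) \<and>
     neg_semidef (sym_block3
       (transpose (Acl A B C K) ** P + P ** Acl A B C K)
         (P ** Bcl B W V K) (transpose (Ccl C Q R K))
       (mat (- \<gamma>)) (transpose (Dcl R V K))
       (mat (- \<gamma>)))}"

definition nondegenerate :: "real ^ 'n::finite ^ 'n \<Rightarrow> real ^ 'm::finite ^ 'n \<Rightarrow>
    real ^ 'n ^ 'p::finite \<Rightarrow>
    real ^ 'n ^ 'n \<Rightarrow> real ^ 'm ^ 'm \<Rightarrow> real ^ 'n ^ 'n \<Rightarrow> real ^ 'p ^ 'p \<Rightarrow>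
    ('n, 'm, 'p) policy \<Rightarrow> bool" where
  "nondegenerate A B C Q R W V K \<longleftrightarrow> K \<in> stabilizing A B C \<and>
     (\<exists>P. pos_def P \<and> invertible (sub12 P) \<and>
          (K, Jinf A B C Q R W V K, P) \<in> Linf_d A B C Q R W V)"

definition B1mat :: "real ^ 'n::finite ^ 'n \<Rightarrow> real ^ ('n + 'p::finite) ^ 'n" where
  "B1mat W = hcat (msqrt W) 0"

definition C1mat :: "real ^ 'n::finite ^ 'n \<Rightarrow> real ^ 'n ^ ('n + 'm::finite)" where
  "C1mat Q = vcat (msqrt Q) 0"

definition D12mat :: "real ^ 'm::finite ^ 'm \<Rightarrow> real ^ 'm ^ ('n::finite + 'm)" where
  "D12mat R = vcat 0 (msqrt R)"

definition D21mat :: "real ^ 'p::finite ^ 'p \<Rightarrow> real ^ ('n::finite + 'p) ^ 'p" where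
  "D21mat V = hcat 0 (msqrt V)"

text \<open>The blocks of \<open>\<Lambda>\<close> are \<open>G\<close>, \<open>F\<close> (upper row) and \<open>H\<close>, \<open>M\<close> (lower row).\<close>

definition Finf_d :: "real ^ 'n::finite ^ 'n \<Rightarrow> real ^ 'm::finite ^ 'n \<Rightarrow> real ^ 'n ^ 'p::finite \<Rightarrow>
    real ^ 'n ^ 'n \<Rightarrow> real ^ 'm ^ 'm \<Rightarrow> real ^ 'n ^ 'n \<Rightarrow> real ^ 'p ^ 'p \<Rightarrow>
    (real \<times> (real ^ ('p + 'n) ^ ('m + 'n)) \<times> (real ^ 'n ^ 'n) \<times> (real ^ 'n ^ 'n)) set" where
  "Finf_d A B C Q R W V = {(\<gamma>, \<Lambda>, X, Y).
     let G = sub11 \<Lambda>; F = sub12 \<Lambda>; H = sub21 \<Lambda>; M = sub22 \<Lambda>;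
         B1 = (B1mat W :: real ^ ('n + 'p) ^ 'n);
         C1 = (C1mat Q :: real ^ 'n ^ ('n + 'm));
         D12 = (D12mat R :: real ^ 'm ^ ('n + 'm));
         D21 = (D21mat V :: real ^ ('n + 'p) ^ 'p)
     in transpose X = X \<and> transpose Y = Y \<and>
        pos_def (block2 X (mat 1) (mat 1) Y) \<and>
        neg_semidef (sym_block4
          (A ** X + B ** F + transpose (A ** X + B ** F))
            (transpose M + A + B ** G ** C) (B1 + B ** G ** D21) (transpose (C1 ** X + D12 ** F))
          (Y ** A + H ** C + transpose (Y ** A + H ** C))
            (Y ** B1 + H ** D21) (transpose (C1 + D12 ** G ** C))
          (mat (- \<gamma>)) (transpose (D12 ** G ** D21))
          (mat (- \<gamma>)))}"

end

theory Submission
  imports Defs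
begin

text \<open>
  Why the theorem holds. A certificate for a policy \<open>K\<close> at level \<open>\<gamma>\<close> is a positive definite matrix \<open>P\<close>
  that satisfies the bounded real matrix inequality. The inequality is bilinear in \<open>(K, P)\<close>, but if
  \<open>P\<^sub>1\<^sub>2\<close> is invertible, a congruence built from the blocks of \<open>P\<close> and of its inverse turns it into the
  linear matrix inequality of the convex problem (\<open>brl_form_coordinates\<close>). Conversely, a point of the
  convex problem and any invertible matrix \<open>U\<close> determine a policy with a certificate.

  Every point \<open>(\<gamma>, \<Lambda>, X, Y)\<close> of the convex problem yields a stabilizing policy of cost at most \<open>\<gamma>\<close>
  (\<open>convex_point_to_policy\<close>). The matrix inequality alone only excludes eigenvalues in the open right
  half plane; modes on the imaginary axis are excluded by observability of \<open>(Q\<^sup>1\<^sup>/\<^sup>2, A)\<close>,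
  controllability of \<open>(A, W\<^sup>1\<^sup>/\<^sup>2)\<close> and invertibility of \<open>P\<^sub>1\<^sub>2\<close> (\<open>lifted_policy_stabilizing\<close>).

  Every level strictly above the cost of a stabilizing policy is attained in the convex problem
  (\<open>policy_to_convex_point\<close>). This is the hard half of the bounded real lemma. It follows from the
  strict Kalman--Yakubovich--Popov lemma (\<open>kyp_strict\<close>), which is proved by separating a compact
  convex set: a dual certificate is a positive semidefinite matrix, and one that is optimal could be
  improved by subtracting a rank-one part belonging to a single frequency. Lyapunov's theorem, which
  makes the certificate positive definite, is obtained from the same lemma by a homotopy. A small
  perturbation makes \<open>P\<^sub>1\<^sub>2\<close> invertible. The two halves together give the equality of the infima.

  For the last claim, a non-degenerate policy \<open>K\<close> corresponds to a point of the convex problem at its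
  exact cost. If some policy were strictly better, the segment towards a better convex point would
  give a curve of policies, starting at \<open>K\<close> with a tangent, along which the cost decreases at a
  linear rate. To contradict Clarke stationarity this descent has to persist at all nearby base
  points. That holds because the cost is a supremum of norms of responses which, uniformly in the
  frequency, depend on the policy affinely up to a second-order error; hence the cost is Lipschitz
  and weakly convex near \<open>K\<close>
  (\<open>cost_lipschitz_weakly_convex\<close>, \<open>descent_curve_not_stationary\<close>).
\<close>

section \<open>Self-adjoint operators\<close>

lemma linear_bound_all_small:
  fixes n c :: real
  assumes "\<And>s. 0 < s \<Longrightarrow> 2 * n \<le> s * c" and "0 \<le> n"
  shows "n = 0"
proof (cases "c > 0")
  case True
  have "2 * n \<le> n / c * c" if "n > 0"
    using assms(1)[of "n / c"] that True by simp
  then show ?thesis using assms(2) True by (cases "n > 0") auto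
next
  case False
  then show ?thesis using assms(1)[of 1] assms(2) by simp
qed

text \<open>Only an invariant subspace is assumed, so that eigenvectors can be split off one by one.\<close>

lemma psd_null_vector:
  fixes f :: "'a::euclidean_space \<Rightarrow> 'a"
  assumes S: "subspace S" and lin: "linear f" and inv: "\<And>x. x \<in> S \<Longrightarrow> f x \<in> S"
    and sa: "\<And>x y. f x \<bullet> y = x \<bullet> f y"
    and psd: "\<And>x. x \<in> S \<Longrightarrow> 0 \<le> x \<bullet> f x"
    and x: "x \<in> S" "x \<bullet> f x = 0"
  shows "f x = 0"
proof -
  let ?y = "f x"
  have "2 * (?y \<bullet> ?y) \<le> s * (?y \<bullet> f ?y)" if "0 < s" for s
  proof -
    have "x - s *\<^sub>R ?y \<in> S" using S x inv by (simp add: subspace_diff subspace_scale)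
    from psd[OF this] have "0 \<le> (x - s *\<^sub>R ?y) \<bullet> (f x - s *\<^sub>R f ?y)"
      using lin by (simp add: linear_diff linear_scale)
    also have "\<dots> = - s * (2 * (?y \<bullet> ?y)) + s * (s * (?y \<bullet> f ?y))"
      using x(2) sa[of x ?y] by (simp add: algebra_simps inner_commute)
    finally have "s * (2 * (?y \<bullet> ?y)) \<le> s * (s * (?y \<bullet> f ?y))" by simp
    then show ?thesis using that by (simp add: mult_le_cancel_left_pos)
  qed
  from linear_bound_all_small[OF this] show ?thesis by simp
qed

text \<open>
  The largest eigenvalue of a definite pencil: if \<open>p\<close> is positive semidefinite and nonzero and
  \<open>q\<close> vanishes on the kernel of \<open>p\<close>, then the maximum of the Rayleigh quotient of \<open>q\<close> relative
  to \<open>p\<close> is attained, at a generalised eigenvector.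
\<close>

lemma self_adjoint_pencil:
  fixes p q :: "'a::euclidean_space \<Rightarrow> 'a"
  assumes linp: "linear p" and sap: "\<And>x y. p x \<bullet> y = x \<bullet> p y"
    and psd: "\<And>x. 0 \<le> x \<bullet> p x" and ne: "p z \<noteq> 0"
    and linq: "linear q" and saq: "\<And>x y. q x \<bullet> y = x \<bullet> q y"
    and ker: "\<And>x. p x = 0 \<Longrightarrow> q x = 0"
  obtains l x where "p x \<noteq> 0" and "q x = l *\<^sub>R p x" and "\<And>y. y \<bullet> q y \<le> l * (y \<bullet> p y)"
proof -
  let ?S = "range p \<inter> sphere 0 1"
  have sub: "subspace (range p)"
    using linp by (simp add: linear_subspace_image subspace_UNIV)
  have "compact ?S"
    using closed_subspace[OF sub] by (simp add: closed_Int_compact)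
  moreover have "?S \<noteq> {}"
  proof -
    have "p z /\<^sub>R norm (p z) \<in> ?S" using ne sub by (simp add: subspace_scale)
    then show ?thesis by blast
  qed
  moreover have pos: "x \<bullet> p x > 0" if "x \<in> range p" "x \<noteq> 0" for x
  proof -
    have "x \<bullet> p x \<noteq> 0"
    proof
      assume "x \<bullet> p x = 0"
      then have px: "p x = 0"
        using psd_null_vector[of UNIV p x] linp sap psd by (simp add: subspace_UNIV)
      from that obtain y where "x = p y" by auto
      then have "x \<bullet> x = y \<bullet> p x" using sap by metis
      then show False using px that by simp
    qed
    then show ?thesis using psd[of x] by linarith
  qed
  have nz: "x \<bullet> p x \<noteq> 0" if "x \<in> ?S" for x
  proof -
    have "x \<noteq> 0" using that by auto
    then show ?thesis using pos[of x] that by auto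
  qed
  have "continuous_on ?S (\<lambda>x. (x \<bullet> q x) / (x \<bullet> p x))"
    using linp linq nz
    by (intro continuous_on_divide continuous_on_inner continuous_on_id
        linear_continuous_on linear_linear[THEN iffD2]) (assumption | blast)+
  then obtain x where x: "x \<in> ?S"
    and mx: "\<And>y. y \<in> ?S \<Longrightarrow> (y \<bullet> q y) / (y \<bullet> p y) \<le> (x \<bullet> q x) / (x \<bullet> p x)"
    using continuous_attains_sup[OF \<open>compact ?S\<close> \<open>?S \<noteq> {}\<close>, of "\<lambda>x. (x \<bullet> q x) / (x \<bullet> p x)"]
    by blast
  define l where "l = (x \<bullet> q x) / (x \<bullet> p x)"
  have xpos: "x \<bullet> p x > 0" using x pos by force
  define h where "h y = l *\<^sub>R p y - q y" for y
  have linh: "linear h" unfolding h_def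
    by (intro linear_compose_sub linear_compose_scale_right linp linq)
  have sah: "h x \<bullet> y = x \<bullet> h y" for x y
    by (simp add: h_def inner_diff_left inner_diff_right sap saq)
  have on_range: "0 \<le> y \<bullet> h y" if "y \<in> range p" for y
  proof (cases "y = 0")
    case False
    define u where "u = y /\<^sub>R norm y"
    have u: "u \<in> ?S" using False that sub by (simp add: u_def subspace_scale)
    have "(u \<bullet> q u) \<le> l * (u \<bullet> p u)"
      using mx[OF u] pos[of u] u by (force simp: l_def[symmetric] divide_simps)
    then have "0 \<le> u \<bullet> h u" by (simp add: h_def inner_diff_right)
    moreover have "y = norm y *\<^sub>R u" using False by (simp add: u_def)
    then have "y \<bullet> h y = (norm y)\<^sup>2 * (u \<bullet> h u)"
      by (metis inner_scaleR_left inner_scaleR_right linear_scale[OF linh] mult.assoc power2_eq_square)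
    ultimately show ?thesis by simp
  qed simp
  have hk: "h k = 0" if "p k = 0" for k using that ker by (simp add: h_def)
  have all: "0 \<le> y \<bullet> h y" for y
  proof -
    obtain r k where y: "y = r + k" and r: "r \<in> span (range p)"
      and k: "\<And>w. w \<in> span (range p) \<Longrightarrow> orthogonal k w"
      using orthogonal_subspace_decomp_exists[of "range p" y] by metis
    have "p k \<bullet> p k = 0"
      using k[of "p (p k)"] sap by (simp add: orthogonal_def span_base)
    then have "h k = 0" by (simp add: hk)
    then have "y \<bullet> h y = (r + k) \<bullet> h r" using y linh by (simp add: linear_add)
    also have "\<dots> = r \<bullet> h r" using sah[of k r] \<open>h k = 0\<close> by (simp add: inner_add_left)
    finally show ?thesis using on_range r sub by (simp add: span_eq_iff[THEN iffD2])
  qed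
  have "x \<bullet> h x = 0" using xpos by (simp add: h_def l_def inner_diff_right)
  then have "h x = 0" using psd_null_vector[of UNIV h x] linh sah all by (simp add: subspace_UNIV)
  show thesis
  proof
    show "p x \<noteq> 0" using xpos by auto
    show "q x = l *\<^sub>R p x" using \<open>h x = 0\<close> by (simp add: h_def)
    show "y \<bullet> q y \<le> l * (y \<bullet> p y)" for y using all[of y] by (simp add: h_def inner_diff_right)
  qed
qed

lemma homogeneous_form_max:
  fixes f :: "'a::euclidean_space \<Rightarrow> real"
  assumes S: "subspace S" "S \<noteq> {0}"
    and cont: "continuous_on UNIV f" and hom: "\<And>r x. f (r *\<^sub>R x) = r\<^sup>2 * f x"
  obtains u where "u \<in> S" "norm u = 1" "\<And>x. x \<in> S \<Longrightarrow> f x \<le> f u * (norm x)\<^sup>2"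
proof -
  let ?S = "S \<inter> sphere 0 1"
  have "compact ?S" using closed_subspace[OF S(1)] by (simp add: closed_Int_compact)
  moreover have "?S \<noteq> {}"
  proof -
    obtain z where "z \<in> S" "z \<noteq> 0" using S subspace_0 by blast
    then have "z /\<^sub>R norm z \<in> ?S" using S by (simp add: subspace_scale)
    then show ?thesis by blast
  qed
  moreover have "continuous_on ?S f" using cont by (rule continuous_on_subset) simp
  ultimately obtain u where u: "u \<in> ?S" and mx: "\<And>x. x \<in> ?S \<Longrightarrow> f x \<le> f u"
    using continuous_attains_sup[of ?S f] by blast
  have "f x \<le> f u * (norm x)\<^sup>2" if "x \<in> S" for x
  proof (cases "x = 0")
    case True
    then show ?thesis using hom[of 0 0] by simp
  next
    case False
    have "f x = (norm x)\<^sup>2 * f (x /\<^sub>R norm x)" using hom[of "norm x" "x /\<^sub>R norm x"] False by simp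
    also have "\<dots> \<le> (norm x)\<^sup>2 * f u"
      using mx[of "x /\<^sub>R norm x"] that False S(1) by (simp add: mult_left_mono subspace_scale)
    finally show ?thesis by (simp add: mult.commute)
  qed
  then show thesis using u by (intro that[of u]) auto
qed

lemma self_adjoint_top_eigenvector:
  fixes f :: "'a::euclidean_space \<Rightarrow> 'a"
  assumes S: "subspace S" "S \<noteq> {0}" and lin: "linear f" and inv: "\<And>x. x \<in> S \<Longrightarrow> f x \<in> S"
    and sa: "\<And>x y. f x \<bullet> y = x \<bullet> f y"
  obtains l x where "x \<in> S" "norm x = 1" "f x = l *\<^sub>R x" "\<And>y. y \<in> S \<Longrightarrow> y \<bullet> f y \<le> l * (y \<bullet> y)"
proof -
  obtain x where x: "x \<in> S" "norm x = 1" and mx: "\<And>y. y \<in> S \<Longrightarrow> y \<bullet> f y \<le> x \<bullet> f x * (norm y)\<^sup>2"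
  proof (rule homogeneous_form_max[OF S, of "\<lambda>x. x \<bullet> f x"])
    show "continuous_on UNIV (\<lambda>x. x \<bullet> f x)"
      using lin by (intro continuous_intros linear_continuous_on linear_linear[THEN iffD2])
  qed (simp_all add: linear_scale[OF lin] power2_eq_square)
  define l where "l = x \<bullet> f x"
  have all: "y \<bullet> f y \<le> l * (y \<bullet> y)" if "y \<in> S" for y
    using mx[OF that] by (simp add: l_def power2_norm_eq_inner)
  define h where "h y = l *\<^sub>R y - f y" for y
  have linh: "linear h" unfolding h_def
    by (intro linear_compose_sub linear_compose_scale_right lin linear_ident)
  have "x \<bullet> h x = 0" using x by (simp add: h_def inner_diff_right l_def norm_eq_1)
  then have "h x = 0"
    using x inv sa all S(1)
    by (intro psd_null_vector[of S h x, OF S(1) linh])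
      (simp_all add: h_def inner_diff_right inner_diff_left subspace_diff subspace_scale)
  then show thesis using that[of x l] x all by (auto simp: h_def)
qed

lemma self_adjoint_orthonormal_eigenbasis:
  fixes f :: "'a::euclidean_space \<Rightarrow> 'a"
  assumes lin: "linear f" and sa: "\<And>x y. f x \<bullet> y = x \<bullet> f y"
    and "subspace S" and "\<And>x. x \<in> S \<Longrightarrow> f x \<in> S"
  shows "\<exists>B. pairwise orthogonal B \<and> (\<forall>b\<in>B. norm b = 1 \<and> (\<exists>l. f b = l *\<^sub>R b)) \<and> span B = S"
  using assms(3,4)
proof (induction "dim S" arbitrary: S rule: less_induct)
  case less
  show ?case
  proof (cases "S = {0}")
    case True
    then show ?thesis by (intro exI[of _ "{}"]) auto
  next
    case False
    obtain l x where x: "x \<in> S" "norm x = 1" "f x = l *\<^sub>R x"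
      using self_adjoint_top_eigenvector[OF less.prems(1) False lin less.prems(2) sa] by metis
    define T where "T = S \<inter> {y. x \<bullet> y = 0}"
    have T: "subspace T" unfolding T_def
      by (intro subspace_inter less.prems subspace_hyperplane)
    have invT: "f y \<in> T" if "y \<in> T" for y
      using that less.prems(2) sa[of x y] x by (simp add: T_def)
    have "x \<notin> T" using x by (auto simp: T_def)
    then have "T \<subset> S" using x(1) unfolding T_def by blast
    then have "dim T < dim S" using T less.prems(1)
      by (metis dim_psubset span_eq_iff)
    from less.hyps[OF this T invT] obtain B where B: "pairwise orthogonal B"
      "\<forall>b\<in>B. norm b = 1 \<and> (\<exists>l. f b = l *\<^sub>R b)" "span B = T" by blast
    have orth: "x \<bullet> b = 0" if "b \<in> B" for b
      using that B(3) span_base by (fastforce simp: T_def)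
    have "span (insert x B) = S"
    proof
      have "B \<subseteq> S" using B(3) span_superset by (fastforce simp: T_def)
      then show "span (insert x B) \<subseteq> S" using x less.prems(1) by (simp add: span_minimal)
      show "S \<subseteq> span (insert x B)"
      proof
        fix y assume y: "y \<in> S"
        have "y - (x \<bullet> y) *\<^sub>R x \<in> T"
          using x y less.prems(1)
          by (simp add: T_def subspace_diff subspace_scale inner_diff_right norm_eq_1)
        then show "y \<in> span (insert x B)" using B(3) by (auto simp: span_insert)
      qed
    qed
    moreover have "pairwise orthogonal (insert x B)"
      using B(1) orth by (auto simp: pairwise_insert orthogonal_def inner_commute)
    ultimately show ?thesis using B(2) x by (intro exI[of _ "insert x B"]) auto
  qed
qed

section \<open>Square roots of positive definite matrices\<close>

lemma inner_transpose_mult: "(transpose M *v x) \<bullet> y = x \<bullet> (M *v (y::real^'a))"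
  using dot_lmul_matrix[of x M y] by simp

lemma inner_mult_transpose: "x \<bullet> (transpose M *v y) = (M *v x) \<bullet> (y::real^'a)"
  using inner_transpose_mult[of M y x] by (simp add: inner_commute)

lemma symmetric_inner: "transpose M = M \<Longrightarrow> (M *v x) \<bullet> y = x \<bullet> (M *v (y::real^'a))"
  by (metis inner_transpose_mult)

lemma symmetricI:
  fixes M :: "real^'a^'a"
  assumes "\<And>x y. (M *v x) \<bullet> y = x \<bullet> (M *v y)" shows "transpose M = M"
proof -
  have "transpose M *v x = M *v x" for x
    by (rule vector_eq_rdot[THEN iffD1]) (simp add: dot_lmul_matrix assms)
  then show ?thesis by (simp add: matrix_eq)
qed

lemma pos_def_imp_pos_semidef: "pos_def M \<Longrightarrow> pos_semidef M"
  unfolding pos_def_def pos_semidef_def by (metis inner_zero_left less_eq_real_def)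

lemma pos_semidef_null: "pos_semidef M \<Longrightarrow> x \<bullet> (M *v x) = 0 \<Longrightarrow> M *v x = 0"
  using psd_null_vector[of UNIV "(*v) M" x]
  by (auto simp: pos_semidef_def symmetric_inner)

text \<open>An eigenvector \<open>x\<close> of \<open>S - T\<close> with nonzero eigenvalue would satisfy \<open>x \<bullet> S x + x \<bullet> T x = 0\<close>, since
  \<open>S\<^sup>2 - T\<^sup>2\<close> is the symmetrised product of \<open>S - T\<close> and \<open>S + T\<close>.\<close>

lemma pos_semidef_sqrt_unique:
  assumes S: "pos_semidef S" and T: "pos_semidef T" and eq: "S ** S = T ** T"
  shows "S = T"
proof -
  define D where "D = S - T"
  have tr: "transpose D = D" using S T
    by (simp add: D_def pos_semidef_def transpose_def vec_eq_iff)
  note sym = symmetric_inner[of S] symmetric_inner[of T] symmetric_inner[OF tr]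
  have st: "transpose S = S" "transpose T = T" using S T by (auto simp: pos_semidef_def)
  have zero: "x \<bullet> (D *v x) = 0" if x: "D *v x = l *\<^sub>R x" for x l
  proof (cases "l = 0")
    case False
    have "x \<bullet> (S *v (S *v x)) = x \<bullet> (T *v (T *v x))"
      using eq by (simp add: matrix_vector_mul_assoc)
    moreover have "x \<bullet> (S *v (S *v x)) - x \<bullet> (T *v (T *v x))
        = (D *v x) \<bullet> (S *v x) + (T *v x) \<bullet> (D *v x)"
      using sym(1)[OF st(1)] sym(2)[OF st(2)]
      by (simp add: D_def matrix_vector_mult_diff_rdistrib inner_diff_left inner_diff_right inner_commute)
    ultimately have "l * (x \<bullet> (S *v x) + x \<bullet> (T *v x)) = 0"
      using x by (simp add: inner_commute algebra_simps)
    then have "x \<bullet> (S *v x) = 0" "x \<bullet> (T *v x) = 0" using False S T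
      unfolding pos_semidef_def by (smt (verit) mult_eq_0_iff)+
    then have "D *v x = 0" using S T
      by (simp add: D_def matrix_vector_mult_diff_rdistrib pos_semidef_null)
    then show ?thesis by simp
  qed (use x in simp)
  have *: "y \<bullet> (M *v y) \<le> 0"
    if M: "transpose M = M" and z: "\<And>x l. M *v x = l *\<^sub>R x \<Longrightarrow> x \<bullet> (M *v x) = 0" for M :: "real^'a^'a" and y
  proof -
    obtain l x where x: "norm x = 1" "M *v x = l *\<^sub>R x" "\<And>y. y \<bullet> (M *v y) \<le> l * (y \<bullet> y)"
      using self_adjoint_top_eigenvector[of UNIV "(*v) M"] symmetric_inner[OF M]
      by (metis UNIV_I UNIV_not_singleton subspace_UNIV matrix_vector_mul_linear)
    then have "l = 0" using z[OF x(2)] by (simp add: norm_eq_1)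
    then show ?thesis using x(3)[of y] by simp
  qed
  have neg: "transpose (- D) = - D" using tr by (simp add: transpose_def vec_eq_iff)
  have mneg: "(- D) *v x = - (D *v x)" for x
    by (metis (no_types) add_eq_0_iff matrix_vector_mult_add_rdistrib matrix_vector_mult_0 add.right_inverse)
  have "x \<bullet> (D *v x) \<le> 0" for x using *[OF tr zero] .
  moreover have "x \<bullet> ((- D) *v x) \<le> 0" for x
    by (rule *[OF neg]) (metis zero mneg add.inverse_inverse scaleR_minus_left inner_minus_right neg_equal_0_iff_equal)
  ultimately have "x \<bullet> (D *v x) = 0" for x using mneg by (smt (verit) inner_minus_right)
  then have "pos_semidef D" using tr by (simp add: pos_semidef_def)
  then have "D *v x = 0" for x using pos_semidef_null \<open>\<And>x. x \<bullet> (D *v x) = 0\<close> by blast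
  then have "D = 0" by (simp add: matrix_eq)
  then show ?thesis by (simp add: D_def)
qed

lemma pos_semidef_sqrt_exists:
  fixes M :: "real^'a^'a"
  assumes M: "pos_semidef M"
  shows "\<exists>S. pos_semidef S \<and> S ** S = M"
proof -
  have sym: "(M *v x) \<bullet> y = x \<bullet> (M *v y)" for x y
    using M by (simp add: pos_semidef_def symmetric_inner)
  obtain B where B: "pairwise orthogonal B"
      "\<forall>b\<in>B. norm b = 1 \<and> (\<exists>l. M *v b = l *\<^sub>R b)" "span B = UNIV"
    using self_adjoint_orthonormal_eigenbasis[of "(*v) M" UNIV] sym
    by (auto simp: subspace_UNIV)
  have "0 \<notin> B" using B(2) by force
  then have fin: "finite B"
    using B(1) pairwise_orthogonal_independent independent_bound by blast
  obtain l where l: "\<And>b. b \<in> B \<Longrightarrow> M *v b = l b *\<^sub>R b" using B(2) by metis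
  have l0: "0 \<le> l b" if "b \<in> B" for b
    using M l[OF that] B(2) that unfolding pos_semidef_def
    by (metis inner_scaleR_right norm_eq_1 mult.right_neutral)
  have expand: "(\<Sum>b\<in>B. (x \<bullet> b) *\<^sub>R b) = x" for x
    using orthonormal_basis_expand[OF B(1) _ _ fin] B by auto
  have orth: "b \<bullet> c = (if b = c then 1 else 0)" if "b \<in> B" "c \<in> B" for b c
    using B that by (auto simp: norm_eq_1 pairwise_def orthogonal_def)
  define g where "g x = (\<Sum>b\<in>B. (sqrt (l b) * (x \<bullet> b)) *\<^sub>R b)" for x
  have ling: "linear g" unfolding g_def
    by (intro linear_compose_sum ballI linearI)
       (auto simp: algebra_simps inner_add_left)
  define S where "S = matrix g"
  have Sg: "S *v x = g x" for x by (simp add: S_def matrix_works ling)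
  have gb: "g x \<bullet> b = sqrt (l b) * (x \<bullet> b)" if "b \<in> B" for x b
    unfolding g_def inner_sum_left using that fin
    by (simp add: orth if_distrib cong: if_cong)
  have "S *v (S *v x) = M *v x" for x
  proof -
    have "S *v (S *v x) = (\<Sum>b\<in>B. (l b * (x \<bullet> b)) *\<^sub>R b)"
      unfolding Sg by (subst g_def) (simp add: gb l0 mult.assoc[symmetric])
    also have "\<dots> = (\<Sum>b\<in>B. (x \<bullet> b) *\<^sub>R (M *v b))" by (simp add: l mult.commute)
    also have "\<dots> = M *v (\<Sum>b\<in>B. (x \<bullet> b) *\<^sub>R b)"
      by (simp add: linear_sum[OF matrix_vector_mul_linear] linear_scale[OF matrix_vector_mul_linear])
    finally show ?thesis by (simp add: expand)
  qed
  then have "S ** S = M" by (simp add: matrix_eq matrix_vector_mul_assoc[symmetric])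
  moreover have "(S *v x) \<bullet> y = x \<bullet> (S *v y)" for x y
    unfolding Sg g_def by (simp add: inner_sum_left inner_sum_right inner_commute mult.assoc mult.left_commute mult.commute)
  then have "transpose S = S" by (rule symmetricI)
  moreover have "0 \<le> x \<bullet> (S *v x)" for x
    unfolding Sg g_def inner_sum_right using l0 by (intro sum_nonneg) (simp add: mult.assoc)
  ultimately show ?thesis by (auto simp: pos_semidef_def)
qed

lemma msqrt_properties:
  assumes "pos_semidef M"
  shows "pos_semidef (msqrt M)" and "msqrt M ** msqrt M = M"
  using theI'[of "\<lambda>S. pos_semidef S \<and> S ** S = M"] pos_semidef_sqrt_exists[OF assms]
    pos_semidef_sqrt_unique unfolding msqrt_def by metis+

lemma msqrt_pos_def_inject:
  assumes M: "pos_def M" and x: "msqrt M *v x = 0"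
  shows "x = 0"
proof -
  have "M *v x = msqrt M *v (msqrt M *v x)"
    using msqrt_properties(2)[OF pos_def_imp_pos_semidef[OF M]]
    by (simp add: matrix_vector_mul_assoc)
  then have "x \<bullet> (M *v x) = 0" using x by simp
  then show ?thesis using M by (auto simp: pos_def_def)
qed

section \<open>The largest singular value as an operator norm\<close>

text \<open>The inner product on \<open>complex^'n\<close> is the real one, the real part of the Hermitian product; it
  suffices for Hermitian matrices, whose eigenvalues are real.\<close>

lemma inner_conj_transpose:
  "(M *v x) \<bullet> y = x \<bullet> (conj_transpose M *v y)"
proof -
  have *: "a \<bullet> b = Re (a * cnj b)" for a b :: complex by (simp add: inner_complex_def)
  have "(M *v x) \<bullet> y = (\<Sum>i\<in>UNIV. \<Sum>j\<in>UNIV. Re (M $ i $ j * x $ j * cnj (y $ i)))"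
    by (simp add: inner_vec_def * matrix_vector_mult_def sum_distrib_right del: times_complex.sel)
  also have "\<dots> = (\<Sum>j\<in>UNIV. \<Sum>i\<in>UNIV. Re (M $ i $ j * x $ j * cnj (y $ i)))"
    by (rule sum.swap)
  also have "\<dots> = x \<bullet> (conj_transpose M *v y)"
    by (simp add: inner_vec_def * matrix_vector_mult_def conj_transpose_def map_matrix_def
        transpose_def sum_distrib_left cnj_sum ac_simps del: times_complex.sel)
  finally show ?thesis .
qed

lemma scaleR_eq_vector_scalar: "r *\<^sub>R (x :: complex^'n) = complex_of_real r *s x"
  by (simp add: vec_eq_iff complex_eq_iff)

lemma bounded_linear_matvec: "bounded_linear (\<lambda>x. M *v (x::'a::{euclidean_space,real_algebra_1}^'n))"
  by (simp add: linear_linear)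

lemma finite_orthogonal_family:
  fixes v :: "'b \<Rightarrow> 'a::euclidean_space"
  assumes nz: "\<And>s. s \<in> S \<Longrightarrow> v s \<noteq> 0"
    and orth: "\<And>s t. s \<in> S \<Longrightarrow> t \<in> S \<Longrightarrow> s \<noteq> t \<Longrightarrow> v s \<bullet> v t = 0"
  shows "finite S"
proof -
  have "inj_on v S"
  proof (rule inj_onI, rule ccontr)
    fix s t assume st: "s \<in> S" "t \<in> S" "v s = v t" "s \<noteq> t"
    then have "v s \<bullet> v s = 0" using orth[OF st(1,2,4)] by simp
    then show False using nz[OF st(1)] by simp
  qed
  moreover have "pairwise orthogonal (v ` S)"
    unfolding pairwise_def orthogonal_def using orth by auto
  moreover have "0 \<notin> v ` S" using nz by force
  ultimately show ?thesis
    using pairwise_orthogonal_independent independent_bound finite_imageD by blast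
qed

lemma matvec_bound:
  fixes M :: "'a::{euclidean_space,real_algebra_1}^'n^'m"
  shows "norm (M *v x) \<le> onorm (\<lambda>x. M *v x) * norm x" and "0 \<le> onorm (\<lambda>x. M *v x)"
  by (rule onorm[OF bounded_linear_matvec] onorm_pos_le[OF bounded_linear_matvec])+

text \<open>The maximum in the definition of \<open>sigma_max\<close> is taken over a finite set because eigenvectors of
  \<open>M\<^sup>* M\<close> for distinct eigenvalues are orthogonal; it is attained at a unit vector maximising \<open>norm (M x)\<close>.\<close>

lemma sigma_max_eq_onorm: "sigma_max M = onorm (\<lambda>x. M *v x)"
proof -
  let ?H = "conj_transpose M ** M"
  let ?S = "{s. 0 \<le> s \<and> eigenval ?H (complex_of_real (s\<^sup>2))}"
  have H: "x \<bullet> (?H *v y) = (M *v x) \<bullet> (M *v y)" for x y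
    by (simp add: inner_conj_transpose matrix_vector_mul_assoc[symmetric])
  have sa: "(?H *v x) \<bullet> y = x \<bullet> (?H *v y)" for x y
    by (metis H inner_commute)
  have nz: "(UNIV :: (complex^'a) set) \<noteq> {0}" by (rule UNIV_not_singleton)
  obtain l x where x: "norm x = 1" "?H *v x = l *\<^sub>R x"
    and mx: "\<And>y. y \<bullet> (?H *v y) \<le> l * (y \<bullet> y)"
    using self_adjoint_top_eigenvector[OF subspace_UNIV nz matrix_vector_mul_linear _ sa]
    by (metis UNIV_I)
  have lx: "l = (norm (M *v x))\<^sup>2"
    using x H[of x x] by (simp add: norm_eq_1 power2_norm_eq_inner)
  have bound: "norm (M *v y) \<le> norm (M *v x) * norm y" for y
    using mx[of y] unfolding H lx power2_norm_eq_inner[symmetric] power_mult_distrib[symmetric]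
    by (rule power2_le_imp_le) simp
  have on: "onorm (\<lambda>x. M *v x) = norm (M *v x)"
    using onorm_le[of "(*v) M", OF bound] onorm[OF bounded_linear_matvec, of M x] x(1) by simp
  have "finite ?S"
  proof -
    define v where "v s = (SOME v. v \<noteq> 0 \<and> ?H *v v = complex_of_real (s\<^sup>2) *s v)" for s
    have v: "v s \<noteq> 0 \<and> ?H *v v s = complex_of_real (s\<^sup>2) *s v s" if "s \<in> ?S" for s
      unfolding v_def by (rule someI_ex) (use that in \<open>simp only: eigenval_def mem_Collect_eq\<close>)
    have orth: "v s \<bullet> v t = 0" if "s \<in> ?S" "t \<in> ?S" "s \<noteq> t" for s t
    proof -
      have "s\<^sup>2 * (v s \<bullet> v t) = t\<^sup>2 * (v s \<bullet> v t)"
        using sa[of "v s" "v t"] v[OF that(1)] v[OF that(2)]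
        by (simp flip: scaleR_eq_vector_scalar del: of_real_power)
      moreover have "s\<^sup>2 \<noteq> t\<^sup>2" using that by (simp add: power2_eq_iff_nonneg)
      ultimately show ?thesis by simp
    qed
    show ?thesis by (rule finite_orthogonal_family[of ?S v]) (use v orth in blast)+
  qed
  moreover have "norm (M *v x) \<in> ?S"
    using x lx unfolding eigenval_def
    by (auto simp flip: scaleR_eq_vector_scalar simp del: of_real_power intro!: exI[of _ x])
  moreover have "s \<le> norm (M *v x)" if s: "s \<in> ?S" for s
  proof -
    obtain v where v: "v \<noteq> 0" "?H *v v = s\<^sup>2 *\<^sub>R v"
      using s unfolding eigenval_def scaleR_eq_vector_scalar by blast
    then have "s\<^sup>2 * (v \<bullet> v) \<le> l * (v \<bullet> v)" using mx[of v] by simp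
    then have "s\<^sup>2 \<le> (norm (M *v x))\<^sup>2" using v(1) lx by simp
    then show ?thesis by (rule power2_le_imp_le) simp
  qed
  ultimately have "Max ?S = norm (M *v x)" by (intro Max_eqI) auto
  then show ?thesis by (simp add: sigma_max_def on)
qed

section \<open>Complex vectors as pairs of real vectors\<close>

text \<open>The complex vector with real part \<open>a\<close> and imaginary part \<open>b\<close>.\<close>

definition cvec :: "real^'n \<Rightarrow> real^'n \<Rightarrow> complex^'n" where
  "cvec a b = (\<chi> i. Complex (a $ i) (b $ i))"

lemma cvec_cases: obtains a b where "x = cvec a b"
proof
  show "x = cvec (\<chi> i. Re (x $ i)) (\<chi> i. Im (x $ i))" by (simp add: cvec_def vec_eq_iff)
qed

lemma cvec_eq_iff: "cvec a b = cvec c d \<longleftrightarrow> a = c \<and> b = d"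
  by (auto simp: cvec_def vec_eq_iff)

lemma cvec_eq_0_iff: "cvec a b = 0 \<longleftrightarrow> a = 0 \<and> b = 0"
  by (auto simp: cvec_def vec_eq_iff complex_eq_iff)

lemma cvec_add: "cvec a b + cvec c d = cvec (a + c) (b + d)"
  by (simp add: cvec_def vec_eq_iff complex_eq_iff)

lemma cvec_diff: "cvec a b - cvec c d = cvec (a - c) (b - d)"
  by (simp add: cvec_def vec_eq_iff complex_eq_iff)

lemma norm_cvec: "(norm (cvec a b))\<^sup>2 = (norm a)\<^sup>2 + (norm b)\<^sup>2"
  unfolding power2_norm_eq_inner
  by (simp add: inner_vec_def cvec_def inner_complex_def sum.distrib)

lemma cmat_mult_cvec: "cmat M *v cvec a b = cvec (M *v a) (M *v b)"
  by (simp add: vec_eq_iff cmat_def map_matrix_def cvec_def matrix_vector_mult_def complex_eq_iff Re_sum Im_sum)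

lemma scalar_mult_cvec: "z *s cvec a b = cvec (Re z *\<^sub>R a - Im z *\<^sub>R b) (Im z *\<^sub>R a + Re z *\<^sub>R b)"
  by (simp add: vec_eq_iff cvec_def complex_eq_iff)

lemma mat_mult_vec: "mat c *v x = c *s (x :: 'a::comm_semiring_1^'n)"
  by (simp add: vec_eq_iff mat_def matrix_vector_mult_def if_distrib if_distribR cong: if_cong)

lemma cmat_add: "cmat (M + N) = cmat M + cmat N"
  by (simp add: cmat_def map_matrix_def vec_eq_iff)

lemma cmat_diff: "cmat (M - N) = cmat M - cmat N"
  by (simp add: cmat_def map_matrix_def vec_eq_iff)

lemma cmat_scaleR: "cmat (c *\<^sub>R M) = c *\<^sub>R cmat M"
  by (simp add: cmat_def map_matrix_def vec_eq_iff complex_eq_iff)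

text \<open>The matrix \<open>\<i> w I - M\<close>, whose inverse is the resolvent at frequency \<open>w\<close>.\<close>

abbreviation freq_pencil :: "real \<Rightarrow> real^'n^'n \<Rightarrow> complex^'n^'n" where
  "freq_pencil w M \<equiv> mat (\<i> * complex_of_real w) - cmat M"

lemma resolvent_mult_cvec:
  "freq_pencil w M *v cvec a b
     = cvec (- w *\<^sub>R b - M *v a) (w *\<^sub>R a - M *v b)"
  by (simp add: matrix_vector_mult_diff_rdistrib mat_mult_vec scalar_mult_cvec cmat_mult_cvec cvec_diff)

lemma hurwitz_real:
  "hurwitz M \<longleftrightarrow> (\<forall>r w a b. (a \<noteq> 0 \<or> b \<noteq> 0) \<longrightarrow> M *v a = r *\<^sub>R a - w *\<^sub>R b \<longrightarrow>
      M *v b = w *\<^sub>R a + r *\<^sub>R b \<longrightarrow> r < 0)" (is "_ = ?R")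
proof
  assume h: "hurwitz M"
  show ?R
  proof (intro allI impI)
    fix r w a b
    assume "a \<noteq> 0 \<or> b \<noteq> 0" "M *v a = r *\<^sub>R a - w *\<^sub>R b" "M *v b = w *\<^sub>R a + r *\<^sub>R b"
    then have "eigenval (cmat M) (Complex r w)" unfolding eigenval_def
      by (intro exI[of _ "cvec a b"]) (auto simp: cvec_eq_0_iff cmat_mult_cvec scalar_mult_cvec cvec_eq_iff)
    then show "r < 0" using h unfolding hurwitz_def by fastforce
  qed
next
  assume R: ?R
  show "hurwitz M" unfolding hurwitz_def
  proof (intro allI impI)
    fix l assume "eigenval (cmat M) l"
    then obtain v where v: "v \<noteq> 0" "cmat M *v v = l *s v" by (auto simp: eigenval_def)
    obtain a b where "v = cvec a b" by (rule cvec_cases)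
    with v R show "Re l < 0"
      by (auto simp: cvec_eq_0_iff cmat_mult_cvec scalar_mult_cvec cvec_eq_iff)
  qed
qed

section \<open>Resolvent bounds and transfer functions\<close>

text \<open>A uniform bound for the resolvent on the imaginary axis.\<close>

definition resolvent_bound :: "real^'n^'n \<Rightarrow> real \<Rightarrow> bool" where
  "resolvent_bound M k \<longleftrightarrow>
     0 < k \<and> (\<forall>w x. norm x \<le> k * norm (freq_pencil w M *v x))"

lemma resolvent_boundD:
  "resolvent_bound M k \<Longrightarrow> norm x \<le> k * norm (freq_pencil w M *v x)"
  by (simp add: resolvent_bound_def)

text \<open>For large \<open>w\<close> the bound is immediate; the remaining frequencies form a compact interval.\<close>

lemma resolvent_bound_exists:
  assumes nz: "\<And>w x. freq_pencil w M *v x = 0 \<Longrightarrow> x = 0"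
  shows "\<exists>k. resolvent_bound M k"
proof -
  define N where "N = onorm (\<lambda>x. cmat M *v x)"
  note N = matvec_bound[of "cmat M", folded N_def]
  define g where "g p = freq_pencil (fst p) M *v snd p" for p
  have g: "g p = fst p *\<^sub>R (mat \<i> *v snd p) - cmat M *v snd p" for p
    by (simp add: g_def matrix_vector_mult_diff_rdistrib mat_mult_vec scaleR_eq_vector_scalar mult.commute)
  let ?K = "{- (N + 1)..N + 1} \<times> sphere (0::complex^'a) 1"
  have comp: "compact ?K" by (intro compact_Times) auto
  obtain u :: "complex^'a" where "norm u = 1" using vector_choose_size[of 1] by auto
  then have ne: "?K \<noteq> {}" using N(2) by (auto intro!: exI[of _ u])
  have "continuous_on ?K (\<lambda>p. norm (g p))" unfolding g
    by (intro continuous_intros bounded_linear.continuous_on[OF bounded_linear_matvec])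
  then obtain p where p: "p \<in> ?K" and mn: "\<And>q. q \<in> ?K \<Longrightarrow> norm (g p) \<le> norm (g q)"
    using continuous_attains_inf[OF comp ne, of "\<lambda>p. norm (g p)"] by blast
  define d where "d = min 1 (norm (g p))"
  have "g p \<noteq> 0" using p nz[of "fst p" "snd p"] by (auto simp: g_def)
  then have d: "d > 0" by (simp add: d_def)
  have unit: "d \<le> norm (g (w, x))" if x: "norm x = 1" for w x
  proof (cases "\<bar>w\<bar> \<le> N + 1")
    case True
    then have "(w, x) \<in> ?K" using x by auto
    then show ?thesis using mn by (auto simp: d_def intro: min.coboundedI2)
  next
    case False
    have "norm (mat \<i> *v x) = norm x" for x :: "complex^'a"
      by (simp add: mat_mult_vec norm_vec_def norm_mult)
    then have "\<bar>w\<bar> * norm x - N * norm x \<le> norm (g (w, x))"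
      using norm_triangle_ineq2[of "w *\<^sub>R (mat \<i> *v x)" "cmat M *v x"] N(1)[of x] by (simp add: g)
    then show ?thesis using False x by (simp add: d_def)
  qed
  have "norm x \<le> 1 / d * norm (g (w, x))" for w x
  proof (cases "x = 0")
    case False
    have "g (w, x) = norm x *\<^sub>R g (w, x /\<^sub>R norm x)"
      using False by (simp add: g_def linear_scale[OF matrix_vector_mul_linear])
    then have "norm (g (w, x)) = norm x * norm (g (w, x /\<^sub>R norm x))"
      by (metis norm_scaleR abs_norm_cancel)
    moreover have "d \<le> norm (g (w, x /\<^sub>R norm x))" using unit False by simp
    ultimately have "norm x * d \<le> norm (g (w, x))" by (simp add: mult_left_mono)
    then show ?thesis using d by (simp add: field_simps)
  qed (use d in simp)
  then show ?thesis using d unfolding resolvent_bound_def g_def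
    by (intro exI[of _ "1 / d"]) simp
qed

lemma resolvent_bound_perturb:
  assumes M: "resolvent_bound M k"
    and close: "\<And>x. norm (cmat (N - M) *v x) \<le> norm x / (2 * k)"
  shows "resolvent_bound N (2 * k)"
proof -
  have k: "k > 0" using M by (simp add: resolvent_bound_def)
  have "norm x \<le> 2 * k * norm (freq_pencil w N *v x)" for w x
  proof -
    have "norm x \<le> k * norm (freq_pencil w M *v x)"
      using M by (rule resolvent_boundD)
    also have "freq_pencil w M *v x
        = freq_pencil w N *v x + cmat (N - M) *v x"
      by (simp add: cmat_diff matrix_vector_mult_diff_rdistrib)
    also have "k * norm \<dots> \<le> k * (norm (freq_pencil w N *v x) + norm x / (2 * k))"
      using k close[of x] by (intro mult_left_mono order_trans[OF norm_triangle_ineq]) auto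
    also have "\<dots> = k * norm (freq_pencil w N *v x) + norm x / 2"
      using k by (simp add: field_simps)
    finally show ?thesis by simp
  qed
  then show ?thesis using k by (simp add: resolvent_bound_def)
qed

lemma hurwitz_resolvent_bound:
  assumes "hurwitz M" shows "\<exists>k. resolvent_bound M k"
proof (rule resolvent_bound_exists)
  fix w x assume "freq_pencil w M *v x = 0"
  then have e: "cmat M *v x = (\<i> * complex_of_real w) *s x"
    by (simp add: matrix_vector_mult_diff_rdistrib mat_mult_vec)
  show "x = 0"
  proof (rule ccontr)
    assume "x \<noteq> 0"
    then have "eigenval (cmat M) (\<i> * complex_of_real w)" using e by (auto simp: eigenval_def)
    then show False using assms by (auto simp: hurwitz_def)
  qed
qed

text \<open>The transfer function of the system \<open>x' = A x + B d\<close>, \<open>z = C x + D d\<close>.\<close>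

definition transfer :: "real^'n^'n \<Rightarrow> real^'d^'n \<Rightarrow> real^'n^'z \<Rightarrow> real^'d^'z \<Rightarrow> complex \<Rightarrow> complex^'d^'z" where
  "transfer A B C D s = cmat C ** matrix_inv (mat s - cmat A) ** cmat B + cmat D"

lemma matrix_inv_inverse:
  assumes "invertible M"
  shows "M ** matrix_inv M = mat 1" and "matrix_inv M ** M = mat 1"
  using someI_ex[of "\<lambda>N. M ** N = mat 1 \<and> N ** M = mat 1"] assms
  unfolding invertible_def matrix_inv_def by blast+

lemma resolvent_invertible:
  assumes "resolvent_bound A k"
  shows "invertible (freq_pencil w A)" (is "invertible ?R")
proof -
  have "x = 0" if "?R *v x = 0" for x
    using resolvent_boundD[OF assms, of x w] that by simp
  then show ?thesis unfolding invertible_left_inverse matrix_left_invertible_ker by blast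
qed

lemma transfer_apply:
  assumes rb: "resolvent_bound A k"
    and x: "freq_pencil w A *v x = cmat B *v d"
  shows "transfer A B C D (\<i> * complex_of_real w) *v d = cmat C *v x + cmat D *v d"
proof -
  let ?R = "freq_pencil w A"
  have "matrix_inv ?R ** ?R = mat 1"
    using resolvent_invertible[OF rb] by (rule matrix_inv_inverse(2))
  then have "matrix_inv ?R *v (?R *v x) = x" by (simp add: matrix_vector_mul_assoc)
  then show ?thesis unfolding transfer_def
    by (simp add: matrix_vector_mult_add_rdistrib matrix_vector_mul_assoc[symmetric] x[symmetric])
qed

lemma resolvent_solve:
  assumes "resolvent_bound A k"
  obtains x where "freq_pencil w A *v x = y"
proof
  let ?R = "freq_pencil w A"
  have "?R ** matrix_inv ?R = mat 1"
    using resolvent_invertible[OF assms] by (rule matrix_inv_inverse(1))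
  then show "?R *v (matrix_inv ?R *v y) = y" by (simp add: matrix_vector_mul_assoc)
qed

lemma hinf_norm_le:
  assumes rb: "resolvent_bound A k" and c: "0 \<le> c"
    and le: "\<And>w x d. freq_pencil w A *v x = cmat B *v d \<Longrightarrow>
      norm (cmat C *v x + cmat D *v d) \<le> c * norm d"
  shows "hinf_norm (transfer A B C D) \<le> c"
  unfolding hinf_norm_def sigma_max_eq_onorm
proof (rule cSUP_least)
  fix w
  have "norm (transfer A B C D (\<i> * complex_of_real w) *v d) \<le> c * norm d" for d
  proof -
    obtain x where x: "freq_pencil w A *v x = cmat B *v d"
      by (rule resolvent_solve[OF rb])
    show ?thesis using le[OF x] by (simp add: transfer_apply[OF rb x])
  qed
  then show "onorm ((*v) (transfer A B C D (\<i> * complex_of_real w))) \<le> c" by (rule onorm_le)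
qed simp

lemma hinf_norm_bounds:
  assumes rb: "resolvent_bound A k"
  shows "0 \<le> hinf_norm (transfer A B C D)"
    and "freq_pencil w A *v x = cmat B *v d \<Longrightarrow>
      norm (cmat C *v x + cmat D *v d) \<le> hinf_norm (transfer A B C D) * norm d"
proof -
  let ?T = "\<lambda>w. transfer A B C D (\<i> * complex_of_real w)"
  note n = matvec_bound
  have k: "k > 0" using rb by (simp add: resolvent_bound_def)
  have "norm (?T w *v d) \<le> (onorm ((*v) (cmat C)) * (k * onorm ((*v) (cmat B))) + onorm ((*v) (cmat D))) * norm d" for w d
  proof -
    obtain x where x: "freq_pencil w A *v x = cmat B *v d"
      by (rule resolvent_solve[OF rb])
    have "norm x \<le> k * norm (cmat B *v d)" using resolvent_boundD[OF rb, of x w] x by simp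
    also have "\<dots> \<le> k * (onorm ((*v) (cmat B)) * norm d)" using k n by (simp add: mult_left_mono)
    finally have nx: "norm x \<le> k * (onorm ((*v) (cmat B)) * norm d)" .
    have "norm (?T w *v d) \<le> norm (cmat C *v x) + norm (cmat D *v d)"
      unfolding transfer_apply[OF rb x] by (rule norm_triangle_ineq)
    also have "\<dots> \<le> onorm ((*v) (cmat C)) * norm x + onorm ((*v) (cmat D)) * norm d" by (intro add_mono n)
    also have "\<dots> \<le> onorm ((*v) (cmat C)) * (k * (onorm ((*v) (cmat B)) * norm d)) + onorm ((*v) (cmat D)) * norm d"
      by (intro add_right_mono mult_left_mono nx n)
    finally show ?thesis by (simp add: algebra_simps)
  qed
  then have "onorm ((*v) (?T w)) \<le> onorm ((*v) (cmat C)) * (k * onorm ((*v) (cmat B))) + onorm ((*v) (cmat D))" for w by (rule onorm_le)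
  then have bdd: "bdd_above (range (\<lambda>w. onorm ((*v) (?T w))))" by (auto intro!: bdd_aboveI2)
  have up: "onorm ((*v) (?T w)) \<le> hinf_norm (transfer A B C D)" for w
    unfolding hinf_norm_def sigma_max_eq_onorm by (rule cSUP_upper[OF UNIV_I bdd])
  show "0 \<le> hinf_norm (transfer A B C D)"
    using up[of 0] onorm_pos_le[OF bounded_linear_matvec, of "?T 0"] by linarith
  assume x: "freq_pencil w A *v x = cmat B *v d"
  have "norm (cmat C *v x + cmat D *v d) \<le> onorm ((*v) (?T w)) * norm d"
    unfolding transfer_apply[OF rb x, symmetric] by (rule onorm[OF bounded_linear_matvec])
  also have "\<dots> \<le> hinf_norm (transfer A B C D) * norm d" by (simp add: up mult_right_mono)
  finally show "norm (cmat C *v x + cmat D *v d) \<le> hinf_norm (transfer A B C D) * norm d" .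
qed

section \<open>The Kalman--Yakubovich--Popov lemma\<close>

text \<open>The rank-one matrix \<open>a b\<^sup>T\<close>.\<close>

definition outer :: "real^'a \<Rightarrow> real^'b \<Rightarrow> real^'b^'a" where
  "outer a b = (\<chi> i j. a $ i * b $ j)"

lemma outer_mult: "outer a b *v x = (b \<bullet> x) *\<^sub>R a"
  by (simp add: outer_def vec_eq_iff matrix_vector_mult_def inner_vec_def sum_distrib_left ac_simps)

lemma inner_outer: "outer a b \<bullet> M = a \<bullet> (M *v b)"
  by (simp add: outer_def inner_vec_def matrix_vector_mult_def sum_distrib_left ac_simps)

lemma transpose_outer: "transpose (outer a b) = outer b a"
  by (simp add: outer_def transpose_def vec_eq_iff)

lemma transpose_add: "transpose (M + N) = transpose M + transpose N"
  by (simp add: transpose_def vec_eq_iff)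

lemma transpose_diff: "transpose (M - N) = transpose M - transpose N"
  by (simp add: transpose_def vec_eq_iff)

lemma transpose_scaleR: "transpose (c *\<^sub>R M) = c *\<^sub>R transpose M"
  by (simp add: transpose_def vec_eq_iff)

lemma scaleR_matrix_mult: "(c *\<^sub>R M) *v x = c *\<^sub>R (M *v (x::real^'a))"
  by (simp add: scaleR_matrix_vector_assoc)

lemma matrix_mult_scaleR: "M *v (c *\<^sub>R x) = c *\<^sub>R (M *v (x::real^'a))"
  by (simp add: linear_scale)

lemma linear_matvec_left: "linear (\<lambda>M. M *v (x::real^'a))"
  by (intro linearI) (simp_all add: matrix_vector_mult_add_rdistrib scaleR_matrix_mult)

lemma trace_psd_nonneg:
  assumes "\<And>x. 0 \<le> x \<bullet> (Z *v x)"
  shows "0 \<le> Z \<bullet> mat 1"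
proof -
  have "Z \<bullet> mat 1 = (\<Sum>i\<in>UNIV. axis i 1 \<bullet> (Z *v axis i 1))"
    by (simp add: inner_vec_def mat_def axis_def matrix_vector_mult_def if_distrib if_distribR
        inner_commute[of 1] cong: if_cong)
  then show ?thesis by (simp add: assms sum_nonneg)
qed

lemmas mult_vec_simps = matrix_vector_mult_add_rdistrib matrix_vector_mult_diff_rdistrib
  matrix_vector_right_distrib matrix_vector_mult_diff_distrib matrix_vector_mul_assoc[symmetric]

text \<open>Products with a transposed matrix are kept as such, to be moved across inner products.\<close>

declare transpose_matrix_vector [simp del]

text \<open>The density matrices: positive semidefinite of trace one.\<close>

definition density_matrices :: "(real^'k^'k) set" where
  "density_matrices = {Z. pos_semidef Z \<and> Z \<bullet> mat 1 = 1}"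

lemma density_outer: "norm u = 1 \<Longrightarrow> outer u u \<in> density_matrices"
proof -
  assume "norm u = 1"
  moreover have "0 \<le> x \<bullet> (outer u u *v x)" for x
    using inner_commute[of u x] by (simp add: outer_mult)
  ultimately show ?thesis
    by (simp add: density_matrices_def pos_semidef_def transpose_outer inner_outer norm_eq_1)
qed

lemma convex_density: "convex (density_matrices :: (real^'k^'k) set)"
proof (rule convexI)
  fix X Y :: "real^'k^'k" and u v :: real
  assume "X \<in> density_matrices" "Y \<in> density_matrices" "0 \<le> u" "0 \<le> v" "u + v = 1"
  then show "u *\<^sub>R X + v *\<^sub>R Y \<in> density_matrices"
    by (simp add: density_matrices_def pos_semidef_def transpose_add transpose_scaleR inner_add_left inner_add_right
        matrix_vector_mult_add_rdistrib scaleR_matrix_mult)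
qed

lemma compact_density: "compact (density_matrices :: (real^'k^'k) set)"
  unfolding compact_eq_bounded_closed
proof
  have tr: "linear (transpose :: real^'k^'k \<Rightarrow> _)"
    by (intro linearI) (simp_all add: transpose_add transpose_scaleR)
  show "closed (density_matrices :: (real^'k^'k) set)"
    unfolding density_matrices_def pos_semidef_def Collect_conj_eq
    by (intro closed_Int closed_Collect_eq closed_Collect_all closed_Collect_le continuous_intros
        linear_continuous_on linear_linear[THEN iffD2] tr linear_matvec_left)
  have "norm Z \<le> (\<Sum>i\<in>(UNIV::'k set). \<Sum>j\<in>(UNIV::'k set). 1)" if Z: "Z \<in> density_matrices" for Z :: "real^'k^'k"
  proof -
    have psd: "0 \<le> x \<bullet> (Z *v x)" for x
      using Z by (simp add: density_matrices_def pos_semidef_def)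
    have sym: "transpose Z = Z" using Z by (simp add: density_matrices_def pos_semidef_def)
    have ax: "axis i 1 \<bullet> (Z *v axis j 1) = Z $ i $ j" for i j
      by (simp add: inner_axis' matrix_vector_mult_basis column_def)
    have diag: "0 \<le> Z $ i $ i" for i using psd[of "axis i 1"] by (simp add: ax)
    have tr1: "(\<Sum>i\<in>UNIV. Z $ i $ i) = 1"
      using Z by (simp add: density_matrices_def inner_vec_def mat_def if_distrib if_distribR cong: if_cong)
    have le1: "Z $ i $ i \<le> 1" for i
      unfolding tr1[symmetric] by (rule member_le_sum) (auto simp: diag)
    have ent: "\<bar>Z $ i $ j\<bar> \<le> 1" for i j
    proof -
      have s: "Z $ j $ i = Z $ i $ j" by (subst sym[symmetric]) (simp add: transpose_def)
      have "0 \<le> Z $ i $ i + Z $ j $ j + 2 * Z $ i $ j"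
        using psd[of "axis i 1 + axis j 1"] s
        by (simp add: matrix_vector_right_distrib inner_add_left inner_add_right ax)
      moreover have "0 \<le> Z $ i $ i + Z $ j $ j - 2 * Z $ i $ j"
        using psd[of "axis i 1 - axis j 1"] s
        by (simp add: matrix_vector_mult_diff_distrib inner_diff_left inner_diff_right ax)
      ultimately show ?thesis using le1[of i] le1[of j] by linarith
    qed
    have "norm Z \<le> (\<Sum>i\<in>UNIV. norm (Z $ i))" unfolding norm_vec_def by (rule L2_set_le_sum) simp
    also have "\<dots> \<le> (\<Sum>i\<in>UNIV. \<Sum>j\<in>UNIV. \<bar>Z $ i $ j\<bar>)" by (intro sum_mono norm_le_l1_cart)
    also have "\<dots> \<le> (\<Sum>i\<in>(UNIV::'k set). \<Sum>j\<in>(UNIV::'k set). 1)" by (intro sum_mono ent)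
    finally show ?thesis .
  qed
  then show "bounded (density_matrices :: (real^'k^'k) set)" by (rule boundedI)
qed

lemma pos_semidef_cauchy_schwarz:
  assumes Z: "pos_semidef Z"
  shows "(y \<bullet> (Z *v x))\<^sup>2 \<le> (y \<bullet> (Z *v y)) * (x \<bullet> (Z *v x))"
proof (cases "y \<bullet> (Z *v y) = 0")
  case True
  then have "Z *v y = 0" by (rule pos_semidef_null[OF Z])
  then have "y \<bullet> (Z *v x) = 0"
    using Z symmetric_inner[of Z y x] by (simp add: pos_semidef_def)
  then show ?thesis using True by simp
next
  case False
  define q where "q = y \<bullet> (Z *v y)"
  define t where "t = (y \<bullet> (Z *v x)) / q"
  have q: "q > 0" using False Z by (auto simp: q_def pos_semidef_def order_less_le)
  have s: "x \<bullet> (Z *v y) = y \<bullet> (Z *v x)"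
    using Z symmetric_inner[of Z y x] by (simp add: pos_semidef_def inner_commute)
  have "0 \<le> (x - t *\<^sub>R y) \<bullet> (Z *v (x - t *\<^sub>R y))" using Z by (simp add: pos_semidef_def)
  also have "\<dots> = x \<bullet> (Z *v x) - 2 * t * (y \<bullet> (Z *v x)) + t * (t * q)"
    by (simp add: matrix_vector_mult_diff_distrib matrix_mult_scaleR inner_diff_left inner_diff_right s q_def algebra_simps)
  also have "\<dots> = x \<bullet> (Z *v x) - (y \<bullet> (Z *v x))\<^sup>2 / q"
    using q by (simp add: t_def power2_eq_square)
  finally have "(y \<bullet> (Z *v x))\<^sup>2 / q \<le> x \<bullet> (Z *v x)" by simp
  then show ?thesis using q by (simp add: q_def[symmetric] field_simps)
qed

text \<open>
  The dual constraint of the lemma is \<open>G Z E\<^sup>T + E Z G\<^sup>T = 0\<close> for a positive semidefinite \<open>Z\<close>.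
  The range of a nonzero solution \<open>Z\<close> contains a nonzero vector \<open>z = a + \<i> b\<close> with \<open>G z = \<i> w E z\<close> for some
  frequency \<open>w\<close>, or with \<open>E z = 0\<close> (\<open>dual_feasible_direction\<close>); for such \<open>z\<close>, the rank-one matrix \<open>z z\<^sup>*\<close>
  again solves the constraint.
\<close>

definition dual_map :: "real^'k^'n \<Rightarrow> real^'k^'n \<Rightarrow> real^'k^'k \<Rightarrow> real^'n^'n" where
  "dual_map E G Z = G ** Z ** transpose E + E ** Z ** transpose G"

lemma outer_congruence: "M ** outer a b ** transpose N = outer (M *v a) (N *v b)"
proof -
  have "(M ** outer a b ** transpose N) *v x = outer (M *v a) (N *v b) *v x" for x
    by (simp add: matrix_vector_mul_assoc[symmetric] outer_mult matrix_mult_scaleR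
        inner_mult_transpose)
  then show ?thesis by (simp add: matrix_eq)
qed

lemma dual_map_outer: "dual_map E G (outer a b) = outer (G *v a) (E *v b) + outer (E *v a) (G *v b)"
  by (simp add: dual_map_def outer_congruence)

lemma linear_dual_map: "linear (dual_map E G)"
  by (intro linearI)
     (simp_all add: matrix_eq dual_map_def mult_vec_simps
       scaleR_matrix_mult matrix_mult_scaleR matrix_vector_right_distrib scaleR_add_right)

lemma dual_feasible_direction:
  fixes E G :: "real^'k^'n"
  assumes Z: "pos_semidef Z" "Z \<noteq> 0" and con: "dual_map E G Z = 0"
  obtains \<alpha> \<beta> w where "Z *v \<alpha> \<noteq> 0 \<or> Z *v \<beta> \<noteq> 0"
    and "(G *v (Z *v \<alpha>) = - w *\<^sub>R (E *v (Z *v \<beta>)) \<and> G *v (Z *v \<beta>) = w *\<^sub>R (E *v (Z *v \<alpha>)))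
      \<or> (E *v (Z *v \<alpha>) = 0 \<and> E *v (Z *v \<beta>) = 0)"
proof -
  have sym: "(Z *v x) \<bullet> y = x \<bullet> (Z *v y)" for x y
    using Z by (simp add: pos_semidef_def symmetric_inner)
  define Z1 where "Z1 u = E *v (Z *v (transpose E *v u))" for u
  define T where "T u = G *v (Z *v (transpose E *v u))" for u
  have lin1: "linear Z1" "linear T"
    by (intro linearI; simp add: Z1_def T_def matrix_vector_right_distrib matrix_mult_scaleR)+
  have skew: "T u \<bullet> v = - (u \<bullet> T v)" for u v
  proof -
    have "0 = (dual_map E G Z *v v) \<bullet> u" using con by simp
    also have "\<dots> = T v \<bullet> u + (E *v (Z *v (transpose G *v v))) \<bullet> u"
      by (simp add: dual_map_def T_def mult_vec_simps inner_add_left)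
    also have "(E *v (Z *v (transpose G *v v))) \<bullet> u = v \<bullet> T u"
      by (simp only: T_def inner_mult_transpose[of _ E u, symmetric] sym inner_transpose_mult)
    finally show ?thesis by (simp add: inner_commute)
  qed
  have sym1: "Z1 u \<bullet> v = u \<bullet> Z1 v" for u v
    by (simp only: Z1_def inner_mult_transpose[of _ E v, symmetric] sym inner_transpose_mult)
  have psd1: "0 \<le> u \<bullet> Z1 u" for u
  proof -
    have "u \<bullet> Z1 u = (transpose E *v u) \<bullet> (Z *v (transpose E *v u))"
      by (simp add: Z1_def inner_transpose_mult)
    then show ?thesis using Z(1) by (simp add: pos_semidef_def)
  qed
  have ker: "Z *v (transpose E *v u) = 0" if "Z1 u = 0" for u
    using that pos_semidef_null[OF Z(1), of "transpose E *v u"]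
    by (simp add: Z1_def inner_transpose_mult)
  show thesis
  proof (cases "\<forall>u. Z1 u = 0")
    case True
    obtain \<alpha> where \<alpha>: "Z *v \<alpha> \<noteq> 0" using Z(2) by (auto simp: matrix_eq)
    have "(E *v (Z *v \<alpha>)) \<bullet> u = 0" for u
      using ker[of u] True by (simp only: inner_mult_transpose[of _ E u, symmetric] sym inner_zero_right)
    then have "E *v (Z *v \<alpha>) = 0" by (metis inner_eq_zero_iff)
    then show thesis using that[of \<alpha> 0] \<alpha> by simp
  next
    case False
    then obtain z where z: "Z1 z \<noteq> 0" by blast
    \<comment> \<open>The real form of the Hermitian pencil of \<open>\<i> T\<close> and \<open>Z1\<close> on pairs of real and imaginary parts.\<close>
    define p where "p x = (Z1 (fst x), Z1 (snd x))" for x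
    define q where "q x = (- T (snd x), T (fst x))" for x
    note simps = linear_add[OF lin1(1)] linear_add[OF lin1(2)] linear_scale[OF lin1(1)] linear_scale[OF lin1(2)]
    have lp: "linear p" "linear q"
      by (intro linearI; simp add: p_def q_def simps)+
    obtain l x where x: "p x \<noteq> 0" "q x = l *\<^sub>R p x"
    proof (rule self_adjoint_pencil[OF lp(1) _ _ _ lp(2)])
      show "p x \<bullet> y = x \<bullet> p y" for x y by (cases x; cases y) (simp add: p_def sym1)
      show "0 \<le> x \<bullet> p x" for x by (cases x) (simp add: p_def psd1)
      show "p (z, 0) \<noteq> 0" using z by (simp add: p_def zero_prod_def)
      show "q x \<bullet> y = x \<bullet> q y" for x y by (cases x; cases y) (simp add: q_def skew)
      show "q x = 0" if "p x = 0" for x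
        using that ker[of "fst x"] ker[of "snd x"] by (simp add: p_def q_def T_def zero_prod_def)
    qed
    obtain u v where uv: "x = (u, v)" by (cases x)
    have "T u = l *\<^sub>R Z1 v" "- T v = l *\<^sub>R Z1 u" "Z1 u \<noteq> 0 \<or> Z1 v \<noteq> 0"
      using x by (auto simp: uv p_def q_def zero_prod_def)
    then have "T u = l *\<^sub>R Z1 v" "T v = - l *\<^sub>R Z1 u" "Z1 u \<noteq> 0 \<or> Z1 v \<noteq> 0"
      by (auto simp flip: \<open>- T v = l *\<^sub>R Z1 u\<close>)
    then show thesis
      by (intro that[of "transpose E *v u" "transpose E *v v" "- l"]) (auto simp: T_def Z1_def)
  qed
qed

text \<open>It suffices to consider a feasible \<open>Y\<close> that maximises \<open>Y \<bullet> M\<close>. If that maximum were nonnegative,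
  subtracting a small multiple of \<open>Re (z z\<^sup>*)\<close>, on which \<open>M\<close> is negative, and normalising the trace
  would increase it.\<close>

lemma kyp_dual_negative:
  fixes E G :: "real^'k^'n"
  assumes inf: "\<And>z. z \<noteq> 0 \<Longrightarrow> E *v z = 0 \<Longrightarrow> z \<bullet> (M *v z) < 0"
    and fin: "\<And>w a b. a \<noteq> 0 \<or> b \<noteq> 0 \<Longrightarrow> G *v a = - w *\<^sub>R (E *v b) \<Longrightarrow> G *v b = w *\<^sub>R (E *v a) \<Longrightarrow>
      a \<bullet> (M *v a) + b \<bullet> (M *v b) < 0"
    and Z: "Z \<in> density_matrices" "dual_map E G Z = 0"
  shows "Z \<bullet> M < 0"
proof -
  let ?S = "density_matrices \<inter> {Z. dual_map E G Z = 0}"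
  have "closed {Z. dual_map E G Z = 0}"
    by (intro closed_Collect_eq continuous_intros linear_continuous_on linear_linear[THEN iffD2] linear_dual_map)
  then have "compact ?S" by (rule compact_Int_closed[OF compact_density])
  moreover have "?S \<noteq> {}" using Z by blast
  moreover have "continuous_on ?S (\<lambda>Z. Z \<bullet> M)" by (intro continuous_intros)
  ultimately obtain Y where Y: "Y \<in> ?S" and mx: "\<And>X. X \<in> ?S \<Longrightarrow> X \<bullet> M \<le> Y \<bullet> M"
    using continuous_attains_sup[of ?S "\<lambda>Z. Z \<bullet> M"] by blast
  have psd: "pos_semidef Y" and tr: "Y \<bullet> mat 1 = 1" and con: "dual_map E G Y = 0"
    using Y by (auto simp: density_matrices_def)
  have "Y \<noteq> 0" using tr by auto
  have "Y \<bullet> M < 0"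
  proof (rule ccontr)
    assume "\<not> Y \<bullet> M < 0"
    then have Ypos: "0 \<le> Y \<bullet> M" by simp
    obtain \<alpha> \<beta> w where ne: "Y *v \<alpha> \<noteq> 0 \<or> Y *v \<beta> \<noteq> 0"
      and dir: "(G *v (Y *v \<alpha>) = - w *\<^sub>R (E *v (Y *v \<beta>)) \<and> G *v (Y *v \<beta>) = w *\<^sub>R (E *v (Y *v \<alpha>)))
      \<or> (E *v (Y *v \<alpha>) = 0 \<and> E *v (Y *v \<beta>) = 0)"
      by (rule dual_feasible_direction[OF psd \<open>Y \<noteq> 0\<close> con])
    define a where "a = Y *v \<alpha>"
    define b where "b = Y *v \<beta>"
    define N where "N = outer a a + outer b b"
    have neg: "N \<bullet> M < 0"
    proof -
      have "a \<bullet> (M *v a) + b \<bullet> (M *v b) < 0"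
        using dir
      proof
        assume "E *v (Y *v \<alpha>) = 0 \<and> E *v (Y *v \<beta>) = 0"
        then have "E *v a = 0" "E *v b = 0" by (auto simp: a_def b_def)
        then show ?thesis using inf[of a] inf[of b] ne
          by (cases "a = 0"; cases "b = 0") (auto simp: a_def[symmetric] b_def[symmetric])
      qed (use fin[of a b w] ne in \<open>auto simp: a_def b_def\<close>)
      then show ?thesis by (simp add: N_def inner_add_left inner_outer)
    qed
    have conN: "dual_map E G N = 0"
      using dir unfolding N_def linear_add[OF linear_dual_map] dual_map_outer
      by (auto simp: a_def[symmetric] b_def[symmetric] outer_def vec_eq_iff)
    define k where "k = \<alpha> \<bullet> (Y *v \<alpha>) + \<beta> \<bullet> (Y *v \<beta>)"
    have nn: "0 \<le> x \<bullet> (Y *v x)" for x using psd by (simp add: pos_semidef_def)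
    have k: "k > 0"
    proof -
      have "\<alpha> \<bullet> (Y *v \<alpha>) \<noteq> 0 \<or> \<beta> \<bullet> (Y *v \<beta>) \<noteq> 0"
        using ne pos_semidef_null[OF psd] by blast
      then show ?thesis using nn[of \<alpha>] nn[of \<beta>] by (auto simp: k_def)
    qed
    have quadN: "x \<bullet> (N *v x) \<le> k * (x \<bullet> (Y *v x))" for x
    proof -
      have s: "(Y *v y) \<bullet> x = y \<bullet> (Y *v x)" for y
        using psd by (simp add: pos_semidef_def symmetric_inner)
      have "x \<bullet> (N *v x) = (\<alpha> \<bullet> (Y *v x))\<^sup>2 + (\<beta> \<bullet> (Y *v x))\<^sup>2"
        by (simp add: N_def matrix_vector_mult_add_rdistrib outer_mult inner_add_right a_def b_def
            s power2_eq_square inner_commute[of x])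
      then show ?thesis
        using pos_semidef_cauchy_schwarz[OF psd, of \<alpha> x] pos_semidef_cauchy_schwarz[OF psd, of \<beta> x]
        by (simp add: k_def algebra_simps)
    qed
    \<comment> \<open>Half of the largest admissible multiple of \<open>N\<close> is removed, so that the trace stays positive.\<close>
    define c where "c = 1 / (2 * k)"
    define X where "X = Y - c *\<^sub>R N"
    have c: "c > 0" using k by (simp add: c_def)
    have X_half: "(x \<bullet> (Y *v x)) / 2 \<le> x \<bullet> (X *v x)" for x
    proof -
      have "c * (x \<bullet> (N *v x)) \<le> c * (k * (x \<bullet> (Y *v x)))" using quadN c by simp
      also have "\<dots> = (x \<bullet> (Y *v x)) / 2" using k by (simp add: c_def)
      finally show ?thesis
        by (simp add: X_def matrix_vector_mult_diff_rdistrib scaleR_matrix_mult inner_diff_right)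
    qed
    define t where "t = X \<bullet> mat 1"
    have "0 \<le> (X - (1/2) *\<^sub>R Y) \<bullet> mat 1"
      using X_half by (intro trace_psd_nonneg)
        (simp add: matrix_vector_mult_diff_rdistrib scaleR_matrix_mult inner_diff_right)
    then have t: "1 / 2 \<le> t" by (simp add: t_def inner_diff_left tr)
    have "0 \<le> N \<bullet> mat 1" by (simp add: N_def inner_outer inner_add_left)
    then have t1: "t \<le> 1" using c by (simp add: t_def X_def inner_diff_left tr)
    have symN: "transpose N = N" by (simp add: N_def transpose_add transpose_outer)
    have "(1 / t) *\<^sub>R X \<in> ?S"
    proof -
      have "pos_semidef X"
        unfolding pos_semidef_def
      proof (intro conjI allI)
        show "transpose X = X"
          using psd symN by (simp add: X_def pos_semidef_def transpose_diff transpose_scaleR)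
        show "0 \<le> x \<bullet> (X *v x)" for x using X_half[of x] nn[of x] by linarith
      qed
      then have "pos_semidef ((1 / t) *\<^sub>R X)"
        using t by (simp add: pos_semidef_def transpose_scaleR scaleR_matrix_mult)
      moreover have "dual_map E G ((1 / t) *\<^sub>R X) = 0"
        by (simp add: X_def linear_scale[OF linear_dual_map] linear_diff[OF linear_dual_map] con conN)
      ultimately show ?thesis using t by (simp add: density_matrices_def t_def)
    qed
    from mx[OF this] have "X \<bullet> M \<le> t * (Y \<bullet> M)" using t by (simp add: field_simps)
    also have "\<dots> \<le> Y \<bullet> M" using t1 Ypos by (simp add: mult_left_le_one_le t order_trans[OF _ t])
    also have "\<dots> < X \<bullet> M" using c neg by (simp add: X_def inner_diff_left mult_pos_neg)
    finally show False by simp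
  qed
  then show ?thesis using mx[of Z] Z by auto
qed

text \<open>
  Strict frequency-domain inequalities, at all finite frequencies \<open>w\<close> (for \<open>z = a + \<i> b\<close> with
  \<open>G z = \<i> w E z\<close>) and at infinity (\<open>E z = 0\<close>), are certified by a single symmetric matrix \<open>P\<close>.
\<close>

theorem kyp_strict:
  fixes E G :: "real^'k^'n"
  assumes inf: "\<And>z. z \<noteq> 0 \<Longrightarrow> E *v z = 0 \<Longrightarrow> z \<bullet> (M *v z) < 0"
    and fin: "\<And>w a b. a \<noteq> 0 \<or> b \<noteq> 0 \<Longrightarrow> G *v a = - w *\<^sub>R (E *v b) \<Longrightarrow> G *v b = w *\<^sub>R (E *v a) \<Longrightarrow>
      a \<bullet> (M *v a) + b \<bullet> (M *v b) < 0"
  shows "\<exists>P. transpose P = P \<and> (\<forall>z. z \<noteq> 0 \<longrightarrow> z \<bullet> (M *v z) + 2 * ((G *v z) \<bullet> (P *v (E *v z))) < 0)"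
proof -
  define F where "F Z = (dual_map E G Z, Z \<bullet> M)" for Z
  have linF: "linear F" unfolding F_def
    by (intro linearI) (simp_all add: linear_add[OF linear_dual_map] linear_scale[OF linear_dual_map] inner_add_left)
  have "convex (F ` density_matrices)" by (rule convex_linear_image[OF linF convex_density])
  moreover have "compact (F ` density_matrices)"
    by (intro compact_continuous_image compact_density linear_continuous_on linear_linear[THEN iffD2] linF)
  moreover have "F ` density_matrices \<noteq> {}"
  proof -
    obtain u :: "real^'k" where "norm u = 1" using vector_choose_size[of 1] by auto
    then show ?thesis using density_outer by blast
  qed
  moreover have "convex ({0::real^'n^'n} \<times> {0::real..})" "closed ({0::real^'n^'n} \<times> {0::real..})"
    by (auto intro: convex_Times closed_Times)
  moreover have "F ` density_matrices \<inter> ({0} \<times> {0..}) = {}"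
    using kyp_dual_negative[OF inf fin] by (force simp: F_def)
  ultimately obtain c b where c: "\<And>x. x \<in> F ` density_matrices \<Longrightarrow> c \<bullet> x < b"
      and b: "\<And>x. x \<in> {0} \<times> {0..} \<Longrightarrow> b < c \<bullet> x"
    using separating_hyperplane_compact_closed[of "F ` density_matrices" "{0} \<times> {0..}"] by blast
  obtain N q where cN: "c = (N, q)" by (cases c)
  have b0: "b < 0" using b[of "(0, 0)"] by (simp add: cN)
  have q: "0 \<le> q"
  proof (rule ccontr)
    assume "\<not> 0 \<le> q"
    then show False using b[of "(0, b / q)"] b0 by (simp add: cN divide_nonpos_neg)
  qed
  define m where "m = onorm (\<lambda>x. M *v x)"
  note m = matvec_bound[of M, folded m_def]
  \<comment> \<open>The multiplier \<open>q\<close> of \<open>M\<close> could be zero; increasing it slightly does no harm because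
    \<open>Z \<bullet> M\<close> is bounded on the density matrices.\<close>
  define r where "r = q + - b / (m + 1)"
  have "0 < - b / (m + 1)" using b0 m(2) by (intro divide_pos_pos) auto
  then have r: "r > 0" using q by (simp add: r_def)
  define P where "P = (1 / (2 * r)) *\<^sub>R (N + transpose N)"
  have unit: "u \<bullet> (M *v u) + 2 * ((G *v u) \<bullet> (P *v (E *v u))) < 0" if u: "norm u = 1" for u
  proof -
    have "N \<bullet> dual_map E G (outer u u) + q * (u \<bullet> (M *v u)) < b"
      using c[OF imageI[OF density_outer[OF u]]] by (simp add: cN F_def inner_outer)
    moreover have "N \<bullet> dual_map E G (outer u u)
        = (G *v u) \<bullet> (N *v (E *v u)) + (E *v u) \<bullet> (N *v (G *v u))"
      by (simp add: dual_map_outer inner_add_right inner_outer inner_commute[of N])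
    moreover have "(E *v u) \<bullet> (N *v (G *v u)) = (G *v u) \<bullet> (transpose N *v (E *v u))"
      by (simp only: inner_mult_transpose inner_commute)
    moreover have "2 * r * ((G *v u) \<bullet> (P *v (E *v u)))
        = (G *v u) \<bullet> (N *v (E *v u)) + (G *v u) \<bullet> (transpose N *v (E *v u))"
      using r by (simp add: P_def scaleR_matrix_mult matrix_vector_mult_add_rdistrib inner_add_right)
    moreover have "- b / (m + 1) * (u \<bullet> (M *v u)) < - b"
    proof -
      have "u \<bullet> (M *v u) \<le> norm u * norm (M *v u)" by (rule norm_cauchy_schwarz)
      also have "\<dots> \<le> m" using m(1)[of u] u by simp
      finally have "- b / (m + 1) * (u \<bullet> (M *v u)) \<le> - b / (m + 1) * m"
        using \<open>0 < - b / (m + 1)\<close> by (intro mult_left_mono) auto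
      also have "\<dots> < - b" using b0 m(2) by (simp add: field_simps)
      finally show ?thesis .
    qed
    ultimately have "r * (u \<bullet> (M *v u)) + 2 * r * ((G *v u) \<bullet> (P *v (E *v u))) < 0"
      by (simp add: r_def algebra_simps)
    then have "r * (u \<bullet> (M *v u) + 2 * ((G *v u) \<bullet> (P *v (E *v u)))) < 0" by (simp add: algebra_simps)
    then show ?thesis using r by (simp add: mult_less_0_iff)
  qed
  have "transpose P = P" by (simp add: P_def transpose_scaleR transpose_add add.commute)
  moreover have "z \<bullet> (M *v z) + 2 * ((G *v z) \<bullet> (P *v (E *v z))) < 0" if "z \<noteq> 0" for z
  proof -
    define u where "u = z /\<^sub>R norm z"
    have z: "z = norm z *\<^sub>R u" and u: "norm u = 1" using that by (simp_all add: u_def)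
    have "(r *\<^sub>R u) \<bullet> (M *v (r *\<^sub>R u)) + 2 * ((G *v (r *\<^sub>R u)) \<bullet> (P *v (E *v (r *\<^sub>R u))))
        = r\<^sup>2 * (u \<bullet> (M *v u) + 2 * ((G *v u) \<bullet> (P *v (E *v u))))" for r
      by (simp add: matrix_mult_scaleR power2_eq_square algebra_simps)
    from this[of "norm z"] have "z \<bullet> (M *v z) + 2 * ((G *v z) \<bullet> (P *v (E *v z)))
        = (norm z)\<^sup>2 * (u \<bullet> (M *v u) + 2 * ((G *v u) \<bullet> (P *v (E *v u))))"
      by (simp flip: z)
    then show ?thesis using unit[OF u] that by (simp add: mult_less_0_iff)
  qed
  ultimately show ?thesis by blast
qed

section \<open>Block vectors\<close>

text \<open>The stacked vector, indexed by the sum type as in the block matrices.\<close>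

definition vjoin :: "'a^'m \<Rightarrow> 'a^'n \<Rightarrow> 'a^('m::finite + 'n::finite)" where
  "vjoin x y = (\<chi> i. case i of Inl k \<Rightarrow> x $ k | Inr k \<Rightarrow> y $ k)"

lemma vjoin_nth [simp]: "vjoin x y $ Inl i = x $ i" "vjoin x y $ Inr j = y $ j"
  by (simp_all add: vjoin_def)

lemma vec_sum_eq_iff: "x = y \<longleftrightarrow> (\<forall>i. x $ Inl i = y $ Inl i) \<and> (\<forall>j. x $ Inr j = y $ Inr j)"
  by (metis vec_eq_iff sum.exhaust)

lemma vjoin_cases: obtains x y where "z = vjoin x y"
proof
  show "z = vjoin (\<chi> i. z $ Inl i) (\<chi> j. z $ Inr j)" by (simp add: vec_sum_eq_iff)
qed

lemma vjoin_eq_iff [simp]: "vjoin x y = vjoin x' y' \<longleftrightarrow> x = x' \<and> y = y'"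
  by (simp add: vec_sum_eq_iff vec_eq_iff[of x] vec_eq_iff[of y])

lemma vjoin_0 [simp]: "vjoin 0 0 = 0"
  by (simp add: vec_sum_eq_iff)

lemma vjoin_eq_0_iff [simp]: "vjoin x y = 0 \<longleftrightarrow> x = 0 \<and> y = 0"
  by (metis vjoin_0 vjoin_eq_iff)

lemma vjoin_add: "vjoin x y + vjoin x' y' = vjoin (x + x') (y + y')"
  by (simp add: vec_sum_eq_iff)

lemma vjoin_diff: "vjoin x y - vjoin x' y' = vjoin (x - x') (y - y')"
  by (simp add: vec_sum_eq_iff)

lemma vjoin_minus: "- vjoin x y = vjoin (- x) (- y)"
  by (simp add: vec_sum_eq_iff)

lemma vjoin_scaleR: "c *\<^sub>R vjoin x y = vjoin (c *\<^sub>R x) (c *\<^sub>R y)"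
  by (simp add: vec_sum_eq_iff)

lemma sum_sum_type: "(\<Sum>i\<in>(UNIV::('a::finite + 'b::finite) set). f i) = (\<Sum>i\<in>UNIV. f (Inl i)) + (\<Sum>j\<in>UNIV. f (Inr j))"
  unfolding UNIV_Plus_UNIV[symmetric] by (subst sum.Plus) auto

lemma inner_vjoin: "vjoin x y \<bullet> vjoin x' y' = x \<bullet> x' + y \<bullet> y'"
  by (simp add: inner_vec_def sum_sum_type)

lemma hcat_mult_vjoin: "hcat M N *v vjoin x y = M *v x + N *v y"
  by (simp add: vec_eq_iff matrix_vector_mult_def hcat_def sum_sum_type)

lemma vcat_mult: "vcat M N *v x = vjoin (M *v x) (N *v x)"
  by (simp add: vec_sum_eq_iff matrix_vector_mult_def vcat_def)

lemma block2_mult_vjoin: "block2 M11 M12 M21 M22 *v vjoin x y = vjoin (M11 *v x + M12 *v y) (M21 *v x + M22 *v y)"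
  by (simp add: block2_def vcat_mult hcat_mult_vjoin)

lemma transpose_hcat: "transpose (hcat M N) = vcat (transpose M) (transpose N)"
  by (simp add: vec_eq_iff transpose_def hcat_def vcat_def split: sum.split)

lemma transpose_block2:
  "transpose (block2 M11 M12 M21 M22) = block2 (transpose M11) (transpose M21) (transpose M12) (transpose M22)"
  by (simp add: block2_def vec_eq_iff transpose_def hcat_def vcat_def split: sum.split)

lemma block2_eq_iff: "block2 M11 M12 M21 M22 = block2 N11 N12 N21 N22 \<longleftrightarrow> M11 = N11 \<and> M12 = N12 \<and> M21 = N21 \<and> M22 = N22"
  by (simp add: block2_def vcat_def hcat_def vec_sum_eq_iff) (auto simp: vec_eq_iff)

lemma block2_sub: "block2 (sub11 M) (sub12 M) (sub21 M) (sub22 M) = M"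
  by (simp add: vec_sum_eq_iff block2_def hcat_def vcat_def sub11_def sub12_def sub21_def sub22_def)

lemma sub_block2 [simp]:
  "sub11 (block2 M11 M12 M21 M22) = M11" "sub12 (block2 M11 M12 M21 M22) = M12"
  "sub21 (block2 M11 M12 M21 M22) = M21" "sub22 (block2 M11 M12 M21 M22) = M22"
  using block2_sub[of "block2 M11 M12 M21 M22"] by (simp_all add: block2_eq_iff)

section \<open>Lyapunov's theorem\<close>

lemma negative_form_margin:
  fixes f :: "'a::euclidean_space \<Rightarrow> real"
  assumes cont: "continuous_on UNIV f" and hom: "\<And>r x. f (r *\<^sub>R x) = r\<^sup>2 * f x"
    and neg: "\<And>x. x \<noteq> 0 \<Longrightarrow> f x < 0"
  obtains c where "c > 0" "\<And>x. f x \<le> - c * (norm x)\<^sup>2"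
proof -
  obtain u where u: "norm u = 1" "\<And>x. f x \<le> f u * (norm x)\<^sup>2"
    by (rule homogeneous_form_max[OF subspace_UNIV UNIV_not_singleton cont hom]) blast
  then have "u \<noteq> 0" by auto
  then show thesis using that[of "- f u"] neg[of u] u by simp
qed

text \<open>\<open>P\<close> solves the strict Lyapunov inequality for \<open>A - t I\<close>; no sign of \<open>P\<close> is required.\<close>

definition lyapunov_solution :: "real^'n^'n \<Rightarrow> real \<Rightarrow> real^'n^'n \<Rightarrow> bool" where
  "lyapunov_solution A t P \<longleftrightarrow> transpose P = P \<and> (\<forall>x. x \<noteq> 0 \<longrightarrow> (A *v x - t *\<^sub>R x) \<bullet> (P *v x) < 0)"

lemma lyapunov_solution_exists:
  assumes A: "hurwitz A" and t: "0 \<le> t"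
  shows "\<exists>P. lyapunov_solution A t P"
proof -
  have "\<exists>P. transpose P = P \<and> (\<forall>z. z \<noteq> 0 \<longrightarrow>
      z \<bullet> (0 *v z) + 2 * (((A - t *\<^sub>R mat 1) *v z) \<bullet> (P *v (mat 1 *v z))) < 0)"
  proof (rule kyp_strict)
    fix w a b
    assume nz: "a \<noteq> 0 \<or> b \<noteq> 0" and "(A - t *\<^sub>R mat 1) *v a = - w *\<^sub>R (mat 1 *v b)"
      "(A - t *\<^sub>R mat 1) *v b = w *\<^sub>R (mat 1 *v a)"
    then have "A *v a = t *\<^sub>R a - w *\<^sub>R b" "A *v b = w *\<^sub>R a + t *\<^sub>R b"
      by (simp_all add: matrix_vector_mult_diff_rdistrib scaleR_matrix_mult algebra_simps)
    then have "t < 0" using A nz unfolding hurwitz_real by blast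
    then show "a \<bullet> (0 *v a) + b \<bullet> (0 *v b) < 0" using t by simp
  qed simp
  then show ?thesis
    by (simp add: lyapunov_solution_def matrix_vector_mult_diff_rdistrib scaleR_matrix_mult)
qed

text \<open>
  Were one solution positive definite and another one not, the pencil of the two would have an
  eigenvector on which the two inequalities contradict each other.
\<close>

lemma lyapunov_solutions_same_sign:
  assumes P: "lyapunov_solution A t P" "pos_def P" and Q: "lyapunov_solution A t Q"
  shows "pos_def Q"
proof (rule ccontr)
  assume "\<not> pos_def Q"
  then obtain x where x: "x \<noteq> 0" "x \<bullet> (Q *v x) \<le> 0"
    using Q by (auto simp: pos_def_def lyapunov_solution_def not_less)
  have symP: "transpose P = P" and symQ: "transpose Q = Q"
    using P Q by (auto simp: lyapunov_solution_def)
  have ker: "P *v y = 0 \<longleftrightarrow> y = 0" for y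
    using P(2) by (auto simp: pos_def_def)
  have linQ: "linear (\<lambda>x. - (Q *v x))" by (intro linear_compose_neg matrix_vector_mul_linear)
  obtain l v where v: "P *v v \<noteq> 0" "- (Q *v v) = l *\<^sub>R (P *v v)"
    and mx: "\<And>y. y \<bullet> - (Q *v y) \<le> l * (y \<bullet> (P *v y))"
  proof (rule self_adjoint_pencil[where p = "(*v) P" and q = "\<lambda>x. - (Q *v x)" and z = x])
    show "0 \<le> y \<bullet> (P *v y)" for y
      using P(2) pos_def_imp_pos_semidef by (auto simp: pos_semidef_def)
  qed (use linQ x ker symmetric_inner[OF symP] symmetric_inner[OF symQ] in auto)
  have "0 < x \<bullet> (P *v x)" using P(2) x(1) by (simp add: pos_def_def)
  moreover have "0 \<le> l * (x \<bullet> (P *v x))" using mx[of x] x(2) by simp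
  ultimately have l: "0 \<le> l" by (simp add: zero_le_mult_iff)
  have v0: "v \<noteq> 0" using v(1) ker by auto
  define y where "y = A *v v - t *\<^sub>R v"
  have "y \<bullet> (P *v v) < 0" "y \<bullet> (Q *v v) < 0"
    using P(1) Q v0 by (auto simp: y_def lyapunov_solution_def)
  moreover have "y \<bullet> (Q *v v) = - l * (y \<bullet> (P *v v))"
    using v(2) by (metis inner_minus_right inner_scaleR_right minus_minus mult_minus_left)
  ultimately show False using l mult_nonneg_nonpos[of l "y \<bullet> (P *v v)"] by simp
qed

text \<open>For large \<open>t\<close> the identity solves the inequality for \<open>A - t I\<close>. The set of \<open>t \<ge> 0\<close> that admit a
  positive definite solution is open and, as some solution exists for every \<open>t\<close> and all solutions for
  the same \<open>t\<close> share their sign, contains its infimum; so it contains \<open>0\<close>.\<close>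

theorem lyapunov_pos_def:
  assumes A: "hurwitz A" and P: "lyapunov_solution A 0 P"
  shows "pos_def P"
proof -
  define S where "S = {t. 0 \<le> t \<and> (\<exists>P. lyapunov_solution A t P \<and> pos_def P)}"
  define N where "N = onorm (\<lambda>x. A *v x)"
  note N = matvec_bound[of A, folded N_def]
  have "N + 1 \<in> S"
  proof -
    have "(A *v x - (N + 1) *\<^sub>R x) \<bullet> x < 0" if "x \<noteq> 0" for x
    proof -
      have "(A *v x) \<bullet> x \<le> N * norm x * norm x"
        by (rule order_trans[OF norm_cauchy_schwarz]) (simp add: N mult_right_mono)
      also have "\<dots> < (N + 1) * (x \<bullet> x)"
        using that by (simp add: power2_norm_eq_inner[symmetric] power2_eq_square)
      finally show ?thesis by (simp add: inner_diff_left)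
    qed
    then have "lyapunov_solution A (N + 1) (mat 1)" by (simp add: lyapunov_solution_def transpose_mat)
    moreover have "pos_def (mat 1 :: real^'a^'a)" by (simp add: pos_def_def transpose_mat)
    ultimately show ?thesis using N(2) by (auto simp: S_def)
  qed
  then have ne: "S \<noteq> {}" by blast
  have bdd: "bdd_below S" by (rule bdd_belowI[of _ 0]) (simp add: S_def)
  define T where "T = Inf S"
  have T0: "0 \<le> T" unfolding T_def by (rule cInf_greatest[OF ne]) (simp add: S_def)
  obtain X where X: "lyapunov_solution A T X" using lyapunov_solution_exists[OF A T0] by blast
  obtain c where c: "c > 0" and cX: "\<And>x. (A *v x - T *\<^sub>R x) \<bullet> (X *v x) \<le> - c * (norm x)\<^sup>2"
  proof (rule negative_form_margin[where f = "\<lambda>x. (A *v x - T *\<^sub>R x) \<bullet> (X *v x)"])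
    show "continuous_on UNIV (\<lambda>x. (A *v x - T *\<^sub>R x) \<bullet> (X *v x))"
      by (intro continuous_intros bounded_linear.continuous_on[OF bounded_linear_matvec])
  qed (use X in \<open>auto simp: lyapunov_solution_def matrix_mult_scaleR power2_eq_square algebra_simps\<close>)
  define m where "m = onorm (\<lambda>x. X *v x)"
  note m = matvec_bound[of X, folded m_def]
  define e where "e = c / (m + 1)"
  have e: "e > 0" using c m(2) by (simp add: e_def)
  have near: "lyapunov_solution A s X" if s: "\<bar>s - T\<bar> < e" for s
  proof -
    have "(A *v x - s *\<^sub>R x) \<bullet> (X *v x) < 0" if x: "x \<noteq> 0" for x
    proof -
      have "(T - s) * (x \<bullet> (X *v x)) \<le> \<bar>T - s\<bar> * \<bar>x \<bullet> (X *v x)\<bar>"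
        by (simp add: abs_mult[symmetric])
      also have "\<dots> \<le> \<bar>T - s\<bar> * (norm x * (m * norm x))"
        by (intro mult_left_mono order_trans[OF Cauchy_Schwarz_ineq2] m) auto
      also have "\<dots> \<le> \<bar>T - s\<bar> * (m + 1) * (norm x)\<^sup>2"
        by (simp add: power2_eq_square algebra_simps mult_left_mono)
      also have "\<dots> < c * (norm x)\<^sup>2"
      proof -
        have "\<bar>T - s\<bar> * (m + 1) < c" using s m(2) by (simp add: e_def abs_minus_commute field_simps)
        then show ?thesis using x by simp
      qed
      finally have "(T - s) * (x \<bullet> (X *v x)) < c * (norm x)\<^sup>2" .
      moreover have "(A *v x - s *\<^sub>R x) \<bullet> (X *v x)
          = (A *v x - T *\<^sub>R x) \<bullet> (X *v x) + (T - s) * (x \<bullet> (X *v x))"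
        by (simp add: inner_diff_left algebra_simps)
      ultimately show ?thesis using cX[of x] by linarith
    qed
    then show ?thesis using X by (simp add: lyapunov_solution_def)
  qed
  obtain s where s: "s \<in> S" "s < T + e"
    using cInf_lessD[OF ne, of "T + e"] e by (auto simp: T_def)
  have "T \<le> s" unfolding T_def by (rule cInf_lower[OF s(1) bdd])
  then have "lyapunov_solution A s X" using s(2) by (intro near) simp
  then have pdX: "pos_def X" using s(1) lyapunov_solutions_same_sign by (auto simp: S_def)
  have "T = 0"
  proof (rule ccontr)
    assume "T \<noteq> 0"
    define r where "r = max 0 (T - e / 2)"
    have r: "r < T" "0 \<le> r" "\<bar>r - T\<bar> < e" using \<open>T \<noteq> 0\<close> T0 e by (auto simp: r_def max_def)
    then have "r \<in> S" using near[of r] pdX by (auto simp: S_def)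
    then have "T \<le> r" unfolding T_def by (rule cInf_lower[OF _ bdd])
    then show False using r by simp
  qed
  then show ?thesis using lyapunov_solutions_same_sign[OF _ pdX P] X by simp
qed

section \<open>The bounded real lemma\<close>

lemma norm_vector_scalar_mult: "norm (c *s (x::complex^'n)) = norm c * norm x"
  by (simp add: norm_vec_def norm_mult L2_set_right_distrib)

text \<open>The feedthrough is the value of the transfer function at infinite frequency.\<close>

lemma feedthrough_bound:
  assumes rb: "resolvent_bound A k"
  shows "norm (cmat D *v d) \<le> hinf_norm (transfer A B C D) * norm d"
proof (rule field_le_epsilon)
  fix e :: real assume e: "e > 0"
  define N where "N = onorm ((*v) (cmat A))"
  define n where "n = onorm ((*v) (cmat C)) * norm (cmat B *v d)"
  have n: "0 \<le> n" by (simp add: n_def matvec_bound)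
  define t where "t = (n + 1) / e"
  define w where "w = N + t"
  have t: "t > 0" using n e by (simp add: t_def add_nonneg_pos)
  have N: "0 \<le> N" by (simp add: N_def matvec_bound)
  obtain x where x: "freq_pencil w A *v x = cmat B *v d"
    by (rule resolvent_solve[OF rb])
  have "w * norm x - N * norm x \<le> norm (cmat B *v d)"
  proof -
    have "norm ((\<i> * complex_of_real w) *s x) = w * norm x"
      using N t by (simp add: norm_vector_scalar_mult norm_mult w_def flip: of_real_add)
    moreover have "cmat B *v d = (\<i> * complex_of_real w) *s x - cmat A *v x"
      using x by (simp add: matrix_vector_mult_diff_rdistrib mat_mult_vec)
    moreover have "norm (cmat A *v x) \<le> N * norm x" unfolding N_def by (rule matvec_bound)
    ultimately show ?thesis
      using norm_triangle_ineq2[of "(\<i> * complex_of_real w) *s x" "cmat A *v x"] by simp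
  qed
  then have nx: "norm x \<le> norm (cmat B *v d) / t" using t by (simp add: w_def field_simps)
  have "norm (cmat C *v x) \<le> onorm ((*v) (cmat C)) * norm x" by (rule matvec_bound)
  also have "\<dots> \<le> onorm ((*v) (cmat C)) * (norm (cmat B *v d) / t)"
    by (intro mult_left_mono nx matvec_bound)
  also have "\<dots> = n / (n + 1) * e" using t by (simp add: n_def[symmetric] t_def)
  also have "\<dots> \<le> e" using n e by (simp add: field_simps)
  finally have "norm (cmat C *v x) \<le> e" .
  moreover have "norm (cmat D *v d) \<le> norm (cmat C *v x + cmat D *v d) + norm (cmat C *v x)"
    by (metis add_diff_cancel_left' norm_triangle_ineq4 add.commute)
  moreover have "norm (cmat C *v x + cmat D *v d) \<le> hinf_norm (transfer A B C D) * norm d"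
    by (rule hinf_norm_bounds(2)[OF rb x])
  ultimately show "norm (cmat D *v d) \<le> hinf_norm (transfer A B C D) * norm d + e" by linarith
qed

text \<open>The dissipation inequality with storage matrix \<open>P\<close> states that this form is not positive.\<close>

abbreviation dissipation where
  "dissipation A B C D P g x d \<equiv>
     2 * ((A *v x + B *v d) \<bullet> (P *v x)) + (norm (C *v x + D *v d))\<^sup>2 - g\<^sup>2 * (norm d)\<^sup>2"

theorem bounded_real_lemma_strict:
  fixes A :: "real^'n^'n" and B :: "real^'d^'n" and C :: "real^'n^'z" and D :: "real^'d^'z"
  assumes A: "hurwitz A" and g: "hinf_norm (transfer A B C D) < g"
  shows "\<exists>P. transpose P = P \<and> (\<forall>x d. x \<noteq> 0 \<or> d \<noteq> 0 \<longrightarrow>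
      dissipation A B C D P g x d < 0)"
proof -
  obtain k where rb: "resolvent_bound A k" using hurwitz_resolvent_bound[OF A] by blast
  define h where "h = hinf_norm (transfer A B C D)"
  have h0: "0 \<le> h" unfolding h_def by (rule hinf_norm_bounds[OF rb])
  have hg: "h\<^sup>2 < g\<^sup>2" using g h0 by (simp add: h_def power_strict_mono)
  let ?E = "hcat (mat 1) 0 :: real^('n + 'd)^'n"
  let ?S = "hcat 0 (mat 1) :: real^('n + 'd)^'d"
  let ?M = "transpose (hcat C D) ** hcat C D - g\<^sup>2 *\<^sub>R (transpose ?S ** ?S)"
  have M: "vjoin x d \<bullet> (?M *v vjoin x d) = (norm (C *v x + D *v d))\<^sup>2 - g\<^sup>2 * (norm d)\<^sup>2" for x d
    by (simp add: matrix_vector_mult_diff_rdistrib scaleR_matrix_mult matrix_vector_mul_assoc[symmetric]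
        inner_diff_right inner_mult_transpose hcat_mult_vjoin power2_norm_eq_inner)
  have "\<exists>P. transpose P = P \<and> (\<forall>z. z \<noteq> 0 \<longrightarrow>
      z \<bullet> (?M *v z) + 2 * ((hcat A B *v z) \<bullet> (P *v (?E *v z))) < 0)"
  proof (rule kyp_strict)
    fix z assume z: "z \<noteq> 0" "?E *v z = 0"
    obtain x d where xd: "z = vjoin x d" by (rule vjoin_cases)
    then have x0: "x = 0" and d0: "d \<noteq> 0" using z by (auto simp: hcat_mult_vjoin)
    have "norm (cvec (D *v d) 0) \<le> h * norm (cvec d 0)"
      using feedthrough_bound[OF rb, of D "cvec d 0" B C] by (simp add: h_def cmat_mult_cvec)
    then have "(norm (cvec (D *v d) 0))\<^sup>2 \<le> h\<^sup>2 * (norm (cvec d 0))\<^sup>2"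
      by (metis norm_ge_zero power_mono power_mult_distrib)
    then have "(norm (D *v d))\<^sup>2 \<le> h\<^sup>2 * (norm d)\<^sup>2" by (simp add: norm_cvec)
    also have "\<dots> < g\<^sup>2 * (norm d)\<^sup>2" using hg d0 by simp
    finally show "z \<bullet> (?M *v z) < 0" by (simp add: xd M x0)
  next
    fix w a b
    assume nz: "a \<noteq> 0 \<or> b \<noteq> 0" and e: "hcat A B *v a = - w *\<^sub>R (?E *v b)" "hcat A B *v b = w *\<^sub>R (?E *v a)"
    obtain x1 d1 where a: "a = vjoin x1 d1" by (rule vjoin_cases)
    obtain x2 d2 where b: "b = vjoin x2 d2" by (rule vjoin_cases)
    have e': "A *v x1 + B *v d1 = - w *\<^sub>R x2" "A *v x2 + B *v d2 = w *\<^sub>R x1"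
      using e by (simp_all add: a b hcat_mult_vjoin)
    have eq: "freq_pencil w A *v cvec x1 x2 = cmat B *v cvec d1 d2"
      unfolding resolvent_mult_cvec cmat_mult_cvec e'[symmetric] by simp
    have "cvec d1 d2 \<noteq> 0"
    proof
      assume "cvec d1 d2 = 0"
      then have "norm (cvec x1 x2) \<le> 0" using resolvent_boundD[OF rb, of "cvec x1 x2" w] eq by simp
      then show False using nz \<open>cvec d1 d2 = 0\<close> by (simp add: a b cvec_eq_0_iff)
    qed
    then have d: "(norm (cvec d1 d2))\<^sup>2 > 0" by simp
    have "norm (cmat C *v cvec x1 x2 + cmat D *v cvec d1 d2) \<le> h * norm (cvec d1 d2)"
      unfolding h_def by (rule hinf_norm_bounds(2)[OF rb eq])
    then have "(norm (cmat C *v cvec x1 x2 + cmat D *v cvec d1 d2))\<^sup>2 \<le> h\<^sup>2 * (norm (cvec d1 d2))\<^sup>2"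
      by (metis norm_ge_zero power_mono power_mult_distrib)
    also have "\<dots> < g\<^sup>2 * (norm (cvec d1 d2))\<^sup>2" using hg d by simp
    finally show "a \<bullet> (?M *v a) + b \<bullet> (?M *v b) < 0"
      by (simp add: a b M cmat_mult_cvec cvec_add norm_cvec distrib_left)
  qed
  then obtain P where symP: "transpose P = P"
    and neg: "\<And>z. z \<noteq> 0 \<Longrightarrow> z \<bullet> (?M *v z) + 2 * ((hcat A B *v z) \<bullet> (P *v (?E *v z))) < 0" by blast
  have neg': "dissipation A B C D P g x d < 0"
    if "x \<noteq> 0 \<or> d \<noteq> 0" for x d
    using neg[of "vjoin x d"] that by (simp add: M hcat_mult_vjoin)
  then show ?thesis using symP by blast
qed

text \<open>With \<open>d = 0\<close> the strict inequality is a Lyapunov inequality.\<close>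

lemma strict_brl_pos_def:
  assumes A: "hurwitz A" and P: "transpose P = P"
    and neg: "\<And>x d. x \<noteq> 0 \<or> d \<noteq> 0 \<Longrightarrow>
      dissipation A B C D P g x d < 0"
  shows "pos_def P"
proof (rule lyapunov_pos_def[OF A])
  have "(A *v x) \<bullet> (P *v x) < 0" if "x \<noteq> 0" for x
  proof -
    have "2 * ((A *v x) \<bullet> (P *v x)) + (norm (C *v x))\<^sup>2 < 0" using neg[of x 0] that by simp
    then show ?thesis using zero_le_power2[of "norm (C *v x)"] by linarith
  qed
  then show "lyapunov_solution A 0 P" using P by (simp add: lyapunov_solution_def)
qed

text \<open>Strictness leaves room for perturbing the certificate in any direction \<open>E\<close>.\<close>

lemma strict_brl_perturb:
  fixes A :: "real^'n^'n" and B :: "real^'d^'n" and C :: "real^'n^'z" and D :: "real^'d^'z"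
  assumes neg: "\<And>x d. x \<noteq> 0 \<or> d \<noteq> 0 \<Longrightarrow>
      dissipation A B C D P g x d < 0"
  shows "\<exists>e>0. \<forall>t x d. 0 < t \<longrightarrow> t < e \<longrightarrow> x \<noteq> 0 \<or> d \<noteq> 0 \<longrightarrow>
      dissipation A B C D (P + t *\<^sub>R E) g x d < 0"
proof -
  define f :: "(real^'n) \<times> (real^'d) \<Rightarrow> real" where
    "f p = 2 * ((A *v fst p + B *v snd p) \<bullet> (P *v fst p)) + (norm (C *v fst p + D *v snd p))\<^sup>2
       - g\<^sup>2 * (norm (snd p))\<^sup>2" for p
  define h :: "(real^'n) \<times> (real^'d) \<Rightarrow> real" where
    "h p = 2 * ((A *v fst p + B *v snd p) \<bullet> (E *v fst p))" for p
  have cont: "continuous_on UNIV f" "continuous_on UNIV h" unfolding f_def h_def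
    by (intro continuous_intros bounded_linear.continuous_on[OF bounded_linear_matvec])+
  have hom: "f (r *\<^sub>R p) = r\<^sup>2 * f p" "h (r *\<^sub>R p) = r\<^sup>2 * h p" for r p
    unfolding f_def h_def
    by (simp_all add: matrix_mult_scaleR power_mult_distrib right_diff_distrib power2_eq_square[of r]
        distrib_left scaleR_add_right[symmetric] del: scaleR_add_right)
  obtain c where c: "c > 0" "\<And>p. f p \<le> - c * (norm p)\<^sup>2"
  proof (rule negative_form_margin[OF cont(1) hom(1)])
    show "f p < 0" if "p \<noteq> 0" for p
      using that neg[of "fst p" "snd p"] by (cases p) (auto simp: f_def zero_prod_def)
  qed blast
  obtain u where u: "\<And>p. h p \<le> h u * (norm p)\<^sup>2"
    by (rule homogeneous_form_max[OF subspace_UNIV UNIV_not_singleton cont(2) hom(2)]) blast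
  define m where "m = max 0 (h u) + 1"
  have m: "m > 0" "h p \<le> m * (norm p)\<^sup>2" for p
  proof -
    show "m > 0" by (simp add: m_def)
    have "h u * (norm p)\<^sup>2 \<le> m * (norm p)\<^sup>2" by (intro mult_right_mono) (auto simp: m_def)
    then show "h p \<le> m * (norm p)\<^sup>2" using u[of p] by simp
  qed
  show ?thesis
  proof (intro exI[of _ "c / m"] conjI allI impI)
    show "c / m > 0" using c m by simp
    fix t :: real and x :: "real^'n" and d :: "real^'d"
    assume t: "0 < t" "t < c / m" and nz: "x \<noteq> 0 \<or> d \<noteq> 0"
    have "dissipation A B C D (P + t *\<^sub>R E) g x d
        = f (x, d) + t * h (x, d)"
      by (simp add: f_def h_def matrix_vector_mult_add_rdistrib scaleR_matrix_mult inner_add_right)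
    also have "\<dots> \<le> - c * (norm (x, d))\<^sup>2 + t * (m * (norm (x, d))\<^sup>2)"
      using t by (intro add_mono c m mult_left_mono) auto
    also have "\<dots> = (t * m - c) * (norm (x, d))\<^sup>2" by (simp add: algebra_simps)
    also have "\<dots> < 0"
      using t m(1) nz by (intro mult_neg_pos) (auto simp: field_simps zero_prod_def)
    finally show "dissipation A B C D (P + t *\<^sub>R E) g x d < 0" .
  qed
qed

section \<open>Block matrix inequalities as quadratic forms\<close>

lemma minus_matrix_mult: "(- M) *v x = - (M *v (x::real^'a))"
  using scaleR_matrix_mult[of "-1" M x] by simp

lemma matrix_mult_minus: "M *v (- x) = - (M *v (x::real^'a))"
  by (simp add: linear_neg)

lemma mat_scalar_mult: "mat c *v x = c *\<^sub>R (x::real^'a)"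
  by (simp add: mat_mult_vec vec_eq_iff)

lemma inner_symmetric_swap:
  assumes "transpose P = P" shows "x \<bullet> (P *v y) = y \<bullet> (P *v (x::real^'a))"
  by (subst symmetric_inner[OF assms, symmetric]) (rule inner_commute)

lemma neg_semidef_iff: "neg_semidef M \<longleftrightarrow> transpose M = M \<and> (\<forall>x. x \<bullet> (M *v x) \<le> 0)"
proof -
  have "transpose (- M) = - M \<longleftrightarrow> transpose M = M"
    by (simp add: transpose_def vec_eq_iff)
  then show ?thesis by (simp add: neg_semidef_def pos_semidef_def minus_matrix_mult)
qed

lemma sym_block3_mult:
  fixes M11 :: "real^'a::finite^'a" and M22 :: "real^'b::finite^'b" and M33 :: "real^'c::finite^'c"
  shows "sym_block3 M11 M12 M13 M22 M23 M33 *v vjoin x (vjoin y z) =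
    vjoin (M11 *v x + M12 *v y + M13 *v z)
      (vjoin (transpose M12 *v x + M22 *v y + M23 *v z)
             (transpose M13 *v x + transpose M23 *v y + M33 *v z))"
  by (simp add: sym_block3_def block2_mult_vjoin hcat_mult_vjoin transpose_hcat vcat_mult vjoin_add
      add.assoc)

lemma transpose_sym_block3:
  "transpose (sym_block3 M11 M12 M13 M22 M23 M33) = sym_block3 M11 M12 M13 M22 M23 M33 \<longleftrightarrow>
    transpose M11 = M11 \<and> transpose M22 = M22 \<and> transpose M33 = M33"
  by (simp add: sym_block3_def transpose_block2 block2_eq_iff)

lemma neg_semidef_sym_block3:
  fixes M11 :: "real^'a::finite^'a" and M22 :: "real^'b::finite^'b" and M33 :: "real^'c::finite^'c"
  shows "neg_semidef (sym_block3 M11 M12 M13 M22 M23 M33) \<longleftrightarrow>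
    (transpose M11 = M11 \<and> transpose M22 = M22 \<and> transpose M33 = M33) \<and>
    (\<forall>x y z. x \<bullet> (M11 *v x) + 2 * (x \<bullet> (M12 *v y)) + 2 * (x \<bullet> (M13 *v z)) + y \<bullet> (M22 *v y)
        + 2 * (y \<bullet> (M23 *v z)) + z \<bullet> (M33 *v z) \<le> 0)"
proof -
  have q: "vjoin x (vjoin y z) \<bullet> (sym_block3 M11 M12 M13 M22 M23 M33 *v vjoin x (vjoin y z)) =
      x \<bullet> (M11 *v x) + 2 * (x \<bullet> (M12 *v y)) + 2 * (x \<bullet> (M13 *v z)) + y \<bullet> (M22 *v y)
        + 2 * (y \<bullet> (M23 *v z)) + z \<bullet> (M33 *v z)" for x y z
    by (simp add: sym_block3_mult inner_vjoin inner_add_right inner_mult_transpose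
        inner_commute[of _ x] inner_commute[of _ y])
  have all: "(\<forall>w. Q w) \<longleftrightarrow> (\<forall>x y z. Q (vjoin x (vjoin y z)))" for Q :: "real^('a + ('b + 'c)) \<Rightarrow> bool"
    by (metis vjoin_cases)
  show ?thesis unfolding neg_semidef_iff transpose_sym_block3 all q by simp
qed

lemma neg_semidef_sym_block4:
  fixes M11 :: "real^'a::finite^'a" and M22 :: "real^'b::finite^'b"
    and M33 :: "real^'c::finite^'c" and M44 :: "real^'d::finite^'d"
  shows "neg_semidef (sym_block4 M11 M12 M13 M14 M22 M23 M24 M33 M34 M44) \<longleftrightarrow>
    (transpose M11 = M11 \<and> transpose M22 = M22 \<and> transpose M33 = M33 \<and> transpose M44 = M44) \<and>
    (\<forall>x y z u. x \<bullet> (M11 *v x) + 2 * (x \<bullet> (M12 *v y)) + 2 * (x \<bullet> (M13 *v z)) + 2 * (x \<bullet> (M14 *v u))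
        + y \<bullet> (M22 *v y) + 2 * (y \<bullet> (M23 *v z)) + 2 * (y \<bullet> (M24 *v u))
        + z \<bullet> (M33 *v z) + 2 * (z \<bullet> (M34 *v u)) + u \<bullet> (M44 *v u) \<le> 0)"
proof -
  let ?M = "sym_block4 M11 M12 M13 M14 M22 M23 M24 M33 M34 M44"
  have q: "vjoin x (vjoin y (vjoin z u)) \<bullet> (?M *v vjoin x (vjoin y (vjoin z u))) =
      x \<bullet> (M11 *v x) + 2 * (x \<bullet> (M12 *v y)) + 2 * (x \<bullet> (M13 *v z)) + 2 * (x \<bullet> (M14 *v u))
        + y \<bullet> (M22 *v y) + 2 * (y \<bullet> (M23 *v z)) + 2 * (y \<bullet> (M24 *v u))
        + z \<bullet> (M33 *v z) + 2 * (z \<bullet> (M34 *v u)) + u \<bullet> (M44 *v u)" for x y z u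
    by (simp add: sym_block4_def block2_mult_vjoin hcat_mult_vjoin transpose_hcat vcat_mult
        sym_block3_mult inner_vjoin inner_add_right inner_mult_transpose
        inner_commute[of _ x] inner_commute[of _ y] inner_commute[of _ z])
  have all: "(\<forall>w. Q w) \<longleftrightarrow> (\<forall>x y z u. Q (vjoin x (vjoin y (vjoin z u))))"
    for Q :: "real^('a + ('b + ('c + 'd))) \<Rightarrow> bool"
    by (metis vjoin_cases)
  have tr: "transpose ?M = ?M \<longleftrightarrow>
      transpose M11 = M11 \<and> transpose M22 = M22 \<and> transpose M33 = M33 \<and> transpose M44 = M44"
    by (simp add: sym_block4_def transpose_block2 block2_eq_iff transpose_sym_block3)
  show ?thesis unfolding neg_semidef_iff tr all q by simp
qed

text \<open>
  The quadratic form of the bounded real inequality with storage matrix \<open>P\<close> and level \<open>g\<close>; its matrix,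
  for symmetric \<open>P\<close>, is \<open>brl_matrix\<close>.
\<close>

definition brl_form where
  "brl_form A B C D P g x d z =
     2 * ((A *v x + B *v d) \<bullet> (P *v x)) + 2 * (z \<bullet> (C *v x + D *v d))
     - g * ((norm d)\<^sup>2 + (norm z)\<^sup>2)"

abbreviation brl_matrix where
  "brl_matrix A B C D P g \<equiv> sym_block3 (transpose A ** P + P ** A) (P ** B) (transpose C)
     (mat (- g)) (transpose D) (mat (- g))"

lemma neg_semidef_brl_matrix:
  fixes A :: "real^'n::finite^'n" and B :: "real^'d::finite^'n" and C :: "real^'n^'z::finite" and D :: "real^'d^'z"
  assumes P: "transpose P = P"
  shows "neg_semidef (brl_matrix A B C D P g) \<longleftrightarrow> (\<forall>x d z. brl_form A B C D P g x d z \<le> 0)"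
proof -
  have tr: "transpose (transpose A ** P + P ** A) = transpose A ** P + P ** A"
    using P by (simp add: transpose_add matrix_transpose_mul add.commute)
  have q: "x \<bullet> ((transpose A ** P + P ** A) *v x) + 2 * (x \<bullet> (P ** B *v d)) + 2 * (x \<bullet> (transpose C *v z))
        + d \<bullet> (mat (- g) *v d) + 2 * (d \<bullet> (transpose D *v z)) + z \<bullet> (mat (- g) *v z)
      = brl_form A B C D P g x d z" for x d z
  proof -
    have "x \<bullet> (P *v (A *v x)) = (A *v x) \<bullet> (P *v x)" "x \<bullet> (P *v (B *v d)) = (B *v d) \<bullet> (P *v x)"
      by (rule inner_symmetric_swap[OF P])+
    then show ?thesis
      by (simp add: brl_form_def mult_vec_simps
          inner_add_right inner_add_left inner_mult_transpose mat_scalar_mult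
          inner_commute[of "C *v x"] inner_commute[of "D *v d"] power2_norm_eq_inner distrib_left)
  qed
  show ?thesis unfolding neg_semidef_sym_block3 q using tr by (simp add: transpose_mat)
qed

lemma level_bound:
  fixes g y d :: real
  assumes "0 \<le> g" and le: "\<And>t. 2 * t * y - g * (d + t\<^sup>2 * y) \<le> 0"
  shows "y \<le> g\<^sup>2 * d"
proof (cases "g = 0")
  case True
  then show ?thesis using le[of 1] by simp
next
  case False
  then have g: "g > 0" using assms by simp
  have "2 * (1 / g) * y - g * (d + (1 / g)\<^sup>2 * y) = y / g - g * d"
    using g by (simp add: power2_eq_square field_simps)
  then have "y / g \<le> g * d" using le[of "1 / g"] by simp
  then show ?thesis using g by (simp add: power2_eq_square field_simps)
qed

text \<open>The easy half of the bounded real lemma: a certificate bounds the norm.\<close>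

lemma bounded_real_lemma_converse:
  fixes A :: "real^'n::finite^'n" and B :: "real^'d::finite^'n" and C :: "real^'n^'z::finite" and D :: "real^'d^'z"
  assumes P: "transpose P = P" and rb: "resolvent_bound A k"
    and le: "\<And>x d z. brl_form A B C D P g x d z \<le> 0"
  shows "hinf_norm (transfer A B C D) \<le> g"
proof -
  obtain u :: "real^'d" where u: "norm u = 1" using vector_choose_size[of 1] by auto
  have g0: "0 \<le> g" using le[of 0 u 0] u by (simp add: brl_form_def)
  show ?thesis
  proof (rule hinf_norm_le[OF rb g0])
    fix w x d
    assume eq: "freq_pencil w A *v x = cmat B *v d"
    obtain x1 x2 where x: "x = cvec x1 x2" by (rule cvec_cases)
    obtain d1 d2 where d: "d = cvec d1 d2" by (rule cvec_cases)
    have "- w *\<^sub>R x2 - A *v x1 = B *v d1" "w *\<^sub>R x1 - A *v x2 = B *v d2"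
      using eq unfolding x d resolvent_mult_cvec cmat_mult_cvec cvec_eq_iff by blast+
    then have e: "A *v x1 + B *v d1 = - w *\<^sub>R x2" "A *v x2 + B *v d2 = w *\<^sub>R x1"
      by (metis add_diff_cancel_left' diff_add_cancel add.commute)+
    define z1 where "z1 = C *v x1 + D *v d1"
    define z2 where "z2 = C *v x2 + D *v d2"
    have z: "cmat C *v x + cmat D *v d = cvec z1 z2"
      by (simp add: x d cmat_mult_cvec cvec_add z1_def z2_def)
    let ?z = "(norm (cvec z1 z2))\<^sup>2" and ?d = "(norm d)\<^sup>2"
    have sum: "2 * t * ?z - g * (?d + t\<^sup>2 * ?z) \<le> 0" for t
    proof -
      have sw: "x1 \<bullet> (P *v x2) = x2 \<bullet> (P *v x1)" by (rule inner_symmetric_swap[OF P])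
      have "brl_form A B C D P g x1 d1 (t *\<^sub>R z1) + brl_form A B C D P g x2 d2 (t *\<^sub>R z2)
          = 2 * t * ?z - g * (?d + t\<^sup>2 * ?z)"
        unfolding brl_form_def e z1_def[symmetric] z2_def[symmetric] d norm_cvec
        by (simp add: sw power_mult_distrib distrib_left flip: power2_norm_eq_inner)
      then show ?thesis using le[of x1 d1 "t *\<^sub>R z1"] le[of x2 d2 "t *\<^sub>R z2"] by linarith
    qed
    have "?z \<le> (g * norm d)\<^sup>2"
      using level_bound[of g ?z ?d, OF g0 sum] by (simp only: power_mult_distrib)
    then show "norm (cmat C *v x + cmat D *v d) \<le> g * norm d"
      unfolding z by (rule power2_le_imp_le) (simp add: g0)
  qed
qed

text \<open>A state at which a negative semidefinite form vanishes lies in the kernel of its matrix.\<close>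

lemma brl_null_vector:
  fixes A :: "real^'n::finite^'n" and B :: "real^'d::finite^'n" and C :: "real^'n^'z::finite" and D :: "real^'d^'z"
  assumes P: "transpose P = P" and le: "\<And>x d z. brl_form A B C D P g x d z \<le> 0"
    and x: "(A *v x) \<bullet> (P *v x) = 0"
  shows "transpose A *v (P *v x) + P *v (A *v x) = 0"
    and "transpose B *v (P *v x) = 0" and "C *v x = 0"
proof -
  let ?M = "brl_matrix A B C D P g"
  have "neg_semidef ?M" using le neg_semidef_brl_matrix[OF P] by blast
  moreover have M: "?M *v vjoin x (vjoin 0 0) =
      vjoin (transpose A *v (P *v x) + P *v (A *v x)) (vjoin (transpose B *v (P *v x)) (C *v x))"
    unfolding sym_block3_mult
    by (simp add: mult_vec_simps
        matrix_transpose_mul P transpose_transpose)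
  moreover have "vjoin x (vjoin 0 0) \<bullet> (?M *v vjoin x (vjoin 0 0)) = 0"
    unfolding M using x symmetric_inner[OF P, of x "A *v x"]
    by (simp add: inner_vjoin inner_add_right inner_mult_transpose inner_commute)
  ultimately have "?M *v vjoin x (vjoin 0 0) = 0"
    using pos_semidef_null[of "- ?M" "vjoin x (vjoin 0 0)"]
    by (simp add: neg_semidef_def minus_matrix_mult)
  then show "transpose A *v (P *v x) + P *v (A *v x) = 0"
    and "transpose B *v (P *v x) = 0" and "C *v x = 0"
    unfolding M vjoin_eq_0_iff by blast+
qed

section \<open>Popov--Belevitch--Hautus tests\<close>

lemma orthogonal_to_full_dim:
  fixes S :: "(real^'n) set"
  assumes "dim S = CARD('n)" and "\<And>s. s \<in> S \<Longrightarrow> s \<bullet> x = 0"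
  shows "x = 0"
proof -
  have "x \<in> span S" using assms(1) dim_eq_full[of S] by simp
  moreover have "orthogonal x s" if "s \<in> S" for s
    using assms(2)[OF that] by (simp add: orthogonal_def inner_commute)
  ultimately have "orthogonal x x" using orthogonal_to_span by blast
  then show ?thesis by (simp add: orthogonal_def)
qed

lemma matpow_Suc_right: "matpow A (Suc k) = matpow A k ** A"
  by (induction k) (simp_all add: matpow_def matrix_mul_assoc)

text \<open>Kalman's rank condition excludes unobservable modes; only modes \<open>a + \<i> b\<close> with eigenvalue \<open>\<i> w\<close> on
  the imaginary axis are needed, in real form.\<close>

lemma observable_mode:
  fixes A :: "real^'n^'n"
  assumes obs: "observable C A" and e: "A *v a = - w *\<^sub>R b" "A *v b = w *\<^sub>R a"
    and C: "C *v a = 0" "C *v b = 0"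
  shows "a = 0" and "b = 0"
proof -
  have k: "C *v (matpow A k *v a) = 0 \<and> C *v (matpow A k *v b) = 0" for k
  proof (induction k)
    case (Suc k)
    have "matpow A (Suc k) *v x = matpow A k *v (A *v x)" for x
      by (simp add: matpow_Suc_right matrix_vector_mul_assoc)
    then show ?case using Suc e by (simp add: matrix_mult_scaleR matrix_mult_minus)
  qed (simp add: matpow_def C)
  have orth: "s \<bullet> x = 0" if s: "s \<in> (\<Union>k<CARD('n). rows (C ** matpow A k))"
    and x: "\<And>k. C *v (matpow A k *v x) = 0" for s x
  proof -
    obtain k i where s: "s = row i (C ** matpow A k)" using s by (auto simp: rows_def)
    have "s \<bullet> x = ((C ** matpow A k) *v x) $ i"
      by (simp add: s matrix_vector_mul_component row_def)
    then show ?thesis using x by (simp add: matrix_vector_mul_assoc[symmetric])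
  qed
  show "a = 0" by (rule orthogonal_to_full_dim[OF obs[unfolded observable_def] orth]) (simp_all add: k)
  show "b = 0" by (rule orthogonal_to_full_dim[OF obs[unfolded observable_def] orth]) (simp_all add: k)
qed

lemma controllable_mode:
  fixes A :: "real^'n^'n"
  assumes ctr: "controllable A B" and e: "transpose A *v a = - w *\<^sub>R b" "transpose A *v b = w *\<^sub>R a"
    and B: "transpose B *v a = 0" "transpose B *v b = 0"
  shows "a = 0" and "b = 0"
proof -
  have "transpose (matpow A k) = matpow (transpose A) k" for k
  proof (induction k)
    case (Suc k)
    have "transpose (matpow A (Suc k)) = transpose (matpow A k) ** transpose A"
      by (simp add: matpow_def matrix_transpose_mul)
    then show ?case by (simp add: Suc matpow_Suc_right)
  qed (simp add: matpow_def transpose_mat)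
  then have "columns (matpow A k ** B) = rows (transpose B ** matpow (transpose A) k)" for k
    by (metis matrix_transpose_mul rows_transpose)
  then have "observable (transpose B) (transpose A)"
    using ctr by (simp add: controllable_def observable_def)
  from observable_mode[OF this e B] show "a = 0" "b = 0" .
qed

section \<open>The closed loop\<close>

lemma Jinf_transfer: "Jinf A B C Q R W V K = hinf_norm (transfer (Acl A B C K) (Bcl B W V K) (Ccl C Q R K) (Dcl R V K))"
  by (simp add: Jinf_def Tzd_def[abs_def] transfer_def[abs_def])

lemma Acl_mult: "Acl A B C K *v vjoin x y =
    vjoin (A *v x + B *v (sub11 K *v (C *v x) + sub12 K *v y)) (sub21 K *v (C *v x) + sub22 K *v y)"
  by (simp add: Acl_def block2_mult_vjoin mult_vec_simps)

lemma Bcl_mult: "Bcl B W V K *v vjoin d e =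
    vjoin (msqrt W *v d + B *v (sub11 K *v (msqrt V *v e))) (sub21 K *v (msqrt V *v e))"
  by (simp add: Bcl_def block2_mult_vjoin matrix_vector_mul_assoc[symmetric])

lemma Ccl_mult: "Ccl C Q R K *v vjoin x y =
    vjoin (msqrt Q *v x) (msqrt R *v (sub11 K *v (C *v x) + sub12 K *v y))"
  by (simp add: Ccl_def block2_mult_vjoin mult_vec_simps)

lemma Dcl_mult: "Dcl R V K *v vjoin d e = vjoin 0 (msqrt R *v (sub11 K *v (msqrt V *v e)))"
  by (simp add: Dcl_def block2_mult_vjoin matrix_vector_mul_assoc[symmetric])

lemma Linf_d_iff:
  "(K, g, P) \<in> Linf_d A B C Q R W V \<longleftrightarrow> pos_def P \<and> invertible (sub12 P) \<and>
    (\<forall>x d z. brl_form (Acl A B C K) (Bcl B W V K) (Ccl C Q R K) (Dcl R V K) P g x d z \<le> 0)"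
proof -
  have "neg_semidef (brl_matrix (Acl A B C K) (Bcl B W V K) (Ccl C Q R K) (Dcl R V K) P g) \<longleftrightarrow>
      (\<forall>x d z. brl_form (Acl A B C K) (Bcl B W V K) (Ccl C Q R K) (Dcl R V K) P g x d z \<le> 0)"
    if "pos_def P"
    using that by (intro neg_semidef_brl_matrix) (simp add: pos_def_def)
  then show ?thesis unfolding Linf_d_def by blast
qed

lemma invertible_iff_ker: "invertible (M :: real^'n^'n) \<longleftrightarrow> (\<forall>x. M *v x = 0 \<longrightarrow> x = 0)"
  unfolding invertible_left_inverse matrix_left_invertible_ker ..

lemma invertible_transpose_real: "invertible (transpose M) \<longleftrightarrow> invertible (M :: real^'n^'n)"
  by (simp add: invertible_det_nz)

text \<open>
  The inequality alone gives a closed loop spectrum in the closed left half plane. For a mode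
  \<open>(x\<^sub>1, x\<^sub>2)\<close> on the imaginary axis, observability of \<open>(Q\<^sup>1\<^sup>/\<^sup>2, A)\<close> forces \<open>x\<^sub>1 = 0\<close>;
  dually, \<open>P x\<close> is a mode of the transposed loop and controllability of \<open>(A, W\<^sup>1\<^sup>/\<^sup>2)\<close> forces its
  first block \<open>P\<^sub>1\<^sub>2 x\<^sub>2\<close> to vanish.
\<close>

lemma lifted_policy_stabilizing:
  fixes A :: "real ^ 'n ^ 'n" and B :: "real ^ 'm ^ 'n" and C :: "real ^ 'n ^ 'p"
    and Q W :: "real ^ 'n ^ 'n" and R :: "real ^ 'm ^ 'm" and V :: "real ^ 'p ^ 'p"
  assumes R: "pos_def R" and V: "pos_def V"
    and ctr: "controllable A (msqrt W)" and obs: "observable (msqrt Q) A"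
    and L: "(K, g, P) \<in> Linf_d A B C Q R W V"
  shows "K \<in> stabilizing A B C"
  unfolding stabilizing_def mem_Collect_eq hurwitz_real
proof (intro allI impI)
  let ?A = "Acl A B C K" and ?B = "Bcl B W V K" and ?C = "Ccl C Q R K" and ?D = "Dcl R V K"
  have P: "pos_def P" and P12: "invertible (sub12 P)"
    and le: "\<And>x d z. brl_form ?A ?B ?C ?D P g x d z \<le> 0"
    using L unfolding Linf_d_iff by blast+
  have symP: "transpose P = P" using P by (simp add: pos_def_def)
  have neg: "(?A *v x) \<bullet> (P *v x) \<le> 0" for x using le[of x 0 0] by (simp add: brl_form_def)
  fix r w a b
  assume nz: "a \<noteq> 0 \<or> b \<noteq> 0" and ea: "?A *v a = r *\<^sub>R a - w *\<^sub>R b" and eb: "?A *v b = w *\<^sub>R a + r *\<^sub>R b"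
  have sw: "a \<bullet> (P *v b) = b \<bullet> (P *v a)" by (rule inner_symmetric_swap[OF symP])
  have sum: "(?A *v a) \<bullet> (P *v a) + (?A *v b) \<bullet> (P *v b) = r * (a \<bullet> (P *v a) + b \<bullet> (P *v b))"
    unfolding ea eb by (simp add: inner_add_left inner_diff_left sw algebra_simps)
  have pos: "0 < a \<bullet> (P *v a) + b \<bullet> (P *v b)"
    using nz P pos_def_imp_pos_semidef[OF P]
    by (auto simp: pos_def_def pos_semidef_def intro: add_pos_nonneg add_nonneg_pos)
  show "r < 0"
  proof (rule ccontr)
    assume "\<not> r < 0"
    then have "0 \<le> (?A *v a) \<bullet> (P *v a) + (?A *v b) \<bullet> (P *v b)"
      unfolding sum using pos by simp
    then have za: "(?A *v a) \<bullet> (P *v a) = 0" and zb: "(?A *v b) \<bullet> (P *v b) = 0"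
      using neg[of a] neg[of b] by linarith+
    then have r: "r = 0" using sum pos by simp
    note na = brl_null_vector[OF symP le za] and nb = brl_null_vector[OF symP le zb]
    obtain a1 a2 where a: "a = vjoin a1 a2" by (rule vjoin_cases)
    obtain b1 b2 where b: "b = vjoin b1 b2" by (rule vjoin_cases)
    have u: "msqrt Q *v a1 = 0" "sub11 K *v (C *v a1) + sub12 K *v a2 = 0"
            "msqrt Q *v b1 = 0" "sub11 K *v (C *v b1) + sub12 K *v b2 = 0"
      using na(3) nb(3) msqrt_pos_def_inject[OF R] by (auto simp: a b Ccl_mult)
    have "A *v a1 = - w *\<^sub>R b1" "A *v b1 = w *\<^sub>R a1"
      using ea eb u r by (auto simp: a b Acl_mult vjoin_scaleR vjoin_add vjoin_diff vjoin_minus)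
    then have ab1: "a1 = 0" "b1 = 0" using observable_mode[OF obs] u by blast+
    obtain p1 p2 where p: "P *v a = vjoin p1 p2" by (rule vjoin_cases)
    obtain q1 q2 where q: "P *v b = vjoin q1 q2" by (rule vjoin_cases)
    have tA: "transpose ?A *v vjoin x y = vjoin (transpose A *v x + transpose C *v
        (transpose (sub11 K) *v (transpose B *v x) + transpose (sub21 K) *v y))
        (transpose (sub12 K) *v (transpose B *v x) + transpose (sub22 K) *v y)" for x y
      by (simp add: Acl_def transpose_block2 block2_mult_vjoin transpose_add matrix_transpose_mul
          mult_vec_simps)
    have tB: "transpose ?B *v vjoin x y = vjoin (transpose (msqrt W) *v x)
        (transpose (msqrt V) *v (transpose (sub11 K) *v (transpose B *v x) + transpose (sub21 K) *v y))" for x y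
    proof -
      have "transpose (0 :: real^'p^'n) = 0" by (simp add: transpose_def vec_eq_iff)
      moreover have "transpose (0 :: real^'n^'n) = 0" by (simp add: transpose_def vec_eq_iff)
      ultimately show ?thesis
        by (simp add: Bcl_def transpose_block2 block2_mult_vjoin matrix_transpose_mul
            mult_vec_simps)
    qed
    have tV: "transpose (msqrt V) = msqrt V"
      using msqrt_properties(1)[OF pos_def_imp_pos_semidef[OF V]] by (simp add: pos_semidef_def)
    have v: "transpose (msqrt W) *v p1 = 0" "transpose (sub11 K) *v (transpose B *v p1) + transpose (sub21 K) *v p2 = 0"
            "transpose (msqrt W) *v q1 = 0" "transpose (sub11 K) *v (transpose B *v q1) + transpose (sub21 K) *v q2 = 0"
      using na(2) nb(2) msqrt_pos_def_inject[OF V] by (auto simp: p q tB tV)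
    have "transpose ?A *v (P *v a) = w *\<^sub>R (P *v b)" "transpose ?A *v (P *v b) = - w *\<^sub>R (P *v a)"
      using na(1) nb(1) unfolding ea eb r
      by (simp_all add: matrix_vector_right_distrib matrix_mult_scaleR matrix_mult_minus eq_neg_iff_add_eq_0)
    then have "transpose A *v p1 = w *\<^sub>R q1" "transpose A *v q1 = - w *\<^sub>R p1"
      using v by (auto simp: p q tA vjoin_scaleR vjoin_minus)
    then have "q1 = 0" "p1 = 0" using controllable_mode[OF ctr, of q1 w p1] v by blast+
    moreover have "P *v vjoin 0 y = vjoin (sub12 P *v y) (sub22 P *v y)" for y
      by (subst block2_sub[of P, symmetric]) (simp add: block2_mult_vjoin)
    ultimately have "sub12 P *v a2 = 0" "sub12 P *v b2 = 0"
      using p q by (auto simp: a b ab1)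
    then have "a2 = 0" "b2 = 0" using P12 unfolding invertible_iff_ker by blast+
    then show False using nz by (simp add: a b ab1)
  qed
qed

lemma lifted_policy_cost:
  assumes "(K, g, P) \<in> Linf_d A B C Q R W V" and "K \<in> stabilizing A B C"
  shows "Jinf A B C Q R W V K \<le> g"
proof -
  obtain k where "resolvent_bound (Acl A B C K) k"
    using assms(2) hurwitz_resolvent_bound unfolding stabilizing_def by blast
  then show ?thesis unfolding Jinf_transfer
    using assms(1) unfolding Linf_d_iff pos_def_def
    by (intro bounded_real_lemma_converse[where P = P]) auto
qed

section \<open>The change of variables\<close>

text \<open>The quadratic form of the linear matrix inequality in the new variables.\<close>

definition convex_form where
  "convex_form A B C Q R W V g L X Y x y d1 d2 z1 z2 =
     2 * (x \<bullet> (A *v (X *v x) + B *v (sub12 L *v x) + A *v y + B *v (sub11 L *v (C *v y))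
        + msqrt W *v d1 + B *v (sub11 L *v (msqrt V *v d2))))
   + 2 * (y \<bullet> (sub22 L *v x + Y *v (A *v y) + sub21 L *v (C *v y)
        + Y *v (msqrt W *v d1) + sub21 L *v (msqrt V *v d2)))
   + 2 * (z1 \<bullet> (msqrt Q *v (X *v x + y)))
   + 2 * (z2 \<bullet> (msqrt R *v (sub12 L *v x + sub11 L *v (C *v y) + sub11 L *v (msqrt V *v d2))))
   - g * ((norm d1)\<^sup>2 + (norm d2)\<^sup>2 + (norm z1)\<^sup>2 + (norm z2)\<^sup>2)"

lemma Finf_d_iff:
  fixes A :: "real ^ 'n ^ 'n" and B :: "real ^ 'm ^ 'n" and C :: "real ^ 'n ^ 'p"
    and Q W :: "real ^ 'n ^ 'n" and R :: "real ^ 'm ^ 'm" and V :: "real ^ 'p ^ 'p"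
  shows "(g, L, X, Y) \<in> Finf_d A B C Q R W V \<longleftrightarrow>
    transpose X = X \<and> transpose Y = Y \<and> pos_def (block2 X (mat 1) (mat 1) Y) \<and>
    (\<forall>x y d1 d2 z1 z2. convex_form A B C Q R W V g L X Y x y d1 d2 z1 z2 \<le> 0)"
proof -
  let ?S = "A ** X + B ** sub12 L" and ?T = "Y ** A + sub21 L ** C" and ?G = "sub11 L" and ?M = "sub22 L"
  let ?B1 = "B1mat W :: real ^ ('n + 'p) ^ 'n" and ?C1 = "C1mat Q :: real ^ 'n ^ ('n + 'm)"
  let ?D12 = "D12mat R :: real ^ 'm ^ ('n + 'm)" and ?D21 = "D21mat V :: real ^ ('n + 'p) ^ 'p"
  have tr: "transpose (N + transpose N) = N + transpose N" for N :: "real^'n^'n"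
    by (simp add: transpose_add add.commute)
  have q: "x \<bullet> ((?S + transpose ?S) *v x) + 2 * (x \<bullet> ((transpose ?M + A + B ** ?G ** C) *v y))
      + 2 * (x \<bullet> ((?B1 + B ** ?G ** ?D21) *v vjoin d1 d2))
      + 2 * (x \<bullet> (transpose (?C1 ** X + ?D12 ** sub12 L) *v vjoin z1 z2))
      + y \<bullet> ((?T + transpose ?T) *v y) + 2 * (y \<bullet> ((Y ** ?B1 + sub21 L ** ?D21) *v vjoin d1 d2))
      + 2 * (y \<bullet> (transpose (?C1 + ?D12 ** ?G ** C) *v vjoin z1 z2))
      + vjoin d1 d2 \<bullet> (mat (- g) *v vjoin d1 d2)
      + 2 * (vjoin d1 d2 \<bullet> (transpose (?D12 ** ?G ** ?D21) *v vjoin z1 z2))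
      + vjoin z1 z2 \<bullet> (mat (- g) *v vjoin z1 z2)
    = convex_form A B C Q R W V g L X Y x y d1 d2 z1 z2" for x y d1 d2 z1 z2
  proof -
    have s: "x \<bullet> ((N + transpose N) *v x) = 2 * (x \<bullet> (N *v x))" for N :: "real^'n^'n" and x
      by (simp add: matrix_vector_mult_add_rdistrib inner_add_right inner_mult_transpose inner_commute)
    note m = mult_vec_simps B1mat_def C1mat_def D12mat_def D21mat_def
      hcat_mult_vjoin vcat_mult inner_vjoin inner_add_right vjoin_add
    have 1: "x \<bullet> ((?S + transpose ?S) *v x) = 2 * (x \<bullet> (A *v (X *v x)) + x \<bullet> (B *v (sub12 L *v x)))"
      unfolding s by (simp add: m)
    have 2: "x \<bullet> ((transpose ?M + A + B ** ?G ** C) *v y)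
        = y \<bullet> (?M *v x) + x \<bullet> (A *v y) + x \<bullet> (B *v (?G *v (C *v y)))"
      by (simp add: m inner_mult_transpose) (simp add: inner_commute)
    have 3: "x \<bullet> ((?B1 + B ** ?G ** ?D21) *v vjoin d1 d2)
        = x \<bullet> (msqrt W *v d1) + x \<bullet> (B *v (?G *v (msqrt V *v d2)))"
      by (simp add: m)
    have 4: "x \<bullet> (transpose (?C1 ** X + ?D12 ** sub12 L) *v vjoin z1 z2)
        = z1 \<bullet> (msqrt Q *v (X *v x)) + z2 \<bullet> (msqrt R *v (sub12 L *v x))"
      unfolding inner_mult_transpose by (simp add: m) (simp add: inner_commute)
    have 5: "y \<bullet> ((?T + transpose ?T) *v y) = 2 * (y \<bullet> (Y *v (A *v y)) + y \<bullet> (sub21 L *v (C *v y)))"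
      unfolding s by (simp add: m)
    have 6: "y \<bullet> ((Y ** ?B1 + sub21 L ** ?D21) *v vjoin d1 d2)
        = y \<bullet> (Y *v (msqrt W *v d1)) + y \<bullet> (sub21 L *v (msqrt V *v d2))"
      by (simp add: m)
    have 7: "y \<bullet> (transpose (?C1 + ?D12 ** ?G ** C) *v vjoin z1 z2)
        = z1 \<bullet> (msqrt Q *v y) + z2 \<bullet> (msqrt R *v (?G *v (C *v y)))"
      unfolding inner_mult_transpose by (simp add: m) (simp add: inner_commute)
    have 8: "vjoin d1 d2 \<bullet> (transpose (?D12 ** ?G ** ?D21) *v vjoin z1 z2)
        = z2 \<bullet> (msqrt R *v (?G *v (msqrt V *v d2)))"
      unfolding inner_mult_transpose by (simp add: m) (simp add: inner_commute)
    show ?thesis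
      unfolding 1 2 3 4 5 6 7 8 convex_form_def mat_scalar_mult inner_scaleR_right
        power2_norm_eq_inner[symmetric]
      unfolding power2_norm_eq_inner inner_vjoin
      by (simp only: matrix_vector_right_distrib inner_add_right) (simp only: algebra_simps)
  qed
  have all: "(\<forall>x y z u. F x y z u) \<longleftrightarrow> (\<forall>x y d1 d2 z1 z2. F x y (vjoin d1 d2) (vjoin z1 z2))"
    for F :: "real^'n \<Rightarrow> real^'n \<Rightarrow> real^('n + 'p) \<Rightarrow> real^('n + 'm) \<Rightarrow> bool"
    by (metis vjoin_cases)
  show ?thesis
    unfolding Finf_d_def Let_def mem_Collect_eq prod.case neg_semidef_sym_block4 all q
    by (simp add: tr transpose_mat)
qed

lemma sub_linear:
  "sub11 (M + N) = sub11 M + sub11 N" "sub12 (M + N) = sub12 M + sub12 N"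
  "sub21 (M + N) = sub21 M + sub21 N" "sub22 (M + N) = sub22 M + sub22 N"
  "sub11 (c *\<^sub>R M) = c *\<^sub>R sub11 M" "sub12 (c *\<^sub>R M) = c *\<^sub>R sub12 M"
  "sub21 (c *\<^sub>R M) = c *\<^sub>R sub21 M" "sub22 (c *\<^sub>R M) = c *\<^sub>R sub22 M"
  by (simp_all add: sub11_def sub12_def sub21_def sub22_def vec_eq_iff)

lemma block2_linear:
  "block2 (M11 + N11) (M12 + N12) (M21 + N21) (M22 + N22) = block2 M11 M12 M21 M22 + block2 N11 N12 N21 N22"
  "block2 (c *\<^sub>R M11) (c *\<^sub>R M12) (c *\<^sub>R M21) (c *\<^sub>R M22) = c *\<^sub>R block2 M11 M12 M21 M22"
  by (simp_all add: vec_sum_eq_iff block2_def vcat_def hcat_def)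

lemma pos_def_add: "pos_def M \<Longrightarrow> pos_def N \<Longrightarrow> pos_def (M + N)"
  by (simp add: pos_def_def transpose_add matrix_vector_mult_add_rdistrib inner_add_right add_pos_pos)

lemma pos_def_scaleR: "pos_def M \<Longrightarrow> 0 < c \<Longrightarrow> pos_def (c *\<^sub>R M)"
  by (simp add: pos_def_def transpose_scaleR scaleR_matrix_mult)

lemma convex_form_affine:
  assumes "u + v = 1"
  shows "convex_form A B C Q R W V (u * g + v * g') (u *\<^sub>R L + v *\<^sub>R L') (u *\<^sub>R X + v *\<^sub>R X') (u *\<^sub>R Y + v *\<^sub>R Y') x y d1 d2 z1 z2
    = u * convex_form A B C Q R W V g L X Y x y d1 d2 z1 z2
    + v * convex_form A B C Q R W V g' L' X' Y' x y d1 d2 z1 z2"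
proof -
  have v: "v = 1 - u" using assms by simp
  show ?thesis
    unfolding convex_form_def v
    by (simp add: sub_linear matrix_vector_mult_add_rdistrib scaleR_matrix_mult matrix_vector_right_distrib
        matrix_mult_scaleR inner_add_right) (simp add: algebra_simps)
qed

theorem convex_Finf_d: "convex (Finf_d A B C Q R W V)"
proof (rule convexI)
  fix p q u v
  assume p: "p \<in> Finf_d A B C Q R W V" and q: "q \<in> Finf_d A B C Q R W V"
    and uv: "0 \<le> u" "0 \<le> v" "u + v = (1::real)"
  obtain g L X Y where p': "p = (g, L, X, Y)" by (cases p)
  obtain g' L' X' Y' where q': "q = (g', L', X', Y')" by (cases q)
  have F: "(g, L, X, Y) \<in> Finf_d A B C Q R W V" "(g', L', X', Y') \<in> Finf_d A B C Q R W V"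
    using p q by (simp_all add: p' q')
  consider "u = 0" "v = 1" | "u = 1" "v = 0" | "0 < u" "0 < v" using uv by fastforce
  then show "u *\<^sub>R p + v *\<^sub>R q \<in> Finf_d A B C Q R W V"
  proof cases
    case 3
    have "block2 (u *\<^sub>R X + v *\<^sub>R X') (mat 1) (mat 1) (u *\<^sub>R Y + v *\<^sub>R Y')
        = u *\<^sub>R block2 X (mat 1) (mat 1) Y + v *\<^sub>R block2 X' (mat 1) (mat 1) Y'"
      using uv(3) by (simp flip: block2_linear scaleR_left_distrib)
    then have "pos_def (block2 (u *\<^sub>R X + v *\<^sub>R X') (mat 1) (mat 1) (u *\<^sub>R Y + v *\<^sub>R Y'))"
      using F 3 by (simp add: Finf_d_iff pos_def_add pos_def_scaleR)
    moreover have "convex_form A B C Q R W V (u * g + v * g') (u *\<^sub>R L + v *\<^sub>R L') (u *\<^sub>R X + v *\<^sub>R X')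
        (u *\<^sub>R Y + v *\<^sub>R Y') x y d1 d2 z1 z2 \<le> 0" for x y d1 d2 z1 z2
      unfolding convex_form_affine[OF uv(3)]
      using F uv by (intro add_nonpos_nonpos mult_nonneg_nonpos) (auto simp: Finf_d_iff)
    ultimately show ?thesis
      using F by (simp add: p' q' Finf_d_iff transpose_add transpose_scaleR)
  qed (use p q in auto)
qed

text \<open>
  The relation between a policy \<open>K\<close> and the new variables \<open>(L, X, Y)\<close>. The storage matrix has
  upper blocks \<open>Y\<close> and \<open>N\<close>, and its inverse has left blocks \<open>X\<close> and \<open>U\<close>.
\<close>

definition coordinates where
  "coordinates A B C K L X Y U N \<longleftrightarrow>
     Y ** X + N ** U = mat 1 \<and>
     sub11 L = sub11 K \<and>
     sub12 L = sub11 K ** C ** X + sub12 K ** U \<and>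
     sub21 L = Y ** B ** sub11 K + N ** sub21 K \<and>
     sub22 L = Y ** (A + B ** sub11 K ** C) ** X + N ** sub21 K ** C ** X
       + Y ** B ** sub12 K ** U + N ** sub22 K ** U"

text \<open>The substitution \<open>(X x + y, U x)\<close> for the closed-loop state turns one form into the other.\<close>

lemma brl_form_coordinates:
  fixes A :: "real ^ 'n ^ 'n" and B :: "real ^ 'm ^ 'n" and C :: "real ^ 'n ^ 'p"
    and Q W :: "real ^ 'n ^ 'n" and R :: "real ^ 'm ^ 'm" and V :: "real ^ 'p ^ 'p"
  assumes co: "coordinates A B C K L X Y U N" and Y: "transpose Y = Y"
    and P: "P *v vjoin (X *v x + y) (U *v x) = vjoin (x + Y *v y) (transpose N *v y)"
  shows "brl_form (Acl A B C K) (Bcl B W V K) (Ccl C Q R K) (Dcl R V K) P g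
      (vjoin (X *v x + y) (U *v x)) (vjoin d1 d2) (vjoin z1 z2)
    = convex_form A B C Q R W V g L X Y x y d1 d2 z1 z2"
proof -
  let ?G = "sub11 K"
  note m = mult_vec_simps
  have L11: "sub11 L = ?G" using co by (simp add: coordinates_def)
  have L12: "sub12 L *v w = ?G *v (C *v (X *v w)) + sub12 K *v (U *v w)" for w
    using co by (simp add: coordinates_def m)
  have L21: "sub21 L *v w = Y *v (B *v (?G *v w)) + N *v (sub21 K *v w)" for w
    using co by (simp add: coordinates_def m)
  have L22: "sub22 L *v w = Y *v (A *v (X *v w)) + Y *v (B *v (?G *v (C *v (X *v w))))
      + N *v (sub21 K *v (C *v (X *v w))) + Y *v (B *v (sub12 K *v (U *v w))) + N *v (sub22 K *v (U *v w))" for w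
    using co by (simp add: coordinates_def m)
  have state: "vjoin p q \<bullet> vjoin (x + Y *v y) (transpose N *v y) = x \<bullet> p + y \<bullet> (Y *v p + N *v q)" for p q
    using inner_symmetric_swap[OF Y, of p y] inner_mult_transpose[of q N y]
    by (simp add: inner_vjoin inner_add_right inner_commute)
  have n1: "(norm (vjoin d1 d2))\<^sup>2 = (norm d1)\<^sup>2 + (norm d2)\<^sup>2" "(norm (vjoin z1 z2))\<^sup>2 = (norm z1)\<^sup>2 + (norm z2)\<^sup>2"
    unfolding power2_norm_eq_inner by (rule inner_vjoin)+
  show ?thesis
    unfolding brl_form_def convex_form_def P Acl_mult Bcl_mult Ccl_mult Dcl_mult vjoin_add
    unfolding state
    unfolding inner_vjoin L11 L12 L21 L22 n1
    by (simp add: m inner_add_right)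
qed

lemma pos_def_congruence:
  assumes S: "pos_def S" and J: "invertible (J :: real^'n^'n)"
  shows "pos_def (transpose J ** S ** J)"
  unfolding pos_def_def
proof (intro conjI allI impI)
  show "transpose (transpose J ** S ** J) = transpose J ** S ** J"
    using S by (simp add: pos_def_def matrix_transpose_mul matrix_mul_assoc)
  fix x :: "real^'n" assume "x \<noteq> 0"
  then have "J *v x \<noteq> 0" using J by (auto simp: invertible_iff_ker)
  then show "0 < x \<bullet> (transpose J ** S ** J *v x)"
    using S by (simp add: pos_def_def matrix_vector_mul_assoc[symmetric] inner_mult_transpose)
qed

text \<open>If \<open>N U v = 0\<close>, then \<open>Y X v = v\<close>, and the form of the coupling matrix vanishes at \<open>(v, - X v)\<close>.\<close>

lemma coupling_invertible:
  assumes pd: "pos_def (block2 X (mat 1) (mat 1) Y)" and NU: "Y ** X + N ** U = mat 1" and U: "invertible U"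
  shows "invertible (N :: real^'n^'n)"
  unfolding invertible_iff_ker
proof (intro allI impI)
  fix w assume w: "N *v w = 0"
  define v where "v = matrix_inv U *v w"
  have Uv: "U *v v = w" by (simp add: v_def matrix_vector_mul_assoc matrix_inv_inverse[OF U])
  have "Y *v (X *v v) + N *v (U *v v) = v"
    using arg_cong[OF NU, of "\<lambda>M. M *v v"]
    by (simp add: mult_vec_simps)
  then have v: "Y *v (X *v v) = v" using w Uv by simp
  have "vjoin v (- (X *v v)) \<bullet> (block2 X (mat 1) (mat 1) Y *v vjoin v (- (X *v v))) = 0"
    by (simp add: block2_mult_vjoin inner_vjoin matrix_mult_minus v)
  then have "vjoin v (- (X *v v)) = 0" using pd by (metis pos_def_def less_irrefl)
  then show "w = 0" using Uv by auto
qed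

text \<open>The storage matrix is \<open>T\<^sup>-\<^sup>T S T\<^sup>-\<^sup>1\<close>, where \<open>S\<close> has blocks \<open>X, I, I, Y\<close> and \<open>T\<close> is the substitution
  \<open>(x, y) \<mapsto> (X x + y, U x)\<close>.\<close>

lemma storage_matrix_exists:
  fixes X Y N U :: "real^'n^'n"
  assumes X: "transpose X = X" and Y: "transpose Y = Y" and pd: "pos_def (block2 X (mat 1) (mat 1) Y)"
    and NU: "Y ** X + N ** U = mat 1" and U: "invertible U"
  obtains P where "pos_def P" "invertible (sub12 P)"
    "\<And>x y. P *v vjoin (X *v x + y) (U *v x) = vjoin (x + Y *v y) (transpose N *v y)"
proof -
  define T where "T = block2 X (mat 1) U 0"
  define J where "J = matrix_inv T"
  define P where "P = transpose J ** block2 X (mat 1) (mat 1) Y ** J"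
  have Tmul: "T *v vjoin x y = vjoin (X *v x + y) (U *v x)" for x y
    by (simp add: T_def block2_mult_vjoin)
  have T: "invertible T"
    unfolding invertible_iff_ker
  proof (intro allI impI)
    fix z assume z: "T *v z = 0"
    obtain x y where xy: "z = vjoin x y" by (rule vjoin_cases)
    then have "U *v x = 0" "X *v x + y = 0" using z by (auto simp: Tmul)
    then show "z = 0" using U by (auto simp: xy invertible_iff_ker)
  qed
  note J = matrix_inv_inverse[OF T, folded J_def]
  have Jinv: "invertible J" using J unfolding invertible_def by blast
  have P: "P *v vjoin (X *v x + y) (U *v x) = vjoin (x + Y *v y) (transpose N *v y)" for x y
  proof -
    have NU': "X *v (Y *v y) + transpose U *v (transpose N *v y) = y"
      using arg_cong[OF arg_cong[OF NU, of transpose], of "\<lambda>M. M *v y"]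
      by (simp add: transpose_add matrix_transpose_mul X Y transpose_mat mult_vec_simps)
    have JT: "transpose J *v (transpose T *v w) = w" for w
      using J(1) by (metis matrix_transpose_mul transpose_mat matrix_vector_mul_assoc matrix_vector_mul_lid)
    have zero: "transpose (0 :: real^'n^'n) = 0" by (simp add: transpose_def vec_eq_iff)
    have tT: "transpose T *v vjoin (x + Y *v y) (transpose N *v y) = vjoin (X *v x + y) (x + Y *v y)"
      using NU' by (simp add: T_def transpose_block2 block2_mult_vjoin X transpose_mat zero
          matrix_vector_right_distrib add.assoc)
    have "P *v (T *v vjoin x y) = transpose J *v (block2 X (mat 1) (mat 1) Y *v vjoin x y)"
      unfolding P_def by (simp add: matrix_vector_mul_assoc matrix_mul_assoc[symmetric] J)
    also have "\<dots> = transpose J *v vjoin (X *v x + y) (x + Y *v y)" by (simp add: block2_mult_vjoin)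
    also have "\<dots> = vjoin (x + Y *v y) (transpose N *v y)" unfolding tT[symmetric] by (rule JT)
    finally show ?thesis by (simp add: Tmul)
  qed
  have pdP: "pos_def P" unfolding P_def by (rule pos_def_congruence[OF pd Jinv])
  have "sub21 P *v y = transpose N *v y" for y
  proof -
    have "P *v vjoin y 0 = vjoin (Y *v y) (transpose N *v y)" using P[of 0 y] by simp
    moreover have "P *v vjoin y 0 = vjoin (sub11 P *v y) (sub21 P *v y)"
      by (subst block2_sub[of P, symmetric]) (simp add: block2_mult_vjoin)
    ultimately show ?thesis by simp
  qed
  then have "sub21 P = transpose N" by (simp add: matrix_eq)
  moreover have "transpose P = P" using pdP by (simp add: pos_def_def)
  then have "sub12 P = transpose (sub21 P)" by (metis block2_sub block2_eq_iff transpose_block2)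
  ultimately have "sub12 P = N" by (simp add: transpose_transpose)
  then show thesis using that pdP P coupling_invertible[OF pd NU U] by simp
qed

theorem convex_point_to_policy:
  fixes A :: "real ^ 'n ^ 'n" and B :: "real ^ 'm ^ 'n" and C :: "real ^ 'n ^ 'p"
    and Q W :: "real ^ 'n ^ 'n" and R :: "real ^ 'm ^ 'm" and V :: "real ^ 'p ^ 'p"
  assumes R: "pos_def R" and V: "pos_def V"
    and ctr: "controllable A (msqrt W)" and obs: "observable (msqrt Q) A"
    and F: "(g, L, X, Y) \<in> Finf_d A B C Q R W V" and co: "coordinates A B C K L X Y U N" and U: "invertible U"
  shows "K \<in> stabilizing A B C" and "Jinf A B C Q R W V K \<le> g"
proof -
  have X: "transpose X = X" and Y: "transpose Y = Y" and pd: "pos_def (block2 X (mat 1) (mat 1) Y)"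
    and le: "\<And>x y d1 d2 z1 z2. convex_form A B C Q R W V g L X Y x y d1 d2 z1 z2 \<le> 0"
    using F unfolding Finf_d_iff by blast+
  have NU: "Y ** X + N ** U = mat 1" using co by (simp add: coordinates_def)
  obtain P where P: "pos_def P" "invertible (sub12 P)"
    "\<And>x y. P *v vjoin (X *v x + y) (U *v x) = vjoin (x + Y *v y) (transpose N *v y)"
    by (rule storage_matrix_exists[OF X Y pd NU U]) blast
  have "brl_form (Acl A B C K) (Bcl B W V K) (Ccl C Q R K) (Dcl R V K) P g s d z \<le> 0" for s d z
  proof -
    obtain s1 s2 where s: "s = vjoin s1 s2" by (rule vjoin_cases)
    obtain d1 d2 where d: "d = vjoin d1 d2" by (rule vjoin_cases)
    obtain z1 z2 where z: "z = vjoin z1 z2" by (rule vjoin_cases)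
    define x where "x = matrix_inv U *v s2"
    define y where "y = s1 - X *v x"
    have "s = vjoin (X *v x + y) (U *v x)"
      by (simp add: s y_def x_def matrix_vector_mul_assoc matrix_inv_inverse[OF U])
    then show ?thesis unfolding d z using brl_form_coordinates[OF co Y P(3)] le by metis
  qed
  then have L: "(K, g, P) \<in> Linf_d A B C Q R W V" using P by (simp add: Linf_d_iff)
  show st: "K \<in> stabilizing A B C" by (rule lifted_policy_stabilizing[OF R V ctr obs L])
  show "Jinf A B C Q R W V K \<le> g" by (rule lifted_policy_cost[OF L st])
qed

theorem lifted_policy_to_convex_point:
  fixes A :: "real ^ 'n ^ 'n" and B :: "real ^ 'm ^ 'n" and C :: "real ^ 'n ^ 'p"
    and Q W :: "real ^ 'n ^ 'n" and R :: "real ^ 'm ^ 'm" and V :: "real ^ 'p ^ 'p"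
  assumes L: "(K, g, P) \<in> Linf_d A B C Q R W V"
  obtains L X Y U N where "(g, L, X, Y) \<in> Finf_d A B C Q R W V" "coordinates A B C K L X Y U N" "invertible U"
proof -
  have P: "pos_def P" and P12: "invertible (sub12 P)"
    and le: "\<And>x d z. brl_form (Acl A B C K) (Bcl B W V K) (Ccl C Q R K) (Dcl R V K) P g x d z \<le> 0"
    using L unfolding Linf_d_iff by blast+
  have symP: "transpose P = P" using P by (simp add: pos_def_def)
  have "invertible P"
    unfolding invertible_iff_ker using P by (metis pos_def_def inner_zero_right less_irrefl)
  note inv = matrix_inv_inverse[OF this]
  define Y where "Y = sub11 P"
  define N where "N = sub12 P"
  define X where "X = sub11 (matrix_inv P)"
  define U where "U = sub21 (matrix_inv P)"
  define G where "G = sub11 K"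
  define L where "L = block2 G (G ** C ** X + sub12 K ** U) (Y ** B ** G + N ** sub21 K)
     (Y ** (A + B ** G ** C) ** X + N ** sub21 K ** C ** X + Y ** B ** sub12 K ** U + N ** sub22 K ** U)"
  have "transpose (matrix_inv P) = matrix_inv P"
  proof -
    have "transpose (matrix_inv P) ** P = mat 1"
      using arg_cong[OF inv(1), of transpose] by (simp add: matrix_transpose_mul symP transpose_mat)
    then have "transpose (matrix_inv P) ** P ** matrix_inv P = matrix_inv P" by simp
    then show ?thesis by (simp add: matrix_mul_assoc[symmetric] inv)
  qed
  then have X: "transpose X = X" unfolding X_def by (metis block2_sub block2_eq_iff transpose_block2)
  have Y: "transpose Y = Y" using symP unfolding Y_def by (metis block2_sub block2_eq_iff transpose_block2)
  have P21: "sub21 P = transpose N"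
    using symP unfolding N_def by (metis block2_sub block2_eq_iff transpose_block2)
  have Pb: "P *v vjoin x y = vjoin (Y *v x + N *v y) (transpose N *v x + sub22 P *v y)" for x y
    by (subst block2_sub[of P, symmetric]) (simp add: block2_mult_vjoin Y_def N_def P21)
  have iP: "matrix_inv P *v vjoin x 0 = vjoin (X *v x) (U *v x)" for x
    by (subst block2_sub[of "matrix_inv P", symmetric]) (simp add: block2_mult_vjoin X_def U_def)
  have PXU: "P *v vjoin (X *v x) (U *v x) = vjoin x 0" for x
    unfolding iP[symmetric] by (simp add: matrix_vector_mul_assoc inv)
  have Pact: "P *v vjoin (X *v x + y) (U *v x) = vjoin (x + Y *v y) (transpose N *v y)" for x y
  proof -
    have "P *v (vjoin (X *v x) (U *v x) + vjoin y 0) = vjoin x 0 + vjoin (Y *v y) (transpose N *v y)"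
      unfolding matrix_vector_right_distrib PXU by (simp add: Pb)
    then show ?thesis by (simp add: vjoin_add)
  qed
  have NU: "Y ** X + N ** U = mat 1"
  proof -
    have "(Y ** X + N ** U) *v x = mat 1 *v x" for x
      using PXU[of x] by (simp add: Pb mult_vec_simps)
    then show ?thesis by (simp add: matrix_eq)
  qed
  have co: "coordinates A B C K L X Y U N" unfolding coordinates_def L_def by (simp add: NU G_def)
  have tN: "transpose N *v y = 0 \<Longrightarrow> y = 0" for y
    using P12 invertible_transpose_real[of N] unfolding N_def[symmetric] invertible_iff_ker by blast
  have U: "invertible U"
    unfolding invertible_iff_ker
  proof (intro allI impI)
    fix x assume "U *v x = 0"
    then have "vjoin (x + Y *v (- (X *v x))) (transpose N *v (- (X *v x))) = 0"
      using Pact[of x "- (X *v x)"] by simp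
    then have "x + Y *v (- (X *v x)) = 0" "transpose N *v (- (X *v x)) = 0" by simp_all
    then show "x = 0" using tN[of "- (X *v x)"] by simp
  qed
  have pd: "pos_def (block2 X (mat 1) (mat 1) Y)"
    unfolding pos_def_def
  proof (intro conjI allI impI)
    show "transpose (block2 X (mat 1) (mat 1) Y) = block2 X (mat 1) (mat 1) Y"
      by (simp add: transpose_block2 transpose_mat X Y)
    fix z :: "real^('n + 'n)" assume z: "z \<noteq> 0"
    obtain x y where xy: "z = vjoin x y" by (rule vjoin_cases)
    define s where "s = vjoin (X *v x + y) (U *v x)"
    have "s \<noteq> 0" using z U by (auto simp: s_def xy invertible_iff_ker)
    then have "0 < s \<bullet> (P *v s)" using P by (simp add: pos_def_def)
    also have "s \<bullet> (P *v s) = z \<bullet> (block2 X (mat 1) (mat 1) Y *v z)"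
    proof -
      have 1: "(X *v x) \<bullet> (Y *v y) + (U *v x) \<bullet> (transpose N *v y) = y \<bullet> x"
      proof -
        have "(Y ** X + N ** U) *v x = x" by (simp add: NU)
        then have "y \<bullet> (Y *v (X *v x)) + y \<bullet> (N *v (U *v x)) = y \<bullet> x"
          by (metis inner_add_right matrix_vector_mult_add_rdistrib matrix_vector_mul_assoc)
        then show ?thesis
          using inner_symmetric_swap[OF Y, of "X *v x" y] inner_mult_transpose[of "U *v x" N y]
          by (simp add: inner_commute)
      qed
      have "s \<bullet> (P *v s) = (X *v x) \<bullet> x + y \<bullet> x + y \<bullet> (Y *v y)
          + ((X *v x) \<bullet> (Y *v y) + (U *v x) \<bullet> (transpose N *v y))"
        unfolding s_def Pact by (simp add: inner_vjoin inner_add_left inner_add_right)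
      then show ?thesis unfolding 1
        by (simp add: xy block2_mult_vjoin inner_vjoin inner_add_right inner_commute)
    qed
    finally show "0 < z \<bullet> (block2 X (mat 1) (mat 1) Y *v z)" .
  qed
  have "convex_form A B C Q R W V g L X Y x y d1 d2 z1 z2 \<le> 0" for x y d1 d2 z1 z2
    unfolding brl_form_coordinates[OF co Y Pact, symmetric] by (rule le)
  then have "(g, L, X, Y) \<in> Finf_d A B C Q R W V" using X Y pd by (simp add: Finf_d_iff)
  then show thesis using that co U by blast
qed

section \<open>Near-optimal certificates\<close>

text \<open>The determinant of \<open>M + t I\<close> is a nonzero polynomial in \<open>t\<close>, so it has no zeros for small \<open>t > 0\<close>
  except finitely many.\<close>

lemma invertible_shift:
  fixes M :: "real^'n^'n"
  assumes e: "0 < e"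
  obtains t where "0 < t" "t < e" "invertible (M + t *\<^sub>R mat 1)"
proof -
  define p where "p = det (\<chi> i j. [:M $ i $ j, if i = j then 1 else 0:])"
  have p: "poly p t = det (M + t *\<^sub>R mat 1)" for t
    unfolding p_def det_def
    by (simp add: poly_sum poly_prod mat_def if_distribR cong: if_cong)
  define m where "m = onorm (\<lambda>x. M *v x)"
  note m = matvec_bound[of M, folded m_def]
  have "x = 0" if "(M + (m + 1) *\<^sub>R mat 1) *v x = 0" for x
  proof -
    have "M *v x = - ((m + 1) *\<^sub>R x)"
      using that by (simp add: matrix_vector_mult_add_rdistrib scaleR_matrix_mult eq_neg_iff_add_eq_0)
    then have "norm (M *v x) = (m + 1) * norm x" using m(2) by simp
    then show ?thesis using m(1)[of x] by (simp add: distrib_right)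
  qed
  then have "invertible (M + (m + 1) *\<^sub>R mat 1)" by (simp add: invertible_iff_ker)
  then have "p \<noteq> 0" using p[of "m + 1"] by (auto simp: invertible_det_nz)
  then have "finite {t. poly p t = 0}" by (rule poly_roots_finite)
  moreover have "infinite {0<..<e}" using e by simp
  ultimately have "\<not> {0<..<e} \<subseteq> {t. poly p t = 0}" using finite_subset by blast
  then obtain t where "t \<in> {0<..<e}" "t \<notin> {t. poly p t = 0}" by blast
  then have t: "0 < t" "t < e" "poly p t \<noteq> 0" by simp_all
  then have "det (M + t *\<^sub>R mat 1) \<noteq> 0" by (simp flip: p)
  then have "invertible (M + t *\<^sub>R mat 1)" unfolding invertible_det_nz .
  then show thesis by (rule that[OF t(1,2)])
qed

text \<open>The strict certificate is shifted along the off-diagonal identity \<open>E\<close> to make its upper-right block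
  invertible, and scaled by \<open>1 / g\<close> to pass from the squared output to the inequality that is linear
  in \<open>C\<close> and \<open>D\<close>.\<close>

theorem policy_to_convex_point:
  fixes A :: "real ^ 'n ^ 'n" and B :: "real ^ 'm ^ 'n" and C :: "real ^ 'n ^ 'p"
    and Q W :: "real ^ 'n ^ 'n" and R :: "real ^ 'm ^ 'm" and V :: "real ^ 'p ^ 'p"
  assumes K: "K \<in> stabilizing A B C" and g: "Jinf A B C Q R W V K < g"
  obtains L X Y where "(g, L, X, Y) \<in> Finf_d A B C Q R W V"
proof -
  let ?A = "Acl A B C K" and ?B = "Bcl B W V K" and ?C = "Ccl C Q R K" and ?D = "Dcl R V K"
  have hur: "hurwitz ?A" using K by (simp add: stabilizing_def)
  obtain k where "resolvent_bound ?A k" using hurwitz_resolvent_bound[OF hur] by blast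
  then have "0 \<le> hinf_norm (transfer ?A ?B ?C ?D)" by (rule hinf_norm_bounds(1))
  then have g0: "0 < g" using g unfolding Jinf_transfer by linarith
  obtain P where symP: "transpose P = P" and neg: "\<And>x d. x \<noteq> 0 \<or> d \<noteq> 0 \<Longrightarrow>
      dissipation ?A ?B ?C ?D P g x d < 0"
    using bounded_real_lemma_strict[OF hur g[unfolded Jinf_transfer]] by blast
  define E :: "real^('n + 'n)^('n + 'n)" where "E = block2 0 (mat 1) (mat 1) 0"
  obtain e where e: "e > 0" and pert: "\<forall>t x d. 0 < t \<longrightarrow> t < e \<longrightarrow> x \<noteq> 0 \<or> d \<noteq> 0 \<longrightarrow>
      dissipation ?A ?B ?C ?D (P + t *\<^sub>R E) g x d < 0"
    using strict_brl_perturb[of ?A ?B P ?C ?D g E, OF neg] by blast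
  obtain t where t: "0 < t" "t < e" and inv: "invertible (sub12 P + t *\<^sub>R mat 1)"
    by (rule invertible_shift[OF e])
  define S where "S = P + t *\<^sub>R E"
  have strict: "dissipation ?A ?B ?C ?D S g x d < 0"
    if "x \<noteq> 0 \<or> d \<noteq> 0" for x d
    unfolding S_def using pert t that by blast
  have zero: "transpose (0 :: real^'n^'n) = 0" by (simp add: transpose_def vec_eq_iff)
  have symS: "transpose S = S"
    by (simp add: S_def E_def transpose_add transpose_scaleR symP transpose_block2 transpose_mat zero)
  have pdS: "pos_def S" by (rule strict_brl_pos_def[OF hur symS strict])
  have S12: "invertible (sub12 S)" using inv by (simp add: S_def E_def sub_linear)
  have "(K, g, (1 / g) *\<^sub>R S) \<in> Linf_d A B C Q R W V"
    unfolding Linf_d_iff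
  proof (intro conjI allI)
    show "pos_def ((1 / g) *\<^sub>R S)" using pdS g0 by (simp add: pos_def_scaleR)
    have "c *\<^sub>R M *v x = 0 \<Longrightarrow> c \<noteq> 0 \<Longrightarrow> M *v x = 0" for c and M :: "real^'n^'n" and x
      by (simp add: scaleR_matrix_mult)
    then show "invertible (sub12 ((1 / g) *\<^sub>R S))"
      using S12 g0 unfolding invertible_iff_ker sub_linear by (metis divide_eq_0_iff less_irrefl one_neq_zero)
    fix x d z
    define s where "s = ?C *v x + ?D *v d"
    have "2 * (z \<bullet> s) \<le> g * (norm z)\<^sup>2 + (norm s)\<^sup>2 / g"
    proof -
      have "0 \<le> (norm (g *\<^sub>R z - s))\<^sup>2 / g" using g0 by simp
      also have "\<dots> = g * (norm z)\<^sup>2 + (norm s)\<^sup>2 / g - 2 * (z \<bullet> s)"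
        unfolding power2_norm_eq_inner using g0
        by (simp add: inner_diff_left inner_diff_right inner_commute field_simps)
      finally show ?thesis by simp
    qed
    moreover have "brl_form ?A ?B ?C ?D ((1 / g) *\<^sub>R S) g x d z
        = (1 / g) * (2 * ((?A *v x + ?B *v d) \<bullet> (S *v x)) + (norm s)\<^sup>2 - g\<^sup>2 * (norm d)\<^sup>2)
        + (2 * (z \<bullet> s) - g * (norm z)\<^sup>2 - (norm s)\<^sup>2 / g)"
      using g0 unfolding brl_form_def s_def[symmetric] scaleR_matrix_mult inner_scaleR_right
      by (simp add: power2_eq_square[of g] field_simps)
    ultimately have "brl_form ?A ?B ?C ?D ((1 / g) *\<^sub>R S) g x d z
        \<le> (1 / g) * (2 * ((?A *v x + ?B *v d) \<bullet> (S *v x)) + (norm s)\<^sup>2 - g\<^sup>2 * (norm d)\<^sup>2)"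
      by linarith
    also have "\<dots> \<le> 0"
    proof -
      have "2 * ((?A *v x + ?B *v d) \<bullet> (S *v x)) + (norm s)\<^sup>2 - g\<^sup>2 * (norm d)\<^sup>2 \<le> 0"
        using strict[of x d] unfolding s_def by (cases "x = 0 \<and> d = 0") auto
      then show ?thesis using g0 by (intro mult_nonneg_nonpos) auto
    qed
    finally show "brl_form ?A ?B ?C ?D ((1 / g) *\<^sub>R S) g x d z \<le> 0" .
  qed
  then show thesis using lifted_policy_to_convex_point that by metis
qed

section \<open>Weakly convex functions and Clarke stationarity\<close>

text \<open>
  For a function that is Lipschitz and convex up to a quadratic error near \<open>x\<^sub>0\<close>, difference
  quotients at nearby points are controlled by a longer difference quotient at \<open>x\<^sub>0\<close>.
\<close>

lemma clarke_deriv_le_quotient: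
  fixes f :: "'a::real_normed_vector \<Rightarrow> real"
  assumes e: "0 < e" and M: "0 \<le> M"
    and lip: "\<And>x y. x \<in> ball x0 e \<Longrightarrow> y \<in> ball x0 e \<Longrightarrow> f x \<le> f y + M * norm (x - y)"
    and wc: "\<And>y v s t. y \<in> ball x0 e \<Longrightarrow> y + s *\<^sub>R v \<in> ball x0 e \<Longrightarrow> 0 < t \<Longrightarrow> t \<le> s \<Longrightarrow>
      f (y + t *\<^sub>R v) \<le> (1 - t / s) * f y + t / s * f (y + s *\<^sub>R v) + c * t * s * (norm v)\<^sup>2"
    and s: "0 < s" "s * norm v < e / 2"
  shows "clarke_deriv f x0 v \<le> ereal ((f (x0 + s *\<^sub>R v) - f x0) / s + c * s * (norm v)\<^sup>2)"
proof (rule ereal_le_epsilon2)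
  fix \<eta> :: real assume \<eta>: "0 < \<eta>"
  define d where "d = min (e / 2) (s * \<eta> / (2 * (M + 1)))"
  have d: "0 < d" using e s \<eta> M by (simp add: d_def)
  have Md: "2 * M * d \<le> s * \<eta>"
  proof -
    have "2 * M * d \<le> 2 * (M + 1) * d" using d by simp
    also have "\<dots> \<le> 2 * (M + 1) * (s * \<eta> / (2 * (M + 1)))"
      using M by (intro mult_left_mono) (auto simp: d_def)
    also have "\<dots> = s * \<eta>" using M by simp
    finally show ?thesis .
  qed
  let ?b = "(f (x0 + s *\<^sub>R v) - f x0) / s + c * s * (norm v)\<^sup>2 + \<eta>"
  have q: "(f (y + t *\<^sub>R v) - f y) / t \<le> ?b" if y: "y \<in> ball x0 d" and t: "0 < t" "t < s" for y t
  proof -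
    have yd: "norm (y - x0) < d" using y by (simp add: dist_norm norm_minus_commute)
    have de: "d \<le> e / 2" unfolding d_def by (rule min.cobounded1)
    have in1: "y \<in> ball x0 e" "x0 \<in> ball x0 e"
      using yd de e by (auto simp: dist_norm norm_minus_commute)
    have in2: "x0 + s *\<^sub>R v \<in> ball x0 e" using s e by (simp add: dist_norm)
    have "norm (y - x0 + s *\<^sub>R v) < e"
      using norm_triangle_ineq[of "y - x0" "s *\<^sub>R v"] yd de s by simp
    moreover have "y - x0 + s *\<^sub>R v = y + s *\<^sub>R v - x0" by simp
    ultimately have in3: "y + s *\<^sub>R v \<in> ball x0 e"
      by (metis dist_commute dist_norm mem_ball)
    have "f (y + t *\<^sub>R v) - f y \<le> t / s * (f (y + s *\<^sub>R v) - f y) + c * t * s * (norm v)\<^sup>2"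
      using wc[OF in1(1) in3 t(1)] t(2) by (simp add: left_diff_distrib right_diff_distrib diff_divide_distrib)
    also have "\<dots> = t * ((f (y + s *\<^sub>R v) - f y) / s + c * s * (norm v)\<^sup>2)" by (simp add: algebra_simps diff_divide_distrib)
    finally have "(f (y + t *\<^sub>R v) - f y) / t \<le> (f (y + s *\<^sub>R v) - f y) / s + c * s * (norm v)\<^sup>2"
      using t(1) by (simp add: pos_divide_le_eq mult.commute)
    also have "\<dots> \<le> ?b"
    proof -
      have "f (y + s *\<^sub>R v) \<le> f (x0 + s *\<^sub>R v) + M * d"
        using lip[OF in3 in2] yd M mult_left_mono[of "norm (y - x0)" d M] by simp
      moreover have "f x0 \<le> f y + M * d"
        using lip[OF in1(2,1)] yd M mult_left_mono[of "norm (y - x0)" d M]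
        by (simp add: norm_minus_commute)
      ultimately have "f (y + s *\<^sub>R v) - f y \<le> f (x0 + s *\<^sub>R v) - f x0 + s * \<eta>"
        using Md by linarith
      then have "(f (y + s *\<^sub>R v) - f y) / s \<le> (f (x0 + s *\<^sub>R v) - f x0 + s * \<eta>) / s"
        using s by (simp add: divide_right_mono)
      then show ?thesis using s by (simp add: add_divide_distrib)
    qed
    finally show ?thesis .
  qed
  have "eventually (\<lambda>y. y \<in> ball x0 d) (nhds x0)" using d by (intro eventually_nhds_in_open) auto
  moreover have "eventually (\<lambda>t. 0 < t \<and> t < s) (at_right (0::real))"
    using s(1) unfolding eventually_at_right_field by blast
  ultimately have "eventually (\<lambda>p. fst p \<in> ball x0 d \<and> 0 < snd p \<and> snd p < s) (nhds x0 \<times>\<^sub>F at_right 0)"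
    by (rule eventually_prodI)
  then have "eventually (\<lambda>p. (case p of (y, t) \<Rightarrow> ereal ((f (y + t *\<^sub>R v) - f y) / t)) \<le> ereal ?b)
      (nhds x0 \<times>\<^sub>F at_right 0)"
    by (rule eventually_mono) (use q in auto)
  then have "clarke_deriv f x0 v \<le> ereal ?b" unfolding clarke_deriv_def by (rule Limsup_bounded)
  then show "clarke_deriv f x0 v \<le> ereal ((f (x0 + s *\<^sub>R v) - f x0) / s + c * s * (norm v)\<^sup>2) + ereal \<eta>"
    by simp
qed

text \<open>Descent at a linear rate along a curve with a tangent at its start excludes stationarity.\<close>

lemma descent_curve_not_stationary:
  fixes f :: "'a::real_inner \<Rightarrow> real" and h :: "real \<Rightarrow> 'a"
  assumes e: "0 < e" and M: "0 \<le> M" and c: "0 \<le> c"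
    and lip: "\<And>x y. x \<in> ball (h 0) e \<Longrightarrow> y \<in> ball (h 0) e \<Longrightarrow> f x \<le> f y + M * norm (x - y)"
    and wc: "\<And>y v s t. y \<in> ball (h 0) e \<Longrightarrow> y + s *\<^sub>R v \<in> ball (h 0) e \<Longrightarrow> 0 < t \<Longrightarrow> t \<le> s \<Longrightarrow>
      f (y + t *\<^sub>R v) \<le> (1 - t / s) * f y + t / s * f (y + s *\<^sub>R v) + c * t * s * (norm v)\<^sup>2"
    and tangent: "((\<lambda>s. (h s - h 0) /\<^sub>R s) \<longlongrightarrow> v) (at_right 0)"
    and descent: "\<And>s. 0 < s \<Longrightarrow> s \<le> 1 \<Longrightarrow> f (h s) \<le> f (h 0) - \<delta> * s" and \<delta>: "0 < \<delta>"
  shows "0 \<notin> clarke_subdiff f (h 0)"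
proof
  assume "0 \<in> clarke_subdiff f (h 0)"
  then have stat: "0 \<le> clarke_deriv f (h 0) v" by (auto simp: clarke_subdiff_def zero_ereal_def dest: spec[of _ v])
  define \<eta> where "\<eta> = min 1 (\<delta> / (4 * (M + 1)))"
  have \<eta>: "0 < \<eta>" "\<eta> \<le> 1" using \<delta> M by (auto simp: \<eta>_def)
  have M\<eta>: "M * \<eta> \<le> \<delta> / 4"
  proof -
    have "M * \<eta> \<le> (M + 1) * (\<delta> / (4 * (M + 1)))" using M \<eta> by (intro mult_mono) (auto simp: \<eta>_def)
    also have "\<dots> = \<delta> / 4"
    proof -
      have "n * (\<delta> / (4 * n)) = \<delta> / 4" if "0 < n" for n using that by simp
      from this[of "M + 1"] show ?thesis using M by simp
    qed
    finally show ?thesis .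
  qed
  have "eventually (\<lambda>s. dist ((h s - h 0) /\<^sub>R s) v < \<eta>) (at_right 0)"
    using tangent \<eta> by (simp add: tendsto_iff)
  then obtain r where r: "0 < r" "\<And>s. 0 < s \<Longrightarrow> s < r \<Longrightarrow> dist ((h s - h 0) /\<^sub>R s) v < \<eta>"
    unfolding eventually_at_right_field by auto
  \<comment> \<open>\<open>s\<close> keeps both \<open>h s\<close> and \<open>h 0 + s v\<close> in the ball and the quadratic error below \<open>\<delta> / 4\<close>.\<close>
  define s where "s = min (min (r / 2) 1) (min (e / (4 * (norm v + 1))) (\<delta> / (4 * (c * (norm v)\<^sup>2 + 1))))"
  have pos: "0 < norm v + 1" "0 < c * (norm v)\<^sup>2 + 1" using c by (auto intro: add_nonneg_pos)
  have s: "0 < s" "s < r" "s \<le> 1" using r e \<delta> pos by (auto simp: s_def min_less_iff_disj)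
  have se: "s * (norm v + 1) \<le> e / 4"
  proof -
    have "s \<le> e / (4 * (norm v + 1))" by (simp add: s_def)
    then show ?thesis using pos(1) by (simp add: field_simps)
  qed
  have sc: "s * (c * (norm v)\<^sup>2 + 1) \<le> \<delta> / 4"
  proof -
    have "s \<le> \<delta> / (4 * (c * (norm v)\<^sup>2 + 1))" by (simp add: s_def)
    then show ?thesis using pos(2) by (simp add: field_simps)
  qed
  have sv: "s * norm v < e / 2"
  proof -
    have "s * norm v \<le> s * (norm v + 1)" using s by simp
    then show ?thesis using se e by linarith
  qed
  have hs: "norm (h s - h 0 - s *\<^sub>R v) \<le> s * \<eta>"
  proof -
    have "h s - h 0 - s *\<^sub>R v = s *\<^sub>R ((h s - h 0) /\<^sub>R s - v)" using s by (simp add: scaleR_diff_right)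
    then have "norm (h s - h 0 - s *\<^sub>R v) = s * dist ((h s - h 0) /\<^sub>R s) v"
      using s by (metis abs_of_pos dist_norm norm_scaleR)
    also have "\<dots> \<le> s * \<eta>" using r(2)[OF s(1,2)] s by (simp add: mult_left_mono)
    finally show ?thesis .
  qed
  have "norm (h s - h 0) \<le> norm (h s - h 0 - s *\<^sub>R v) + norm (s *\<^sub>R v)" by (metis diff_add_cancel norm_triangle_ineq)
  also have "\<dots> \<le> s * (norm v + 1)"
  proof -
    have "norm (h s - h 0 - s *\<^sub>R v) \<le> s * 1"
      using s \<eta> by (intro order_trans[OF hs] mult_left_mono) auto
    then show ?thesis using s by (simp add: distrib_left)
  qed
  also have "\<dots> < e" using se e by linarith
  finally have in1: "h s \<in> ball (h 0) e" by (simp add: dist_norm norm_minus_commute)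
  have in2: "h 0 + s *\<^sub>R v \<in> ball (h 0) e" using sv s e by (simp add: dist_norm)
  have "f (h 0 + s *\<^sub>R v) \<le> f (h s) + M * norm (h 0 + s *\<^sub>R v - h s)" by (rule lip[OF in2 in1])
  also have "norm (h 0 + s *\<^sub>R v - h s) = norm (h s - h 0 - s *\<^sub>R v)"
    by (subst norm_minus_commute) (simp add: algebra_simps)
  also have "f (h s) + M * \<dots> \<le> f (h 0) - \<delta> * s + M * (s * \<eta>)"
    using hs M descent[OF s(1,3)] by (intro add_mono mult_left_mono) auto
  also have "\<dots> \<le> f (h 0) - \<delta> * s + s * (\<delta> / 4)" using M\<eta> s mult_left_mono[of "M * \<eta>" "\<delta> / 4" s] by (simp add: algebra_simps)
  finally have "f (h 0 + s *\<^sub>R v) - f (h 0) \<le> s * (- (3 / 4) * \<delta>)" by (simp add: algebra_simps)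
  then have "(f (h 0 + s *\<^sub>R v) - f (h 0)) / s \<le> - (3 / 4) * \<delta>" using s by (simp add: pos_divide_le_eq mult.commute)
  moreover have "c * s * (norm v)\<^sup>2 \<le> \<delta> / 4" using sc s by (simp add: algebra_simps)
  ultimately have neg: "(f (h 0 + s *\<^sub>R v) - f (h 0)) / s + c * s * (norm v)\<^sup>2 < 0" using \<delta> by linarith
  have "clarke_deriv f (h 0) v \<le> ereal ((f (h 0 + s *\<^sub>R v) - f (h 0)) / s + c * s * (norm v)\<^sup>2)"
    by (rule clarke_deriv_le_quotient[OF e M lip wc s(1) sv])
  then show False using stat neg by (metis ereal_less_eq(3) linorder_not_less order_trans zero_ereal_def)
qed

section \<open>Weak convexity of the norm of an affine family of systems\<close>

lemma scaleR_cmatrix_mult: "(c *\<^sub>R M) *v x = c *\<^sub>R (M *v (x::complex^'n))"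
  by (simp add: vec_eq_iff matrix_vector_mult_def scaleR_sum_right)

lemma matrix_family_bound:
  fixes f :: "'k::euclidean_space \<Rightarrow> real^'i^'j"
  assumes f: "linear f"
  obtains m where "0 < m" "\<And>v x. norm (cmat (f v) *v x) \<le> m * norm v * norm x"
proof -
  have "bilinear (\<lambda>v x. cmat (f v) *v x)" unfolding bilinear_def
    by (intro conjI allI linearI)
       (simp_all add: linear_add[OF f] linear_scale[OF f] cmat_add cmat_scaleR
         matrix_vector_mult_add_rdistrib scaleR_cmatrix_mult matrix_vector_right_distrib
         linear_scale[OF matrix_vector_mul_linear])
  then have "bounded_bilinear (\<lambda>v x. cmat (f v) *v x)" by (simp add: bilinear_conv_bounded_bilinear)
  then obtain m where "0 < m" "\<And>v x. norm (cmat (f v) *v x) \<le> norm v * norm x * m"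
    using bounded_bilinear.pos_bounded by blast
  then show thesis using that[of m] by (simp add: mult_ac)
qed

text \<open>
  A system whose matrices depend affinely on a parameter, with linear parts \<open>a'\<close>, \<open>b'\<close>, \<open>c'\<close>, \<open>d'\<close>.
  Its \<open>cost\<close> is the \<open>H\<^sub>\<infinity>\<close> norm of the transfer function, and \<open>solves y w u x\<close> states that \<open>x\<close> is the
  state response to the input \<open>u\<close> at frequency \<open>w\<close>.
\<close>

locale affine_system =
  fixes a a' :: "'k::euclidean_space \<Rightarrow> real^'n^'n" and b b' :: "'k \<Rightarrow> real^'d^'n"
    and c c' :: "'k \<Rightarrow> real^'n^'z" and d d' :: "'k \<Rightarrow> real^'d^'z"
  assumes lin: "linear a'" "linear b'" "linear c'" "linear d'"
    and aff: "\<And>x v. a (x + v) = a x + a' v" "\<And>x v. b (x + v) = b x + b' v"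
      "\<And>x v. c (x + v) = c x + c' v" "\<And>x v. d (x + v) = d x + d' v"
begin

definition cost :: "'k \<Rightarrow> real" where
  "cost y = hinf_norm (transfer (a y) (b y) (c y) (d y))"

definition solves :: "'k \<Rightarrow> real \<Rightarrow> complex^'d \<Rightarrow> complex^'n \<Rightarrow> bool" where
  "solves y w u x \<longleftrightarrow> freq_pencil w (a y) *v x = cmat (b y) *v u"

lemma caff:
  "cmat (a (y + v)) *v x = cmat (a y) *v x + cmat (a' v) *v x"
  "cmat (c (y + v)) *v x = cmat (c y) *v x + cmat (c' v) *v x"
  "cmat (b (y + v)) *v u = cmat (b y) *v u + cmat (b' v) *v u"
  "cmat (d (y + v)) *v u = cmat (d y) *v u + cmat (d' v) *v u"
  by (simp_all add: aff cmat_add matrix_vector_mult_add_rdistrib)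

lemma clin:
  "cmat (a' (t *\<^sub>R v)) *v x = t *\<^sub>R (cmat (a' v) *v x)" "cmat (c' (t *\<^sub>R v)) *v x = t *\<^sub>R (cmat (c' v) *v x)"
  "cmat (b' (t *\<^sub>R v)) *v u = t *\<^sub>R (cmat (b' v) *v u)" "cmat (d' (t *\<^sub>R v)) *v u = t *\<^sub>R (cmat (d' v) *v u)"
  by (simp_all add: linear_scale[OF lin(1)] linear_scale[OF lin(2)] linear_scale[OF lin(3)]
      linear_scale[OF lin(4)] cmat_scaleR scaleR_cmatrix_mult)

lemma resolvent_shift:
  "(mat s - cmat (a (y + v))) *v x = (mat s - cmat (a y)) *v x - cmat (a' v) *v x"
  by (simp add: matrix_vector_mult_diff_rdistrib caff)

text \<open>One radius \<open>e\<close> and one constant \<open>m\<close> for all bounds near a parameter with bounded resolvent.\<close>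

lemma local_bounds:
  assumes rb: "resolvent_bound (a y0) k"
  obtains e m where "0 < e" "0 < m"
    "\<And>y. y \<in> ball y0 e \<Longrightarrow> resolvent_bound (a y) m"
    "\<And>y u. y \<in> ball y0 e \<Longrightarrow> norm (cmat (b y) *v u) \<le> m * norm u"
    "\<And>y x. y \<in> ball y0 e \<Longrightarrow> norm (cmat (c y) *v x) \<le> m * norm x"
    "\<And>v x. norm (cmat (a' v) *v x) \<le> m * norm v * norm x" "\<And>v u. norm (cmat (b' v) *v u) \<le> m * norm v * norm u"
    "\<And>v x. norm (cmat (c' v) *v x) \<le> m * norm v * norm x" "\<And>v u. norm (cmat (d' v) *v u) \<le> m * norm v * norm u"
proof -
  obtain m1 where m1: "0 < m1" "\<And>v x. norm (cmat (a' v) *v x) \<le> m1 * norm v * norm x"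
    by (rule matrix_family_bound[OF lin(1)]) blast
  obtain m2 where m2: "0 < m2" "\<And>v x. norm (cmat (b' v) *v x) \<le> m2 * norm v * norm x"
    by (rule matrix_family_bound[OF lin(2)]) blast
  obtain m3 where m3: "0 < m3" "\<And>v x. norm (cmat (c' v) *v x) \<le> m3 * norm v * norm x"
    by (rule matrix_family_bound[OF lin(3)]) blast
  obtain m4 where m4: "0 < m4" "\<And>v x. norm (cmat (d' v) *v x) \<le> m4 * norm v * norm x"
    by (rule matrix_family_bound[OF lin(4)]) blast
  define nb where "nb = onorm ((*v) (cmat (b y0)))"
  define nc where "nc = onorm ((*v) (cmat (c y0)))"
  have n0: "0 \<le> nb" "0 \<le> nc" by (simp_all add: nb_def nc_def matvec_bound)
  have k: "0 < k" using rb by (simp add: resolvent_bound_def)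
  define m where "m = m1 + m2 + m3 + m4 + nb + nc + 2 * k"
  define e where "e = min 1 (1 / (2 * k * m1))"
  have e: "0 < e" "e \<le> 1" using k m1 by (auto simp: e_def)
  have m: "0 < m" using m1 m2 m3 m4 n0 k by (simp add: m_def)
  have up: "q * norm v * norm x \<le> m * norm v * norm x" if "q \<le> m" for q and v :: 'k and x :: "complex^'i"
    using that by (intro mult_right_mono) auto
  have le: "m1 \<le> m" "m2 \<le> m" "m3 \<le> m" "m4 \<le> m" "nb + m2 \<le> m" "nc + m3 \<le> m" "2 * k \<le> m"
    using m1 m2 m3 m4 n0 k by (simp_all add: m_def)
  show thesis
  proof (rule that[OF e(1) m])
    fix y assume y: "y \<in> ball y0 e"
    define v where "v = y - y0"
    have yv: "y = y0 + v" by (simp add: v_def)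
    have nv: "norm v < e" using y by (simp add: v_def dist_norm norm_minus_commute)
    show "resolvent_bound (a y) m"
    proof -
      have "norm (cmat (a y - a y0) *v x) \<le> norm x / (2 * k)" for x
      proof -
        have "norm (cmat (a y - a y0) *v x) \<le> m1 * norm v * norm x" using m1(2)[of v x] by (simp add: yv aff)
        also have "\<dots> \<le> m1 * (1 / (2 * k * m1)) * norm x"
          using nv m1 by (intro mult_right_mono mult_left_mono) (auto simp: e_def)
        also have "\<dots> = norm x / (2 * k)" using m1 by simp
        finally show ?thesis .
      qed
      then have "resolvent_bound (a y) (2 * k)" by (rule resolvent_bound_perturb[OF rb])
      then show ?thesis
        using le(7) m unfolding resolvent_bound_def
        by (meson mult_right_mono norm_ge_zero order_trans)
    qed
    show "norm (cmat (b y) *v u) \<le> m * norm u" for u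
    proof -
      have "norm (cmat (b y) *v u) \<le> nb * norm u + m2 * norm v * norm u"
        unfolding yv caff nb_def by (rule order_trans[OF norm_triangle_ineq add_mono[OF matvec_bound(1) m2(2)]])
      also have "\<dots> \<le> nb * norm u + m2 * 1 * norm u"
        using nv e m2 by (intro add_left_mono mult_right_mono mult_left_mono) auto
      also have "\<dots> \<le> m * norm u" using le(5) mult_right_mono[of "nb + m2" m "norm u"] by (simp add: distrib_right)
      finally show ?thesis .
    qed
    show "norm (cmat (c y) *v x) \<le> m * norm x" for x
    proof -
      have "norm (cmat (c y) *v x) \<le> nc * norm x + m3 * norm v * norm x"
        unfolding yv caff nc_def by (rule order_trans[OF norm_triangle_ineq add_mono[OF matvec_bound(1) m3(2)]])
      also have "\<dots> \<le> nc * norm x + m3 * 1 * norm x"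
        using nv e m3 by (intro add_left_mono mult_right_mono mult_left_mono) auto
      also have "\<dots> \<le> m * norm x" using le(6) mult_right_mono[of "nc + m3" m "norm x"] by (simp add: distrib_right)
      finally show ?thesis .
    qed
  next
    show "norm (cmat (a' v) *v x) \<le> m * norm v * norm x" for v x by (rule order_trans[OF m1(2) up[OF le(1)]])
    show "norm (cmat (b' v) *v x) \<le> m * norm v * norm x" for v x by (rule order_trans[OF m2(2) up[OF le(2)]])
    show "norm (cmat (c' v) *v x) \<le> m * norm v * norm x" for v x by (rule order_trans[OF m3(2) up[OF le(3)]])
    show "norm (cmat (d' v) *v x) \<le> m * norm v * norm x" for v x by (rule order_trans[OF m4(2) up[OF le(4)]])
  qed
qed

text \<open>
  For fixed frequency and input, the response is affine in the parameter up to a second-order error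
  that is uniform in the frequency. Taking norms and the supremum leaves an upper convexity estimate.
\<close>

theorem cost_lipschitz_weakly_convex:
  assumes rb: "resolvent_bound (a y0) k"
  obtains e M q where "0 < e" "0 \<le> M" "0 \<le> q"
    "\<And>x y. x \<in> ball y0 e \<Longrightarrow> y \<in> ball y0 e \<Longrightarrow> cost x \<le> cost y + M * norm (x - y)"
    "\<And>y v s t. y \<in> ball y0 e \<Longrightarrow> y + s *\<^sub>R v \<in> ball y0 e \<Longrightarrow> 0 < t \<Longrightarrow> t \<le> s \<Longrightarrow>
      cost (y + t *\<^sub>R v) \<le> (1 - t / s) * cost y + t / s * cost (y + s *\<^sub>R v) + q * t * s * (norm v)\<^sup>2"
proof -
  obtain e m where e: "0 < e" and m: "0 < m"
    and rbl: "\<And>y. y \<in> ball y0 e \<Longrightarrow> resolvent_bound (a y) m"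
    and bl: "\<And>y u. y \<in> ball y0 e \<Longrightarrow> norm (cmat (b y) *v u) \<le> m * norm u"
    and cl: "\<And>y x. y \<in> ball y0 e \<Longrightarrow> norm (cmat (c y) *v x) \<le> m * norm x"
    and al': "\<And>v x. norm (cmat (a' v) *v x) \<le> m * norm v * norm x"
    and bl': "\<And>v u. norm (cmat (b' v) *v u) \<le> m * norm v * norm u"
    and cl': "\<And>v x. norm (cmat (c' v) *v x) \<le> m * norm v * norm x"
    and dl': "\<And>v u. norm (cmat (d' v) *v u) \<le> m * norm v * norm u"
    by (rule local_bounds[OF rb]) blast
  have inv: "norm x \<le> m * norm (freq_pencil w (a y) *v x)" if "y \<in> ball y0 e" for y w x
    by (rule resolvent_boundD[OF rbl[OF that]])
  have cost0: "0 \<le> cost y" if "y \<in> ball y0 e" for y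
    unfolding cost_def by (rule hinf_norm_bounds(1)[OF rbl[OF that]])
  have cost_ge: "norm (cmat (c y) *v x + cmat (d y) *v u) \<le> cost y * norm u"
    if "y \<in> ball y0 e" "solves y w u x" for y w u x
    unfolding cost_def using hinf_norm_bounds(2)[OF rbl[OF that(1)]] that(2) unfolding solves_def by blast
  have cost_le: "cost y \<le> g"
    if "y \<in> ball y0 e" "0 \<le> g" "\<And>w u x. solves y w u x \<Longrightarrow> norm (cmat (c y) *v x + cmat (d y) *v u) \<le> g * norm u" for y g
    unfolding cost_def using hinf_norm_le[OF rbl[OF that(1)] that(2)] that(3) unfolding solves_def by blast
  have solve: "\<exists>x. solves y w u x" if "y \<in> ball y0 e" for y w u
    unfolding solves_def using resolvent_solve[OF rbl[OF that]] by metis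
  define \<mu> where "\<mu> = m * m"
  define \<nu> where "\<nu> = m * (m * (1 + \<mu>))"
  have \<mu>: "0 \<le> \<mu>" and \<nu>: "0 \<le> \<nu>" using m by (auto simp: \<mu>_def \<nu>_def)
  have state: "norm x \<le> \<mu> * norm u" if "y \<in> ball y0 e" "solves y w u x" for y w u x
  proof -
    have "norm x \<le> m * norm (cmat (b y) *v u)" using inv[OF that(1), of x w] that(2) by (simp add: solves_def)
    also have "\<dots> \<le> m * (m * norm u)" using bl[OF that(1)] m by (simp add: mult_left_mono)
    finally show ?thesis by (simp add: \<mu>_def mult.assoc)
  qed
  have diff: "norm (x1 - x) \<le> \<nu> * norm v * norm u"
    if y: "y \<in> ball y0 e" and yv: "y + v \<in> ball y0 e" and x: "solves y w u x" and x1: "solves (y + v) w u x1" for y v w u x x1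
  proof -
    have "freq_pencil w (a (y + v)) *v (x1 - x) = cmat (b' v) *v u + cmat (a' v) *v x"
      using x x1 by (simp add: solves_def matrix_vector_mult_diff_distrib resolvent_shift[of _ y v x] caff)
    then have "norm (x1 - x) \<le> m * norm (cmat (b' v) *v u + cmat (a' v) *v x)"
      using inv[OF yv, of "x1 - x" w] by simp
    also have "\<dots> \<le> m * (m * norm v * norm u + m * norm v * norm x)"
      using m by (intro mult_left_mono order_trans[OF norm_triangle_ineq add_mono[OF bl' al']]) auto
    also have "\<dots> \<le> m * (m * norm v * norm u + m * norm v * (\<mu> * norm u))"
      using m by (intro mult_left_mono add_left_mono state[OF y x]) auto
    also have "\<dots> = \<nu> * norm v * norm u" by (simp add: \<nu>_def algebra_simps)
    finally show ?thesis .
  qed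
  define M where "M = m * \<nu> + m * (\<mu> + 1)"
  define q where "q = m * (m * (m * \<nu>)) + m * \<nu>"
  have M0: "0 \<le> M" and q0: "0 \<le> q" using m \<mu> \<nu> by (simp_all add: M_def q_def)
  show thesis
  proof (rule that[of e M q, OF e M0 q0])
    fix x y assume x: "x \<in> ball y0 e" and y: "y \<in> ball y0 e"
    define v where "v = x - y"
    have xv: "x = y + v" by (simp add: v_def)
    show "cost x \<le> cost y + M * norm (x - y)"
    proof (rule cost_le[OF x])
      show "0 \<le> cost y + M * norm (x - y)" using cost0[OF y] M0 by simp
      fix w u p1 assume p1: "solves x w u p1"
      obtain p where p: "solves y w u p" using solve[OF y] by blast
      have pd: "norm (p1 - p) \<le> \<nu> * norm v * norm u" using diff[of y v] x y p p1 by (simp add: xv)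
      have "cmat (c x) *v p1 + cmat (d x) *v u = (cmat (c y) *v p + cmat (d y) *v u)
          + (cmat (c x) *v (p1 - p) + (cmat (c' v) *v p + cmat (d' v) *v u))"
        by (simp add: xv caff matrix_vector_mult_diff_distrib)
      also have "norm \<dots> \<le> cost y * norm u + (m * (\<nu> * norm v * norm u)
          + (m * norm v * (\<mu> * norm u) + m * norm v * norm u))"
      proof -
        have 1: "norm (cmat (c x) *v (p1 - p)) \<le> m * (\<nu> * norm v * norm u)"
          using order_trans[OF cl[OF x] mult_left_mono[OF pd]] m by simp
        have 2: "norm (cmat (c' v) *v p) \<le> m * norm v * (\<mu> * norm u)"
          using order_trans[OF cl' mult_left_mono[OF state[OF y p]]] m by simp
        show ?thesis
          by (rule order_trans[OF norm_triangle_ineq add_mono[OF cost_ge[OF y p]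
                order_trans[OF norm_triangle_ineq add_mono[OF 1
                order_trans[OF norm_triangle_ineq add_mono[OF 2 dl']]]]]])
      qed
      also have "\<dots> = (cost y + M * norm (x - y)) * norm u" by (simp add: M_def v_def algebra_simps)
      finally show "norm (cmat (c x) *v p1 + cmat (d x) *v u) \<le> (cost y + M * norm (x - y)) * norm u" .
    qed
  next
    fix y v s t assume y: "y \<in> ball y0 e" and ys: "y + s *\<^sub>R v \<in> ball y0 e" and t: "0 < t" "t \<le> (s::real)"
    define \<theta> where "\<theta> = t / s"
    have \<theta>: "0 \<le> \<theta>" "\<theta> \<le> 1" and ts: "t = \<theta> * s" and s: "0 < s" using t by (auto simp: \<theta>_def)
    have yt: "y + t *\<^sub>R v \<in> ball y0 e"
    proof -
      have "y + t *\<^sub>R v = (1 - \<theta>) *\<^sub>R y + \<theta> *\<^sub>R (y + s *\<^sub>R v)" by (simp add: ts algebra_simps)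
      then show ?thesis using convexD_alt[OF convex_ball y ys \<theta>] by simp
    qed
    show "cost (y + t *\<^sub>R v) \<le> (1 - t / s) * cost y + t / s * cost (y + s *\<^sub>R v) + q * t * s * (norm v)\<^sup>2"
      unfolding \<theta>_def[symmetric]
    proof (rule cost_le[OF yt])
      show "0 \<le> (1 - \<theta>) * cost y + \<theta> * cost (y + s *\<^sub>R v) + q * t * s * (norm v)\<^sup>2"
        using cost0[OF y] cost0[OF ys] \<theta> q0 t s by simp
      fix w u xt assume xt: "solves (y + t *\<^sub>R v) w u xt"
      obtain x0 where x0: "solves y w u x0" using solve[OF y] by blast
      obtain xs where xs: "solves (y + s *\<^sub>R v) w u xs" using solve[OF ys] by blast
      define r where "r = xt - ((1 - \<theta>) *\<^sub>R x0 + \<theta> *\<^sub>R xs)"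
      define \<tau> where "\<tau> = t * (1 - \<theta>)"
      have \<tau>: "0 \<le> \<tau>" "\<tau> \<le> t" using t \<theta> by (auto simp: \<tau>_def mult_left_le)
      have dx: "norm (x0 - xs) \<le> \<nu> * (s * norm v) * norm u"
        using diff[OF y ys x0 xs] s by (simp add: norm_minus_commute)
      let ?R = "freq_pencil w (a (y + t *\<^sub>R v))"
      have Rt: "?R *v xt = cmat (b y) *v u + t *\<^sub>R (cmat (b' v) *v u)"
        using xt by (simp add: solves_def caff clin)
      have R0: "?R *v x0 = cmat (b y) *v u - t *\<^sub>R (cmat (a' v) *v x0)"
        using x0 by (simp add: solves_def resolvent_shift clin)
      have Rs: "?R *v xs = cmat (b y) *v u + s *\<^sub>R (cmat (b' v) *v u) + (s - t) *\<^sub>R (cmat (a' v) *v xs)"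
        using xs by (simp add: solves_def resolvent_shift caff clin algebra_simps)
      have Rr: "?R *v r = \<tau> *\<^sub>R (cmat (a' v) *v (x0 - xs))"
        unfolding r_def matrix_vector_mult_diff_distrib matrix_vector_right_distrib
          linear_scale[OF matrix_vector_mul_linear] Rt R0 Rs
        by (simp add: \<tau>_def ts algebra_simps)
      have nr: "norm r \<le> m * (t * (m * norm v * (\<nu> * (s * norm v) * norm u)))"
      proof -
        have "norm r \<le> m * norm (?R *v r)" by (rule inv[OF yt])
        also have "norm (?R *v r) \<le> t * (m * norm v * (\<nu> * (s * norm v) * norm u))"
          unfolding Rr norm_scaleR using \<tau> m
          by (intro mult_mono order_trans[OF al' mult_left_mono[OF dx]]) auto
        finally show ?thesis using m by (simp add: mult_left_mono)
      qed
      have out: "cmat (c (y + t *\<^sub>R v)) *v xt + cmat (d (y + t *\<^sub>R v)) *v u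
          = (1 - \<theta>) *\<^sub>R (cmat (c y) *v x0 + cmat (d y) *v u)
          + \<theta> *\<^sub>R (cmat (c (y + s *\<^sub>R v)) *v xs + cmat (d (y + s *\<^sub>R v)) *v u)
          + (cmat (c (y + t *\<^sub>R v)) *v r + \<tau> *\<^sub>R (cmat (c' v) *v (x0 - xs)))"
        unfolding r_def matrix_vector_mult_diff_distrib matrix_vector_right_distrib
          linear_scale[OF matrix_vector_mul_linear] caff clin
        by (simp add: \<tau>_def ts algebra_simps)
      have "norm (cmat (c (y + t *\<^sub>R v)) *v xt + cmat (d (y + t *\<^sub>R v)) *v u)
          \<le> ((1 - \<theta>) * (cost y * norm u) + \<theta> * (cost (y + s *\<^sub>R v) * norm u))
          + (m * (m * (t * (m * norm v * (\<nu> * (s * norm v) * norm u))))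
             + t * (m * norm v * (\<nu> * (s * norm v) * norm u)))"
        unfolding out
      proof (intro order_trans[OF norm_triangle_ineq] add_mono)
        show "norm ((1 - \<theta>) *\<^sub>R (cmat (c y) *v x0 + cmat (d y) *v u)) \<le> (1 - \<theta>) * (cost y * norm u)"
          using cost_ge[OF y x0] \<theta> by (simp add: mult_left_mono)
        show "norm (\<theta> *\<^sub>R (cmat (c (y + s *\<^sub>R v)) *v xs + cmat (d (y + s *\<^sub>R v)) *v u)) \<le> \<theta> * (cost (y + s *\<^sub>R v) * norm u)"
          using cost_ge[OF ys xs] \<theta> by (simp add: mult_left_mono)
        show "norm (cmat (c (y + t *\<^sub>R v)) *v r) \<le> m * (m * (t * (m * norm v * (\<nu> * (s * norm v) * norm u))))"
          using order_trans[OF cl[OF yt] mult_left_mono[OF nr]] m by simp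
        show "norm (\<tau> *\<^sub>R (cmat (c' v) *v (x0 - xs))) \<le> t * (m * norm v * (\<nu> * (s * norm v) * norm u))"
          unfolding norm_scaleR using \<tau> m
          by (intro mult_mono order_trans[OF cl' mult_left_mono[OF dx]]) auto
      qed
      also have "\<dots> = ((1 - \<theta>) * cost y + \<theta> * cost (y + s *\<^sub>R v) + q * t * s * (norm v)\<^sup>2) * norm u"
        by (simp add: q_def power2_eq_square algebra_simps)
      finally show "norm (cmat (c (y + t *\<^sub>R v)) *v xt + cmat (d (y + t *\<^sub>R v)) *v u)
        \<le> ((1 - \<theta>) * cost y + \<theta> * cost (y + s *\<^sub>R v) + q * t * s * (norm v)\<^sup>2) * norm u" .
    qed
  qed
qed

end

section \<open>Recovering policies along a segment of the convex problem\<close>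

text \<open>Existence of a one-sided derivative at \<open>0\<close>; its value is never needed.\<close>

definition right_differentiable :: "(real \<Rightarrow> 'a::real_normed_vector) \<Rightarrow> bool" where
  "right_differentiable f \<longleftrightarrow> (\<exists>v. ((\<lambda>s. (f s - f 0) /\<^sub>R s) \<longlongrightarrow> v) (at_right 0))"

lemma right_differentiable_const: "right_differentiable (\<lambda>s. c)"
  by (auto simp: right_differentiable_def)

lemma right_differentiable_ident: "right_differentiable (\<lambda>s. s)"
  unfolding right_differentiable_def
proof (intro exI)
  have "eventually (\<lambda>s. (s - 0) /\<^sub>R s = 1) (at_right (0::real))"
    by (simp add: eventually_at_right_field exI[of _ 1])
  then show "((\<lambda>s. (s - 0) /\<^sub>R s) \<longlongrightarrow> 1) (at_right (0::real))" by (simp add: tendsto_eventually)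
qed

lemma right_differentiable_add:
  assumes "right_differentiable f" and "right_differentiable g"
  shows "right_differentiable (\<lambda>s. f s + g s)"
proof -
  obtain u v where "((\<lambda>s. (f s - f 0) /\<^sub>R s) \<longlongrightarrow> u) (at_right 0)" "((\<lambda>s. (g s - g 0) /\<^sub>R s) \<longlongrightarrow> v) (at_right 0)"
    using assms unfolding right_differentiable_def by blast
  from tendsto_add[OF this] show ?thesis unfolding right_differentiable_def
    by (intro exI[of _ "u + v"]) (simp add: algebra_simps)
qed

lemma right_differentiable_linear:
  assumes L: "bounded_linear L" and f: "right_differentiable f"
  shows "right_differentiable (\<lambda>s. L (f s))"
proof -
  obtain v where "((\<lambda>s. (f s - f 0) /\<^sub>R s) \<longlongrightarrow> v) (at_right 0)"
    using f unfolding right_differentiable_def by blast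
  from bounded_linear.tendsto[OF L this] show ?thesis unfolding right_differentiable_def
    by (intro exI[of _ "L v"]) (simp add: bounded_linear.linear[OF L] linear_diff linear_scale)
qed

lemma right_differentiable_tendsto:
  assumes "right_differentiable f" shows "(f \<longlongrightarrow> f 0) (at_right 0)"
proof -
  obtain v where v: "((\<lambda>s. (f s - f 0) /\<^sub>R s) \<longlongrightarrow> v) (at_right 0)"
    using assms unfolding right_differentiable_def by blast
  have "((\<lambda>s. f 0 + s *\<^sub>R ((f s - f 0) /\<^sub>R s)) \<longlongrightarrow> f 0 + 0 *\<^sub>R v) (at_right 0)"
    by (intro tendsto_intros v)
  moreover have "eventually (\<lambda>s. f 0 + s *\<^sub>R ((f s - f 0) /\<^sub>R s) = f s) (at_right 0)"
    by (simp add: eventually_at_right_field exI[of _ 1])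
  ultimately show ?thesis by (simp add: tendsto_cong)
qed

lemma right_differentiable_bilinear:
  assumes b: "bounded_bilinear b" and f: "right_differentiable f" and g: "right_differentiable g"
  shows "right_differentiable (\<lambda>s. b (f s) (g s))"
proof -
  interpret bounded_bilinear b by (rule b)
  obtain u where u: "((\<lambda>s. (f s - f 0) /\<^sub>R s) \<longlongrightarrow> u) (at_right 0)"
    using f unfolding right_differentiable_def by blast
  obtain v where v: "((\<lambda>s. (g s - g 0) /\<^sub>R s) \<longlongrightarrow> v) (at_right 0)"
    using g unfolding right_differentiable_def by blast
  have "((\<lambda>s. b ((f s - f 0) /\<^sub>R s) (g s) + b (f 0) ((g s - g 0) /\<^sub>R s)) \<longlongrightarrow> b u (g 0) + b (f 0) v) (at_right 0)"
    by (intro tendsto_intros tendsto u v right_differentiable_tendsto[OF g])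
  moreover have "b ((f s - f 0) /\<^sub>R s) (g s) + b (f 0) ((g s - g 0) /\<^sub>R s) = (b (f s) (g s) - b (f 0) (g 0)) /\<^sub>R s" for s
    by (simp add: diff_left diff_right scaleR_left scaleR_right scaleR_diff_right)
  ultimately show ?thesis unfolding right_differentiable_def by auto
qed

lemma bounded_bilinear_matrix_mult: "bounded_bilinear (\<lambda>(M :: real^'b^'a) (N :: real^'c^'b). M ** N)"
proof -
  have "bilinear (\<lambda>(M :: real^'b^'a) (N :: real^'c^'b). M ** N)" unfolding bilinear_def
    by (intro conjI allI linearI)
       (simp_all add: matrix_eq mult_vec_simps scaleR_matrix_mult matrix_mult_scaleR)
  then show ?thesis by (simp add: bilinear_conv_bounded_bilinear)
qed

lemmas right_differentiable_mult = right_differentiable_bilinear[OF bounded_bilinear_matrix_mult]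

lemma right_differentiable_minus: "right_differentiable f \<Longrightarrow> right_differentiable (\<lambda>s. - f s)"
  by (rule right_differentiable_linear[OF bounded_linear_minus[OF bounded_linear_ident]])

lemma right_differentiable_diff:
  "right_differentiable f \<Longrightarrow> right_differentiable g \<Longrightarrow> right_differentiable (\<lambda>s. f s - g s)"
  using right_differentiable_add[of f "\<lambda>s. - g s"] right_differentiable_minus[of g] by simp

lemma right_differentiable_segment: "right_differentiable (\<lambda>s. (1 - s) *\<^sub>R x + s *\<^sub>R y)"
  by (intro right_differentiable_add right_differentiable_diff right_differentiable_const right_differentiable_ident
      right_differentiable_bilinear[OF bounded_bilinear_scaleR])

text \<open>With \<open>J = D\<^sup>-\<^sup>1\<close>, this rests on \<open>J s - J 0 = - J s (D s - D 0) J 0\<close>, which also shows that \<open>J\<close> is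
  continuous at \<open>0\<close>.\<close>

lemma right_differentiable_matrix_inv:
  fixes D :: "real \<Rightarrow> real^'n^'n"
  assumes D: "right_differentiable D" and inv: "\<And>s. 0 \<le> s \<Longrightarrow> s \<le> 1 \<Longrightarrow> invertible (D s)"
  shows "right_differentiable (\<lambda>s. matrix_inv (D s))"
proof -
  interpret bounded_bilinear "\<lambda>(M :: real^'n^'n) (N :: real^'n^'n). M ** N"
    by (rule bounded_bilinear_matrix_mult)
  define J where "J s = matrix_inv (D s)" for s
  obtain m where m: "0 < m" and mb: "\<And>(M :: real^'n^'n) (N :: real^'n^'n). norm (M ** N) \<le> norm M * norm N * m"
    using pos_bounded by blast
  have diff: "J s - J 0 = - (J s ** (D s - D 0) ** J 0)" if "0 \<le> s" "s \<le> 1" for s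
  proof -
    have "J s ** (D s - D 0) ** J 0 = (J s ** D s) ** J 0 - J s ** (D 0 ** J 0)"
      by (simp add: diff_left diff_right matrix_mul_assoc)
    also have "\<dots> = J 0 - J s" using inv[OF that] inv[of 0] by (simp add: J_def matrix_inv_inverse)
    finally show ?thesis by simp
  qed
  have J: "(J \<longlongrightarrow> J 0) (at_right 0)"
  proof -
    define n where "n = norm (J 0)"
    define E where "E s = norm (D s - D 0)" for s
    have E: "(E \<longlongrightarrow> 0) (at_right 0)"
      unfolding E_def using right_differentiable_tendsto[OF D] by (simp add: LIM_zero tendsto_norm_zero)
    \<comment> \<open>Once \<open>D s\<close> is this close to \<open>D 0\<close>, half of \<open>norm (J s - J 0)\<close> can be absorbed.\<close>
    have "eventually (\<lambda>s. E s < 1 / (2 * m * m * (n + 1))) (at_right 0)"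
      using E m by (intro order_tendstoD(2)[OF E]) (simp add: n_def add_nonneg_pos)
    moreover have "eventually (\<lambda>s. 0 < s \<and> s < 1) (at_right (0::real))"
      by (auto simp: eventually_at_right_field intro!: exI[of _ 1])
    ultimately have "eventually (\<lambda>s. norm (J s - J 0) \<le> 2 * m * m * n * n * E s) (at_right 0)"
    proof eventually_elim
      case (elim s)
      define r where "r = norm (J s - J 0)"
      have E0: "0 \<le> E s" and n0: "0 \<le> n" and r0: "0 \<le> r" by (simp_all add: E_def n_def r_def)
      have "norm (J s) \<le> r + n" using norm_triangle_ineq[of "J s - J 0" "J 0"] by (simp add: r_def n_def)
      then have "norm (J s ** (D s - D 0)) \<le> (r + n) * E s * m"
        using m E0 by (intro order_trans[OF mb]) (simp add: E_def mult_right_mono)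
      then have "r \<le> (r + n) * E s * m * n * m"
        using diff[of s] elim m unfolding r_def n_def
        by (simp add: order_trans[OF mb] mult_right_mono)
      moreover have "E s * m * n * m \<le> 1 / 2"
      proof -
        have "E s * (2 * m * m * (n + 1)) \<le> 1"
          using elim(1) m n0 by (simp add: pos_less_divide_eq add_nonneg_pos less_imp_le)
        moreover have "E s * (2 * m * m * n) \<le> E s * (2 * m * m * (n + 1))"
          using E0 m by (intro mult_left_mono) auto
        ultimately show ?thesis by (simp add: algebra_simps)
      qed
      then have "r * (E s * m * n * m) \<le> r * (1 / 2)" using r0 by (rule mult_left_mono)
      ultimately show ?case unfolding r_def[symmetric] by (simp add: algebra_simps)
    qed
    moreover have "((\<lambda>s. 2 * m * m * n * n * E s) \<longlongrightarrow> 0) (at_right 0)"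
      using tendsto_mult_right_zero[OF E] .
    ultimately have "((\<lambda>s. J s - J 0) \<longlongrightarrow> 0) (at_right 0)" by (rule Lim_null_comparison)
    then show ?thesis by (simp add: LIM_zero_iff)
  qed
  obtain v where v: "((\<lambda>s. (D s - D 0) /\<^sub>R s) \<longlongrightarrow> v) (at_right 0)"
    using D unfolding right_differentiable_def by blast
  have "((\<lambda>s. - (J s ** ((D s - D 0) /\<^sub>R s) ** J 0)) \<longlongrightarrow> - (J 0 ** v ** J 0)) (at_right 0)"
    by (intro tendsto_intros tendsto J v)
  moreover have "eventually (\<lambda>s. - (J s ** ((D s - D 0) /\<^sub>R s) ** J 0) = (J s - J 0) /\<^sub>R s) (at_right 0)"
  proof -
    have "eventually (\<lambda>s. 0 < s \<and> s < 1) (at_right (0::real))"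
      by (auto simp: eventually_at_right_field intro!: exI[of _ 1])
    then show ?thesis
      by eventually_elim (simp add: diff scaleR_left scaleR_right)
  qed
  ultimately show ?thesis unfolding right_differentiable_def J_def[symmetric] by (auto simp: tendsto_cong)
qed

text \<open>Solving the change of variables for the policy; \<open>Ui\<close> and \<open>Ni\<close> stand for the inverses of \<open>U\<close> and \<open>N\<close>.\<close>

definition policy_of where
  "policy_of A B C L X Y Ui Ni = block2 (sub11 L) ((sub12 L - sub11 L ** C ** X) ** Ui)
     (Ni ** (sub21 L - Y ** B ** sub11 L))
     (Ni ** (sub22 L - Y ** A ** X - sub21 L ** C ** X - Y ** B ** sub12 L + Y ** B ** sub11 L ** C ** X) ** Ui)"

lemma coordinates_policy_of:
  fixes A X Y U N Ui Ni :: "real^'n^'n"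
  assumes NU: "Y ** X + N ** U = mat 1" and N: "N ** Ni = mat 1" and U: "Ui ** U = mat 1"
  shows "coordinates A B C (policy_of A B C L X Y Ui Ni) L X Y U N"
proof -
  have *: "N *v (Ni *v x) = x" "Ui *v (U *v x) = x" for x
    by (simp_all add: matrix_vector_mul_assoc N U)
  show ?thesis
    unfolding coordinates_def policy_of_def sub_block2
    by (simp add: NU) (simp add: matrix_eq mult_vec_simps *)
qed

lemma policy_of_coordinates:
  fixes A X Y U N Ui Ni :: "real^'n^'n"
  assumes co: "coordinates A B C K L X Y U N" and N: "Ni ** N = mat 1" and U: "U ** Ui = mat 1"
  shows "policy_of A B C L X Y Ui Ni = K"
proof -
  have *: "Ni *v (N *v x) = x" "U *v (Ui *v x) = x" for x
    by (simp_all add: matrix_vector_mul_assoc N U)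
  have "policy_of A B C L X Y Ui Ni = block2 (sub11 K) (sub12 K) (sub21 K) (sub22 K)"
    using co unfolding policy_of_def block2_eq_iff coordinates_def
    by (simp add: matrix_eq mult_vec_simps *)
  then show ?thesis by (simp add: block2_sub)
qed

text \<open>The case \<open>U = I\<close>, \<open>N = I - Y X\<close> of the coupling.\<close>

lemma convex_point_gap_invertible:
  fixes X Y :: "real^'n^'n"
  assumes "(g, L, X, Y) \<in> Finf_d A B C Q R W V" shows "invertible (mat 1 - Y ** X)"
  by (rule coupling_invertible[where U = "mat 1" and X = X and Y = Y])
     (use assms in \<open>auto simp: Finf_d_iff invertible_def intro!: exI[of _ "mat 1"]\<close>)

section \<open>Global optimality of stationary policies\<close>

lemma matrix_eq_vjoin: "M = N \<longleftrightarrow> (\<forall>x y. M *v vjoin x y = N *v vjoin x (y :: real^'b::finite))"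
  by (metis matrix_eq vjoin_cases)

lemma closed_loop_affine:
  fixes A :: "real ^ 'n ^ 'n" and B :: "real ^ 'm ^ 'n" and C :: "real ^ 'n ^ 'p"
    and Q W :: "real ^ 'n ^ 'n" and R :: "real ^ 'm ^ 'm" and V :: "real ^ 'p ^ 'p"
  shows "affine_system (Acl A B C) (Acl 0 B C) (Bcl B W V) (\<lambda>v. Bcl B W V v - Bcl B W V 0)
    (Ccl C Q R) (\<lambda>v. Ccl C Q R v - Ccl C Q R 0) (Dcl R V) (Dcl R V)"
proof -
  have z: "sub11 0 = 0" "sub12 0 = 0" "sub21 0 = 0" "sub22 0 = 0"
    by (simp_all add: sub11_def sub12_def sub21_def sub22_def vec_eq_iff)
  note m = mult_vec_simps Acl_mult Bcl_mult Ccl_mult Dcl_mult vjoin_add vjoin_diff vjoin_scaleR sub_linear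
    scaleR_matrix_mult matrix_mult_scaleR scaleR_add_right z
  have a: "Acl A B C (x + v) = Acl A B C x + Acl 0 B C v" "Acl 0 B C (c *\<^sub>R v) = c *\<^sub>R Acl 0 B C v" for A x v c
    unfolding matrix_eq_vjoin by (simp_all add: m)
  have b: "Bcl B W V (x + v) = Bcl B W V x + (Bcl B W V v - Bcl B W V 0)"
    "Bcl B W V (c *\<^sub>R v) - Bcl B W V 0 = c *\<^sub>R (Bcl B W V v - Bcl B W V 0)" for x v c
    unfolding matrix_eq_vjoin by (simp_all add: m)
  have c: "Ccl C Q R (x + v) = Ccl C Q R x + (Ccl C Q R v - Ccl C Q R 0)"
    "Ccl C Q R (c *\<^sub>R v) - Ccl C Q R 0 = c *\<^sub>R (Ccl C Q R v - Ccl C Q R 0)" for x v c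
    unfolding matrix_eq_vjoin by (simp_all add: m)
  have d: "Dcl R V (x + v) = Dcl R V x + Dcl R V v" "Dcl R V (c *\<^sub>R v) = c *\<^sub>R Dcl R V v"
    for x v :: "('n, 'm, 'p) policy" and c
    unfolding matrix_eq_vjoin by (simp_all add: m)
  have lin: "linear (Acl 0 B C)" "linear (\<lambda>v. Bcl B W V v - Bcl B W V 0)"
      "linear (\<lambda>v. Ccl C Q R v - Ccl C Q R 0)"
    by (intro linearI; simp only: a b c; simp)+
  have "linear (Dcl R V :: ('n, 'm, 'p) policy \<Rightarrow> _)" by (intro linearI d)
  then show ?thesis using lin by (intro affine_system.intro a(1) b(1) c(1) d(1))
qed

text \<open>Along the segment from the convex point of \<open>K\<close> to a better one, \<open>U\<close> is kept fixed and
  \<open>N = (I - Y X) U\<^sup>-\<^sup>1\<close> moves, so that the recovered curve of policies starts at \<open>K\<close> itself.\<close>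

lemma nondegenerate_stationary_optimal:
  fixes A :: "real ^ 'n ^ 'n" and B :: "real ^ 'm ^ 'n" and C :: "real ^ 'n ^ 'p"
    and Q W :: "real ^ 'n ^ 'n" and R :: "real ^ 'm ^ 'm" and V :: "real ^ 'p ^ 'p"
  assumes R: "pos_def R" and V: "pos_def V"
    and ctr: "controllable A (msqrt W)" and obs: "observable (msqrt Q) A"
    and K: "nondegenerate A B C Q R W V K" and K': "K' \<in> stabilizing A B C"
    and lt: "Jinf A B C Q R W V K' < Jinf A B C Q R W V K"
  shows "0 \<notin> clarke_subdiff (Jinf A B C Q R W V) K"
proof -
  let ?J = "Jinf A B C Q R W V" and ?F = "Finf_d A B C Q R W V"
  obtain P where "(K, ?J K, P) \<in> Linf_d A B C Q R W V" using K unfolding nondegenerate_def by blast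
  then obtain L0 X0 Y0 U N where F0: "(?J K, L0, X0, Y0) \<in> ?F"
    and co: "coordinates A B C K L0 X0 Y0 U N" and U: "invertible U"
    by (rule lifted_policy_to_convex_point)
  define g where "g = (?J K' + ?J K) / 2"
  have g: "?J K' < g" "g < ?J K" using lt by (simp_all add: g_def)
  obtain L1 X1 Y1 where F1: "(g, L1, X1, Y1) \<in> ?F" by (rule policy_to_convex_point[OF K' g(1)])
  define L where "L t = (1 - t) *\<^sub>R L0 + t *\<^sub>R L1" for t
  define X where "X t = (1 - t) *\<^sub>R X0 + t *\<^sub>R X1" for t
  define Y where "Y t = (1 - t) *\<^sub>R Y0 + t *\<^sub>R Y1" for t
  define D where "D t = mat 1 - Y t ** X t" for t
  define Ui where "Ui = matrix_inv U"
  define h where "h t = policy_of A B C (L t) (X t) (Y t) Ui (U ** matrix_inv (D t))" for t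
  note Uinv = matrix_inv_inverse[OF U, folded Ui_def]
  have seg: "((1 - t) * ?J K + t * g, L t, X t, Y t) \<in> ?F" if "0 \<le> t" "t \<le> 1" for t
    using convexD[OF convex_Finf_d F0 F1, of "1 - t" t] that by (simp add: L_def X_def Y_def)
  have Dinv: "invertible (D t)" if "0 \<le> t" "t \<le> 1" for t
    unfolding D_def by (rule convex_point_gap_invertible[OF seg[OF that]])
  note DI = matrix_inv_inverse[OF Dinv]
  have h0: "h 0 = K"
  proof -
    have "Y0 ** X0 + N ** U = mat 1" using co by (simp add: coordinates_def)
    then have "N ** U = D 0" by (simp add: D_def X_def Y_def eq_diff_eq add.commute)
    then have "N = D 0 ** Ui" by (metis Uinv(1) matrix_mul_assoc matrix_mul_rid)
    then have "(U ** matrix_inv (D 0)) ** N = U ** (matrix_inv (D 0) ** D 0) ** Ui"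
      by (simp add: matrix_mul_assoc)
    also have "\<dots> = mat 1" using DI(2)[of 0] by (simp add: Uinv)
    finally show ?thesis
      using policy_of_coordinates[OF co _ Uinv(1)] by (simp add: h_def L_def X_def Y_def)
  qed
  have desc: "?J (h t) \<le> ?J (h 0) - (?J K - g) * t" if t: "0 < t" "t \<le> 1" for t
  proof -
    have t': "0 \<le> t" using t by simp
    have NU: "Y t ** X t + (D t ** Ui) ** U = mat 1"
      by (simp add: matrix_mul_assoc[symmetric] Uinv) (simp add: D_def)
    have "(D t ** Ui) ** (U ** matrix_inv (D t)) = D t ** (Ui ** U) ** matrix_inv (D t)"
      by (simp add: matrix_mul_assoc)
    also have "\<dots> = mat 1" using DI(1)[OF t' t(2)] by (simp add: Uinv)
    finally have "coordinates A B C (h t) (L t) (X t) (Y t) U (D t ** Ui)"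
      unfolding h_def by (intro coordinates_policy_of NU Uinv)
    from convex_point_to_policy(2)[OF R V ctr obs seg[OF t' t(2)] this U]
    show ?thesis by (simp add: h0 algebra_simps)
  qed
  have rate: "0 < ?J K - g" using g(2) by simp
  have rdL: "right_differentiable L" "right_differentiable X" "right_differentiable Y"
    unfolding L_def X_def Y_def by (rule right_differentiable_segment)+
  have rdD: "right_differentiable D" unfolding D_def
    by (intro right_differentiable_diff right_differentiable_mult right_differentiable_const rdL)
  have sublin: "linear sub11" "linear sub12" "linear sub21" "linear sub22"
    by (auto intro!: linearI simp: sub_linear)
  note rdsub = sublin[THEN linear_linear[THEN iffD2], THEN right_differentiable_linear, OF rdL(1)]
  have "right_differentiable h"
  proof -
    have rd2: "right_differentiable (\<lambda>t. block2 (f1 t) (f2 t) (f3 t) (f4 t))"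
      if "right_differentiable f1" "right_differentiable f2" "right_differentiable f3" "right_differentiable f4"
      for f1 :: "real \<Rightarrow> real^'p^'m" and f2 :: "real \<Rightarrow> real^'n^'m" and f3 :: "real \<Rightarrow> real^'p^'n" and f4 :: "real \<Rightarrow> real^'n^'n"
    proof -
      have lin: "linear (\<lambda>M :: real^'p^'m. block2 M 0 0 (0 :: real^'n^'n))" "linear (\<lambda>M :: real^'n^'m. block2 0 M 0 (0 :: real^'n^'n) :: real^('p + 'n)^('m + 'n))"
        "linear (\<lambda>M :: real^'p^'n. block2 0 0 M (0 :: real^'n^'n) :: real^('p + 'n)^('m + 'n))" "linear (\<lambda>M :: real^'n^'n. block2 0 0 0 M :: real^('p + 'n)^('m + 'n))"
        by (auto intro!: linearI simp flip: block2_linear)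
      have eq: "block2 a b c d = block2 a 0 0 0 + block2 0 b 0 0 + block2 0 0 c 0 + block2 0 0 0 d"
        for a :: "real^'p^'m" and b :: "real^'n^'m" and c :: "real^'p^'n" and d :: "real^'n^'n"
        by (simp flip: block2_linear)
      note L = lin[THEN linear_linear[THEN iffD2]]
      show ?thesis
        by (subst eq, intro right_differentiable_add that right_differentiable_linear[OF L(1)]
          right_differentiable_linear[OF L(2)] right_differentiable_linear[OF L(3)] right_differentiable_linear[OF L(4)])
    qed
    have rdi: "right_differentiable (\<lambda>t. matrix_inv (D t))"
      by (rule right_differentiable_matrix_inv[OF rdD Dinv])
    show ?thesis unfolding h_def policy_of_def
      by (intro rd2 right_differentiable_add right_differentiable_diff right_differentiable_mult
          right_differentiable_const rdL rdsub rdi)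
  qed
  then obtain v where v: "((\<lambda>s. (h s - h 0) /\<^sub>R s) \<longlongrightarrow> v) (at_right 0)"
    unfolding right_differentiable_def by blast
  interpret affine_system "Acl A B C" "Acl 0 B C" "Bcl B W V" "\<lambda>v. Bcl B W V v - Bcl B W V 0"
    "Ccl C Q R" "\<lambda>v. Ccl C Q R v - Ccl C Q R 0" "Dcl R V" "Dcl R V"
    by (rule closed_loop_affine)
  have cost: "cost = ?J" by (simp add: fun_eq_iff cost_def Jinf_transfer)
  have "hurwitz (Acl A B C K)" using K by (simp add: nondegenerate_def stabilizing_def)
  then obtain k where rb: "resolvent_bound (Acl A B C (h 0)) k"
    using hurwitz_resolvent_bound h0 by metis
  obtain e M q where "0 < e" "0 \<le> M" "0 \<le> q"
    and "\<And>x y. x \<in> ball (h 0) e \<Longrightarrow> y \<in> ball (h 0) e \<Longrightarrow> ?J x \<le> ?J y + M * norm (x - y)"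
    and "\<And>y v s t. y \<in> ball (h 0) e \<Longrightarrow> y + s *\<^sub>R v \<in> ball (h 0) e \<Longrightarrow> 0 < t \<Longrightarrow> t \<le> s \<Longrightarrow>
      ?J (y + t *\<^sub>R v) \<le> (1 - t / s) * ?J y + t / s * ?J (y + s *\<^sub>R v) + q * t * s * (norm v)\<^sup>2"
    by (rule cost_lipschitz_weakly_convex[OF rb, unfolded cost]) blast
  then have "0 \<notin> clarke_subdiff ?J (h 0)"
    by (rule descent_curve_not_stationary[OF _ _ _ _ _ v desc rate])
  then show ?thesis by (simp add: h0)
qed

theorem corollary4p3:
  fixes A :: "real ^ 'n ^ 'n" and B :: "real ^ 'm ^ 'n" and C :: "real ^ 'n ^ 'p"
    and Q W :: "real ^ 'n ^ 'n" and R :: "real ^ 'm ^ 'm" and V :: "real ^ 'p ^ 'p"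
  assumes "pos_semidef Q" and "pos_def R" and "pos_semidef W" and "pos_def V"
    and "controllable A (msqrt W)" and "controllable A B"
    and "observable (msqrt Q) A" and "observable C A"
  shows "convex (Finf_d A B C Q R W V)
    \<and> (INF K\<in>stabilizing A B C. ereal (Jinf A B C Q R W V K))
        = (INF (\<gamma>, \<Lambda>, X, Y)\<in>Finf_d A B C Q R W V. ereal \<gamma>)
    \<and> (\<forall>K\<in>stabilizing A B C.
         nondegenerate A B C Q R W V K \<and> 0 \<in> clarke_subdiff (Jinf A B C Q R W V) K
         \<longrightarrow> (\<forall>K'\<in>stabilizing A B C. Jinf A B C Q R W V K \<le> Jinf A B C Q R W V K'))"
proof (intro conjI)
  show "convex (Finf_d A B C Q R W V)" by (rule convex_Finf_d)
  show "(INF K\<in>stabilizing A B C. ereal (Jinf A B C Q R W V K))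
      = (INF (\<gamma>, \<Lambda>, X, Y)\<in>Finf_d A B C Q R W V. ereal \<gamma>)" (is "?l = ?r")
  proof (rule antisym)
    show "?l \<le> ?r"
    proof (rule INF_greatest)
      fix p assume p: "p \<in> Finf_d A B C Q R W V"
      obtain g L X Y where pe: "p = (g, L, X, Y)" by (cases p)
      with p have F: "(g, L, X, Y) \<in> Finf_d A B C Q R W V" by simp
      define N where "N = mat 1 - Y ** X"
      define K where "K = policy_of A B C L X Y (mat 1) (matrix_inv N)"
      have "invertible N" unfolding N_def by (rule convex_point_gap_invertible[OF F])
      then have "coordinates A B C K L X Y (mat 1) N" unfolding K_def
        by (intro coordinates_policy_of matrix_inv_inverse) (simp_all add: N_def)
      moreover have "invertible (mat 1 :: real^'n^'n)" unfolding invertible_def by (intro exI[of _ "mat 1"]) simp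
      ultimately have "K \<in> stabilizing A B C" "Jinf A B C Q R W V K \<le> g"
        using convex_point_to_policy[OF assms(2,4,5,7) F] by blast+
      then show "?l \<le> (case p of (\<gamma>, \<Lambda>, X, Y) \<Rightarrow> ereal \<gamma>)"
        by (simp add: pe INF_lower2)
    qed
    show "?r \<le> ?l"
    proof (rule INF_greatest)
      fix K assume K: "K \<in> stabilizing A B C"
      show "?r \<le> ereal (Jinf A B C Q R W V K)"
      proof (rule ereal_le_epsilon2)
        fix e :: real assume "0 < e"
        then have "Jinf A B C Q R W V K < Jinf A B C Q R W V K + e" by simp
        then obtain L X Y where F: "(Jinf A B C Q R W V K + e, L, X, Y) \<in> Finf_d A B C Q R W V"
          by (rule policy_to_convex_point[OF K])
        show "?r \<le> ereal (Jinf A B C Q R W V K) + ereal e" by (rule INF_lower2[OF F]) simp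
      qed
    qed
  qed
  show "\<forall>K\<in>stabilizing A B C.
         nondegenerate A B C Q R W V K \<and> 0 \<in> clarke_subdiff (Jinf A B C Q R W V) K
         \<longrightarrow> (\<forall>K'\<in>stabilizing A B C. Jinf A B C Q R W V K \<le> Jinf A B C Q R W V K')"
    using nondegenerate_stationary_optimal[OF assms(2,4,5,7)] by (meson linorder_not_less)
qed

end
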